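(* Let $K=\mathbb{S}^1$ be the circle group. Let $V$ be a unitary $K$-module with $V^K=\{0\}$ such that the corresponding symplectic quotient $M_0$ has real dimension at least $4$. Then there does not exist a regular diffeomorphism between $M_0$ and a linear symplectic orbifold.
   Context: A unitary $K$-module is a finite-dimensional hermitian vector space $V$ with a homomorphism $K\to \mathrm{U}(V)$. Symplectic quotient. View $V$ as a real symplectic vector space with symplectic form the imaginary part of the hermitian form (up to normalization). Let $J\colon V\to\mathfrak{k}^*$ be the homogeneous quadratic moment map, $M=J^{-1}(0)$, and $M_0=M/K$. Put $\mathcal{C}^\infty(M_0)=\mathcal{C}^\infty(V)^K/\mathcal{I}_M^K$, where $\mathcal{I}_M$ is the ideal of smooth functions vanishing on $M$ and $\mathcal{I}_M^K=\mathcal{I}_M\cap\mathcal{C}^\infty(V)^K$. The algebra of regular functions $\mathbb{R}[M_0]\subset\mathcal{C}^\infty(M_0)$ is the image of $\mathbb{R}[V]^K$ (real polynomial invariants on the real vector space underlying $V$), i.e. $\mathbb{R}[V]^K/\mathcal{J}^K$, where $\mathcal{J}$ is the vanishing ideal of $M$ in $\mathbb{R}[V]$ and $\mathcal{J}^K=\mathcal{J}\cap\mathbb{R}[V]^K$. The space $M_0$ is stratified by orbit type into smooth (symplectic) manifolds, and its dimension is the maximal dimension of a stratum. A diffeomorphism between symplectic quotients $M_0$, $N_0$ is a homeomorphism $\chi\colon M_0\to N_0$ such that pullback induces an isomorphism $\chi^*\colon\mathcal{C}^\infty(N_0)\to\mathcal{C}^\infty(M_0)$; it is regular if $\chi^*$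 restricts to an isomorphism $\mathbb{R}[N_0]\to\mathbb{R}[M_0]$. A linear symplectic orbifold is a quotient $W/H$ with $H$ a finite group and $W$ a unitary $H$-module; it is the symplectic quotient of $W$ by $H$ (the moment map is trivial), with $\mathcal{C}^\infty(W/H)=\mathcal{C}^\infty(W)^H$ and $\mathbb{R}[W/H]=\mathbb{R}[W]^H$. *)

theory Defs
  imports
    "HOL-Analysis.Analysis"
    "HOL-Algebra.QuotRing"
    "HOL-Algebra.Group_Action"
begin

section \<open>Unitary modules\<close>

text \<open>The norm topology and the real structure of \<open>'v\<close> are those of the hermitian form.  Spaces of
  dimension zero are included (this is why \<open>'v\<close> is not required to be a euclidean space).\<close>

locale hermitian_space = vector_space cscale
  for cscale :: "complex \<Rightarrow> 'v::real_inner \<Rightarrow> 'v" +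
  fixes h :: "'v \<Rightarrow> 'v \<Rightarrow> complex"
  assumes scale_of_real: "cscale (of_real r) x = r *\<^sub>R x"
    and form_add_left: "h (x + y) z = h x z + h y z"
    and form_scale_left: "h (cscale c x) y = c * h x y"
    and form_hermitian: "h x y = cnj (h y x)"
    and Re_form: "Re (h x y) = x \<bullet> y"
    and finite_dim: "\<exists>B. finite B \<and> span B = UNIV"

definition unitary_group ::
    "(complex \<Rightarrow> 'v::real_inner \<Rightarrow> 'v) \<Rightarrow> ('v \<Rightarrow> 'v \<Rightarrow> complex) \<Rightarrow> ('v \<Rightarrow> 'v) monoid" where
  "unitary_group cscale h =
     \<lparr>carrier = {T. Vector_Spaces.linear cscale cscale T \<and> bij T \<and> (\<forall>x y. h (T x) (T y) = h x y)},
      mult = (\<circ>), one = id\<rparr>"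

locale unitary_module = hermitian_space cscale h + group G
  for cscale :: "complex \<Rightarrow> 'v::real_inner \<Rightarrow> 'v"
    and h :: "'v \<Rightarrow> 'v \<Rightarrow> complex"
    and G :: "('g, 'b) monoid_scheme"
    and \<rho> :: "'g \<Rightarrow> 'v \<Rightarrow> 'v" +
  assumes rep_hom: "\<rho> \<in> hom G (unitary_group cscale h)"

definition circle_group :: "complex monoid" where
  "circle_group = \<lparr>carrier = sphere 0 1, mult = (*), one = 1\<rparr>"

text \<open>A representation of the Lie group \<open>S\<^sup>1\<close> is a continuous homomorphism.  In finite
  dimension it suffices to require continuity of each orbit map.\<close>

locale unitary_circle_module = unitary_module cscale h circle_group \<rho>
  for cscale :: "complex \<Rightarrow> 'v::real_inner \<Rightarrow> 'v"
    and h :: "'v \<Rightarrow> 'v \<Rightarrow> complex"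
    and \<rho> :: "complex \<Rightarrow> 'v \<Rightarrow> 'v" +
  assumes rep_continuous: "continuous_on (sphere 0 1) (\<lambda>z. \<rho> z v)"

definition fixed_points :: "('g, 'b) monoid_scheme \<Rightarrow> ('g \<Rightarrow> 'v \<Rightarrow> 'v) \<Rightarrow> 'v set" where
  "fixed_points G \<rho> = {v. \<forall>g\<in>carrier G. \<rho> g v = v}"


section \<open>The moment map of a circle action\<close>

text \<open>The Lie algebra of \<open>S\<^sup>1\<close> and its dual are identified with \<open>\<real>\<close>, the exponential map
  being \<open>cis\<close>.  With the symplectic form \<open>\<omega> = Im h\<close>, the homogeneous quadratic moment map is
  \<open>J(v)(\<xi>) = \<omega>(\<xi> v, v) / 2\<close>.  Another normalization of \<open>\<omega>\<close> does not change its zero fibre.\<close>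

definition infinitesimal_action :: "(complex \<Rightarrow> 'v::real_normed_vector \<Rightarrow> 'v) \<Rightarrow> 'v \<Rightarrow> 'v" where
  "infinitesimal_action \<rho> v = vector_derivative (\<lambda>t::real. \<rho> (cis t) v) (at 0)"

definition moment_map ::
    "('v \<Rightarrow> 'v \<Rightarrow> complex) \<Rightarrow> (complex \<Rightarrow> 'v::real_normed_vector \<Rightarrow> 'v) \<Rightarrow> 'v \<Rightarrow> real" where
  "moment_map h \<rho> v = Im (h (infinitesimal_action \<rho> v) v) / 2"

definition zero_fibre ::
    "('v \<Rightarrow> 'v \<Rightarrow> complex) \<Rightarrow> (complex \<Rightarrow> 'v::real_normed_vector \<Rightarrow> 'v) \<Rightarrow> 'v set" where
  "zero_fibre h \<rho> = {v. moment_map h \<rho> v = 0}"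


section \<open>Quotient spaces and their orbit type stratification\<close>

text \<open>A symplectic quotient is given by a group \<open>G\<close>, its action \<open>\<rho>\<close> on the module and the zero
  fibre \<open>M\<close> of the moment map.  For a finite group the moment map is trivial and \<open>M = UNIV\<close>.  The
  points of the quotient are the orbits in \<open>M\<close>; it carries the quotient topology.\<close>

definition orbit_space ::
    "('g, 'b) monoid_scheme \<Rightarrow> ('g \<Rightarrow> 'v \<Rightarrow> 'v::topological_space) \<Rightarrow> 'v set \<Rightarrow> 'v set topology" where
  "orbit_space G \<rho> M = topology (\<lambda>U. U \<subseteq> orbits G M \<rho> \<and>
      openin (top_of_set M) {x \<in> M. orbit G \<rho> x \<in> U})"

lemma openin_orbit_space:
  "openin (orbit_space G \<rho> M) U \<longleftrightarrow>
     U \<subseteq> orbits G M \<rho> \<and> openin (top_of_set M) {x \<in> M. orbit G \<rho> x \<in> U}"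
proof -
  let ?P = "\<lambda>U. U \<subseteq> orbits G M \<rho> \<and> openin (top_of_set M) {x \<in> M. orbit G \<rho> x \<in> U}"
  have "istopology ?P"
    unfolding istopology_def
  proof (intro conjI allI impI)
    fix S T assume "?P S" "?P T"
    moreover have "{x \<in> M. orbit G \<rho> x \<in> S \<inter> T} =
        {x \<in> M. orbit G \<rho> x \<in> S} \<inter> {x \<in> M. orbit G \<rho> x \<in> T}"
      by blast
    ultimately show "S \<inter> T \<subseteq> orbits G M \<rho>"
      "openin (top_of_set M) {x \<in> M. orbit G \<rho> x \<in> S \<inter> T}"
      by auto
  next
    fix \<K> assume K: "\<forall>S\<in>\<K>. ?P S"
    then show "\<Union>\<K> \<subseteq> orbits G M \<rho>" by blast
    have "{x \<in> M. orbit G \<rho> x \<in> \<Union>\<K>} = (\<Union>S\<in>\<K>. {x \<in> M. orbit G \<rho> x \<in> S})"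
      by blast
    then show "openin (top_of_set M) {x \<in> M. orbit G \<rho> x \<in> \<Union>\<K>}"
      using K by auto
  qed
  then show ?thesis
    by (simp add: orbit_space_def topology_inverse')
qed

lemma topspace_orbit_space: "topspace (orbit_space G \<rho> M) = orbits G M \<rho>"
proof -
  have "{x \<in> M. orbit G \<rho> x \<in> orbits G M \<rho>} = M"
    by (auto simp: orbits_def)
  then have "openin (orbit_space G \<rho> M) (orbits G M \<rho>)"
    by (simp add: openin_orbit_space)
  then show ?thesis
    by (metis openin_orbit_space openin_subset openin_topspace subset_antisym)
qed

lemma quotient_map_orbit_space: "quotient_map (top_of_set M) (orbit_space G \<rho> M) (orbit G \<rho>)"
  by (auto simp: quotient_map_def topspace_orbit_space openin_orbit_space orbits_def)

text \<open>The stabilizers of the points of an orbit form a conjugacy class of subgroups, so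
  \<open>stratum G \<rho> M L\<close> consists of the orbits with isotropy type \<open>(L)\<close>.\<close>

definition stratum ::
    "('g, 'b) monoid_scheme \<Rightarrow> ('g \<Rightarrow> 'v \<Rightarrow> 'v) \<Rightarrow> 'v set \<Rightarrow> 'g set \<Rightarrow> 'v set set" where
  "stratum G \<rho> M L = {p \<in> orbits G M \<rho>. \<exists>x\<in>p. stabilizer G \<rho> x = L}"

text \<open>The strata are manifolds whose topology is the subspace topology, so the dimension of a stratum
  at a point is the number of coordinates of any topological chart there.\<close>

definition chart_dims :: "'a topology \<Rightarrow> nat set" where
  "chart_dims X = {d. \<exists>U. openin X U \<and> U \<noteq> {} \<and>
     subtopology X U homeomorphic_space Euclidean_space d}"

definition quotient_dim ::
    "('g, 'b) monoid_scheme \<Rightarrow> ('g \<Rightarrow> 'v \<Rightarrow> 'v::topological_space) \<Rightarrow> 'v set \<Rightarrow> nat" where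
  "quotient_dim G \<rho> M =
     Max (\<Union>L. chart_dims (subtopology (orbit_space G \<rho> M) (stratum G \<rho> M L)))"


section \<open>Smooth and regular functions on a quotient\<close>

fun Ck :: "nat \<Rightarrow> ('v::real_normed_vector \<Rightarrow> real) \<Rightarrow> bool" where
  "Ck 0 f \<longleftrightarrow> continuous_on UNIV f"
| "Ck (Suc k) f \<longleftrightarrow> (\<forall>x. f differentiable (at x)) \<and>
     (\<forall>v. Ck k (\<lambda>x. frechet_derivative f (at x) v))"

definition smooth :: "('v::real_normed_vector \<Rightarrow> real) \<Rightarrow> bool" where
  "smooth f \<longleftrightarrow> (\<forall>k. Ck k f)"

definition invariant ::
    "('g, 'b) monoid_scheme \<Rightarrow> ('g \<Rightarrow> 'v \<Rightarrow> 'v) \<Rightarrow> ('v \<Rightarrow> real) \<Rightarrow> bool" where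
  "invariant G \<rho> f \<longleftrightarrow> (\<forall>g\<in>carrier G. \<forall>x. f (\<rho> g x) = f x)"

text \<open>The ring of smooth invariants of the module.\<close>

definition smooth_invariants ::
    "('g, 'b) monoid_scheme \<Rightarrow> ('g \<Rightarrow> 'v \<Rightarrow> 'v::real_normed_vector) \<Rightarrow> ('v \<Rightarrow> real) ring" where
  "smooth_invariants G \<rho> =
     \<lparr>carrier = {f. smooth f \<and> invariant G \<rho> f},
      mult = (\<lambda>f g x. f x * g x), one = (\<lambda>x. 1), zero = (\<lambda>x. 0), add = (\<lambda>f g x. f x + g x)\<rparr>"

definition vanishing_ideal :: "'v::real_normed_vector set \<Rightarrow> ('v \<Rightarrow> real) set" where
  "vanishing_ideal M = {f. smooth f \<and> (\<forall>x\<in>M. f x = 0)}"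

definition invariant_vanishing_ideal ::
    "('g, 'b) monoid_scheme \<Rightarrow> ('g \<Rightarrow> 'v \<Rightarrow> 'v::real_normed_vector) \<Rightarrow> 'v set \<Rightarrow> ('v \<Rightarrow> real) set" where
  "invariant_vanishing_ideal G \<rho> M = vanishing_ideal M \<inter> carrier (smooth_invariants G \<rho>)"

definition smooth_functions ::
    "('g, 'b) monoid_scheme \<Rightarrow> ('g \<Rightarrow> 'v \<Rightarrow> 'v::real_normed_vector) \<Rightarrow> 'v set \<Rightarrow> ('v \<Rightarrow> real) set ring" where
  "smooth_functions G \<rho> M = smooth_invariants G \<rho> Quot invariant_vanishing_ideal G \<rho> M"

text \<open>The regular functions are the image in \<open>smooth_functions G \<rho> M\<close> of the invariant real
  polynomial functions.\<close>

definition regular_functions ::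
    "('g, 'b) monoid_scheme \<Rightarrow> ('g \<Rightarrow> 'v \<Rightarrow> 'v::real_normed_vector) \<Rightarrow> 'v set \<Rightarrow> ('v \<Rightarrow> real) set ring" where
  "regular_functions G \<rho> M = (smooth_functions G \<rho> M)
     \<lparr>carrier := (\<lambda>f. invariant_vanishing_ideal G \<rho> M +>\<^bsub>smooth_invariants G \<rho>\<^esub> f) `
        {f. real_polynomial_function f \<and> invariant G \<rho> f}\<rparr>"


section \<open>Regular diffeomorphisms\<close>

text \<open>The value of a class of invariant functions at a point of the quotient; all representatives
  of the class are constant on the orbit \<open>p\<close>, with the same value.\<close>

definition class_value :: "('v \<Rightarrow> real) set \<Rightarrow> 'v set \<Rightarrow> real" where
  "class_value \<phi> p = (THE c. \<forall>f\<in>\<phi>. \<forall>x\<in>p. f x = c)"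

text \<open>The pullback of the class \<open>\<phi>\<close> along \<open>F\<close> is the class of all smooth invariants that induce the
  function \<open>\<phi> \<circ> F\<close> on the source.  If there are none, this set is empty and thus no element of
  the quotient ring.\<close>

definition pullback ::
    "('g, 'b) monoid_scheme \<Rightarrow> ('g \<Rightarrow> 'v \<Rightarrow> 'v::real_normed_vector) \<Rightarrow> 'v set \<Rightarrow>
     ('v set \<Rightarrow> 'w set) \<Rightarrow> ('w \<Rightarrow> real) set \<Rightarrow> ('v \<Rightarrow> real) set" where
  "pullback G \<rho> M F \<phi> = {f \<in> carrier (smooth_invariants G \<rho>).
     \<forall>x\<in>M. f x = class_value \<phi> (F (orbit G \<rho> x))}"

text \<open>Ring isomorphisms given by pullback preserve constants and hence are \<open>\<real>\<close>-linear.\<close>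

definition diffeomorphism ::
    "('g, 'b) monoid_scheme \<Rightarrow> ('g \<Rightarrow> 'v \<Rightarrow> 'v::real_normed_vector) \<Rightarrow> 'v set \<Rightarrow>
     ('k, 'c) monoid_scheme \<Rightarrow> ('k \<Rightarrow> 'w \<Rightarrow> 'w::real_normed_vector) \<Rightarrow> 'w set \<Rightarrow>
     ('v set \<Rightarrow> 'w set) \<Rightarrow> bool" where
  "diffeomorphism G \<rho> M H \<sigma> N F \<longleftrightarrow>
     homeomorphic_map (orbit_space G \<rho> M) (orbit_space H \<sigma> N) F \<and>
     pullback G \<rho> M F \<in> ring_iso (smooth_functions H \<sigma> N) (smooth_functions G \<rho> M)"

definition regular_diffeomorphism ::
    "('g, 'b) monoid_scheme \<Rightarrow> ('g \<Rightarrow> 'v \<Rightarrow> 'v::real_normed_vector) \<Rightarrow> 'v set \<Rightarrow>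
     ('k, 'c) monoid_scheme \<Rightarrow> ('k \<Rightarrow> 'w \<Rightarrow> 'w::real_normed_vector) \<Rightarrow> 'w set \<Rightarrow>
     ('v set \<Rightarrow> 'w set) \<Rightarrow> bool" where
  "regular_diffeomorphism G \<rho> M H \<sigma> N F \<longleftrightarrow>
     diffeomorphism G \<rho> M H \<sigma> N F \<and>
     pullback G \<rho> M F \<in> ring_iso (regular_functions H \<sigma> N) (regular_functions G \<rho> M)"

end

theory Submission
  imports Defs "HOL-Computational_Algebra.Fundamental_Theorem_Algebra"
    "HOL-Homology.Invariance_of_Domain"
begin

hide_const (open) up_ring.coeff up_ring.monom module.smult

text \<open>Let \<open>z\<^sub>j\<close> be the coordinates of \<open>V\<close> with respect to an orthonormal basis of weight vectors, and
  \<open>a\<^sub>j\<close> the weights; no weight is zero, and the zero fibre \<open>M\<close> of the moment map is the cone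
  \<open>\<Sum> a\<^sub>j \<bar>z\<^sub>j\<bar>\<^sup>2 = 0\<close>.  If the quotient has dimension at least four, there are three coordinates such that
  \<open>a\<^sub>1\<close> and \<open>a\<^sub>2\<close> have the same sign and \<open>a\<^sub>3\<close> the opposite one (\<open>weights_of_large_quotient\<close>).

  The obstruction is the divisor \<open>z\<^sub>1 = 0\<close>.  No multiple of it is cut out by a single invariant
  function, since no power of \<open>z\<^sub>1\<close> is invariant.  On the quotient of a vector space by a finite group,
  every divisor has such a multiple: on the vector space it has an equation, and the norm of this
  equation is invariant.  So the divisor class groups differ, one having an element of infinite order
  and the other one being a torsion group.

  This is made elementary as follows.  For \<open>c = \<bar>a\<^sub>2\<bar>\<close> and \<open>d = \<bar>a\<^sub>1\<bar>\<close> the monomials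
  \<open>A = (z\<^sub>1 cnj z\<^sub>1)\<^sup>c\<close>, \<open>B = z\<^sub>1\<^sup>c (cnj z\<^sub>2)\<^sup>d\<close>, \<open>C = (cnj z\<^sub>1)\<^sup>c z\<^sub>2\<^sup>d\<close>, \<open>D = (z\<^sub>2 cnj z\<^sub>2)\<^sup>d\<close>
  are invariant, and \<open>A D = B C\<close>.  A regular diffeomorphism turns them into polynomials on \<open>W\<close>
  that are invariant under the finite group and satisfy the same relation.
  Unique factorisation on \<open>W\<close> yields polynomials with \<open>A = p q\<close>, \<open>B = p r\<close>, \<open>C = s q\<close>,
  \<open>D = s r\<close> (\<open>polyfun_four_number\<close>).  Their norms are invariant and satisfy the same relations for
  the \<open>N\<close>-th powers of \<open>A\<close>, \<open>B\<close>, \<open>C\<close>, \<open>D\<close>, where \<open>N\<close> is the order of the group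
  (\<open>invariant_four_number\<close>).  Transferred back to \<open>M\<close>, the norm \<open>P\<close> of \<open>p\<close> is a common divisor of
  \<open>A\<^sup>N\<close> and \<open>B\<^sup>N\<close>, and the relations force it to be a constant times \<open>z\<^sub>1\<^sup>c\<^sup>N\<close> on the span of the three
  weight vectors.  But \<open>P\<close> is invariant and \<open>z\<^sub>1\<^sup>c\<^sup>N\<close> is not (\<open>no_invariant_factorization\<close>).\<close>


section \<open>Unique factorisation in polynomial rings\<close>

locale subring_of_domain =
  fixes R :: "'a::idom set"
  assumes one_mem: "1 \<in> R"
    and diff_mem: "a \<in> R \<Longrightarrow> b \<in> R \<Longrightarrow> a - b \<in> R"
    and mult_mem: "a \<in> R \<Longrightarrow> b \<in> R \<Longrightarrow> a * b \<in> R"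
begin

lemma zero_mem: "0 \<in> R"
  using diff_mem[OF one_mem one_mem] by simp

lemma uminus_mem: "a \<in> R \<Longrightarrow> - a \<in> R"
  using diff_mem[OF zero_mem] by simp

lemma add_mem: "a \<in> R \<Longrightarrow> b \<in> R \<Longrightarrow> a + b \<in> R"
  using diff_mem[of a "- b"] uminus_mem by simp

lemma sum_mem: "(\<And>i. i \<in> I \<Longrightarrow> f i \<in> R) \<Longrightarrow> sum f I \<in> R"
  by (induction I rule: infinite_finite_induct) (auto intro: zero_mem add_mem)

end

text \<open>The rings of polynomials in \<open>m\<close> variables, for all \<open>m\<close>, have to be compared with each other by
  induction on \<open>m\<close>.  They are therefore subrings of one integral domain, and divisibility, units and
  primes are relative to the subring \<open>R\<close>.\<close>

definition divides_in :: "'a::idom set \<Rightarrow> 'a \<Rightarrow> 'a \<Rightarrow> bool" where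
  "divides_in R a b \<longleftrightarrow> (\<exists>c\<in>R. b = a * c)"

definition unit_in :: "'a::idom set \<Rightarrow> 'a \<Rightarrow> bool" where
  "unit_in R a \<longleftrightarrow> a \<in> R \<and> divides_in R a 1"

definition prime_in :: "'a::idom set \<Rightarrow> 'a \<Rightarrow> bool" where
  "prime_in R p \<longleftrightarrow> p \<in> R \<and> p \<noteq> 0 \<and> \<not> unit_in R p \<and>
     (\<forall>a\<in>R. \<forall>b\<in>R. divides_in R p (a * b) \<longrightarrow> divides_in R p a \<or> divides_in R p b)"

text \<open>The number counts the prime factors; the units are the empty products.\<close>

inductive prime_product :: "'a::idom set \<Rightarrow> nat \<Rightarrow> 'a \<Rightarrow> bool" for R where
  unit: "unit_in R u \<Longrightarrow> prime_product R 0 u"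
| prime: "prime_in R p \<Longrightarrow> prime_product R n a \<Longrightarrow> prime_product R (Suc n) (p * a)"

definition factorial_in :: "'a::idom set \<Rightarrow> bool" where
  "factorial_in R \<longleftrightarrow> (\<forall>a\<in>R. a \<noteq> 0 \<longrightarrow> (\<exists>n. prime_product R n a))"

context subring_of_domain
begin

lemma divides_in_trans: "divides_in R a b \<Longrightarrow> divides_in R b c \<Longrightarrow> divides_in R a c"
  unfolding divides_in_def by (metis mult.assoc mult_mem)

lemma divides_in_mult: "divides_in R a b \<Longrightarrow> c \<in> R \<Longrightarrow> divides_in R a (b * c)"
  unfolding divides_in_def by (metis mult.assoc mult_mem)

lemma divides_in_add: "divides_in R a b \<Longrightarrow> divides_in R a c \<Longrightarrow> divides_in R a (b + c)"
  unfolding divides_in_def by (metis distrib_left add_mem)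

lemma divides_in_0: "divides_in R a 0"
  unfolding divides_in_def using zero_mem by force

lemma divides_in_sum: "(\<And>i. i \<in> I \<Longrightarrow> divides_in R a (f i)) \<Longrightarrow> divides_in R a (sum f I)"
  by (induction I rule: infinite_finite_induct) (auto intro: divides_in_0 divides_in_add)

lemma divides_in_diff: "divides_in R a b \<Longrightarrow> divides_in R a c \<Longrightarrow> divides_in R a (b - c)"
  unfolding divides_in_def by (metis right_diff_distrib diff_mem)

lemma unit_in_divisor: "unit_in R u \<Longrightarrow> a \<in> R \<Longrightarrow> divides_in R a u \<Longrightarrow> unit_in R a"
  unfolding unit_in_def using divides_in_trans by blast

lemma unit_in_mult: "unit_in R u \<Longrightarrow> unit_in R v \<Longrightarrow> unit_in R (u * v)"
  unfolding unit_in_def divides_in_def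
  by (metis mult.commute mult.left_commute mult.right_neutral mult_mem)

lemma prime_product_mem: "prime_product R n a \<Longrightarrow> a \<in> R \<and> a \<noteq> 0"
proof (induction rule: prime_product.induct)
  case (unit u)
  then show ?case by (auto simp: unit_in_def divides_in_def)
next
  case (prime p n a)
  then show ?case by (auto simp: prime_in_def intro: mult_mem)
qed

lemma prime_product_unit_mult: "prime_product R n a \<Longrightarrow> unit_in R u \<Longrightarrow> prime_product R n (u * a)"
proof (induction rule: prime_product.induct)
  case (unit v)
  then show ?case by (auto intro: prime_product.unit unit_in_mult)
next
  case (prime p n a)
  then show ?case by (metis mult.left_commute prime_product.prime)
qed

lemma prime_product_mult:
  "prime_product R n a \<Longrightarrow> prime_product R m b \<Longrightarrow> prime_product R (n + m) (a * b)"
proof (induction rule: prime_product.induct)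
  case (unit v)
  then show ?case by (simp add: prime_product_unit_mult)
next
  case (prime p n a)
  then show ?case by (simp add: mult.assoc prime_product.prime)
qed

text \<open>Removing a prime divisor shortens a prime factorisation; this serves as a measure when common
  prime factors are split off one after another.\<close>

lemma prime_product_cancel:
  assumes "prime_product R n (p * b)" "prime_in R p" "b \<in> R"
  shows "\<exists>m. n = Suc m \<and> prime_product R m b"
  using assms
proof (induction n "p * b" arbitrary: b rule: prime_product.induct)
  case unit
  then show ?case
    by (metis divides_in_def unit_in_divisor prime_in_def)
next
  case (prime q n a)
  have p0: "p \<noteq> 0" "p \<in> R" and q: "q \<in> R" "q \<noteq> 0" "\<not> unit_in R q" and a: "a \<in> R"
    using prime prime_product_mem by (auto simp: prime_in_def)
  have "divides_in R p (q * a)"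
    using prime.hyps prime.prems by (auto simp: divides_in_def)
  then consider "divides_in R p q" | "divides_in R p a"
    using prime.prems q a unfolding prime_in_def by blast
  then show ?case
  proof cases
    case 1
    then obtain u where u: "u \<in> R" "q = p * u" by (auto simp: divides_in_def)
    have "divides_in R q (p * u)" using one_mem u(2) by (auto simp: divides_in_def)
    then have "divides_in R q p \<or> divides_in R q u"
      using prime.hyps(1) p0 u by (auto simp: prime_in_def)
    then have "unit_in R u"
    proof
      assume "divides_in R q p"
      then obtain v where "v \<in> R" "p = q * v" by (auto simp: divides_in_def)
      then have "p * 1 = p * (u * v)" using u by (simp add: algebra_simps)
      then have "u * v = 1" using p0(1) by (metis mult_cancel_left)
      then show ?thesis using u \<open>v \<in> R\<close> by (auto simp: unit_in_def divides_in_def)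
    next
      assume "divides_in R q u"
      then obtain v where "v \<in> R" "u = q * v" by (auto simp: divides_in_def)
      then have "q * 1 = q * (p * v)" using u by (simp add: algebra_simps)
      then have "p * v = 1" using q(2) by (metis mult_cancel_left)
      then show ?thesis using prime.prems \<open>v \<in> R\<close> p0
        by (metis divides_in_def unit_in_def prime_in_def)
    qed
    moreover have "b = u * a"
      using prime.hyps(4) u p0 by (simp add: mult.assoc)
    ultimately show ?thesis
      using prime.hyps(2) prime_product_unit_mult by blast
  next
    case 2
    then obtain c where c: "c \<in> R" "a = p * c" by (auto simp: divides_in_def)
    with prime.hyps(3)[OF c(2)] prime.prems obtain m where "n = Suc m" "prime_product R m c"
      by blast
    moreover have "b = q * c"
      using prime.hyps(4) c p0 by (simp add: mult.left_commute)
    ultimately show ?thesis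
      using prime.hyps(1) prime_product.prime by blast
  qed
qed

text \<open>Peeling the prime factors off \<open>a\<close> one at a time, each goes into \<open>b\<close> or into \<open>c\<close>.\<close>

lemma four_number_theorem:
  assumes "prime_product R n a" "a * d = b * c" "b \<in> R" "c \<in> R" "d \<in> R"
  shows "\<exists>p\<in>R. \<exists>q\<in>R. \<exists>r\<in>R. \<exists>s\<in>R. a = p * q \<and> b = p * r \<and> c = s * q \<and> d = s * r"
  using assms
proof (induction arbitrary: b c rule: prime_product.induct)
  case (unit u)
  then obtain v where v: "v \<in> R" "u * v = 1" "u \<in> R"
    by (auto simp: unit_in_def divides_in_def)
  have c: "c = (v * c) * u" using v(2) by (simp add: mult.commute mult.left_commute)
  have "d = v * (u * d)" using v(2) by (simp add: mult.assoc[symmetric] mult.commute[of v])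
  then have d: "d = (v * c) * b" unfolding unit.prems(1) by (simp add: mult.assoc mult.commute)
  then show ?case
    using v unit.prems(2-4) one_mem mult_mem[OF v(1) unit.prems(3)]
    by (intro bexI[of _ 1] bexI[of _ u] bexI[of _ b] bexI[of _ "v * c"] conjI) (simp_all add: c[symmetric] d[symmetric])
next
  case (prime p n a)
  have p: "p \<in> R" "p \<noteq> 0" using prime by (auto simp: prime_in_def)
  have a: "a \<in> R" using prime prime_product_mem by blast
  have "divides_in R p (b * c)"
    using prime.prems a by (metis divides_in_def mult.assoc mult_mem)
  then consider "divides_in R p b" | "divides_in R p c"
    using prime unfolding prime_in_def by blast
  then show ?case
  proof cases
    case 1
    then obtain b' where b': "b' \<in> R" "b = p * b'" by (auto simp: divides_in_def)
    then have "a * d = b' * c" using prime.prems p by (simp add: mult.assoc)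
    then obtain x q r s where "x \<in> R" "q \<in> R" "r \<in> R" "s \<in> R" "a = x * q" "b' = x * r" "c = s * q" "d = s * r"
      using prime.IH[OF _ b'(1) prime.prems(3,4)] by blast
    then show ?thesis
      using b'(2) mult_mem[OF p(1)]
      by (intro bexI[of _ "p * x"] bexI[of _ q] bexI[of _ r] bexI[of _ s]) (simp_all add: mult.assoc)
  next
    case 2
    then obtain c' where c': "c' \<in> R" "c = p * c'" by (auto simp: divides_in_def)
    then have "a * d = b * c'" using prime.prems p by (simp add: mult.assoc mult.left_commute)
    then obtain x q r s where "x \<in> R" "q \<in> R" "r \<in> R" "s \<in> R" "a = x * q" "b = x * r" "c' = s * q" "d = s * r"
      using prime.IH[OF _ prime.prems(2) c'(1) prime.prems(4)] by blast
    then show ?thesis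
      using c'(2) mult_mem[OF p(1)]
      by (intro bexI[of _ x] bexI[of _ "p * q"] bexI[of _ r] bexI[of _ s]) (simp_all add: mult.left_commute)
  qed
qed

end

definition polys_over :: "'a::idom set \<Rightarrow> 'a poly set" where
  "polys_over R = {F. \<forall>i. coeff F i \<in> R}"

lemma (in subring_of_domain) subring_of_domain_polys_over: "subring_of_domain (polys_over R)"
proof
  show "1 \<in> polys_over R"
    using one_mem zero_mem by (auto simp: polys_over_def coeff_pCons split: nat.splits)
  show "F - G \<in> polys_over R" if "F \<in> polys_over R" "G \<in> polys_over R" for F G
    using that diff_mem by (auto simp: polys_over_def)
  show "F * G \<in> polys_over R" if "F \<in> polys_over R" "G \<in> polys_over R" for F G
    using that by (auto simp: polys_over_def coeff_mult intro!: sum_mem mult_mem)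
qed

context subring_of_domain
begin

interpretation poly: subring_of_domain "polys_over R"
  by (rule subring_of_domain_polys_over)

lemma const_mem_polys_over: "c \<in> R \<Longrightarrow> [:c:] \<in> polys_over R"
  using zero_mem by (auto simp: polys_over_def coeff_pCons split: nat.splits)

lemma degree_0_polys_over:
  assumes "F \<in> polys_over R" "degree F = 0"
  obtains c where "c \<in> R" "F = [:c:]"
  using assms by (metis (mono_tags, lifting) degree_0_id mem_Collect_eq polys_over_def)

lemma monom_mem_polys_over: "c \<in> R \<Longrightarrow> monom c n \<in> polys_over R"
  using zero_mem by (auto simp: polys_over_def)

lemma smult_mem_polys_over: "c \<in> R \<Longrightarrow> F \<in> polys_over R \<Longrightarrow> smult c F \<in> polys_over R"
  using mult_mem by (auto simp: polys_over_def)

lemma const_divides_in_iff: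
  assumes "F \<in> polys_over R"
  shows "divides_in (polys_over R) [:c:] F \<longleftrightarrow> (\<forall>i. divides_in R c (coeff F i))"
proof
  assume "divides_in (polys_over R) [:c:] F"
  then obtain G where "G \<in> polys_over R" "F = smult c G"
    by (auto simp: divides_in_def)
  then show "\<forall>i. divides_in R c (coeff F i)"
    by (auto simp: divides_in_def polys_over_def)
next
  assume "\<forall>i. divides_in R c (coeff F i)"
  then show "divides_in (polys_over R) [:c:] F"
  proof (induction F)
    case 0
    then show ?case by (simp add: poly.divides_in_0)
  next
    case (pCons a F)
    have "\<forall>i. divides_in R c (coeff F i)"
      using pCons.prems by (metis coeff_pCons_Suc)
    then obtain G where G: "G \<in> polys_over R" "F = [:c:] * G"
      using pCons.IH unfolding divides_in_def by blast
    obtain b where b: "b \<in> R" "a = c * b"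
      using pCons.prems[rule_format, of 0] by (auto simp: divides_in_def)
    have "pCons b G \<in> polys_over R"
      using G b by (auto simp: polys_over_def coeff_pCons split: nat.splits)
    moreover have "pCons a F = [:c:] * pCons b G" using G b by simp
    ultimately show ?case unfolding divides_in_def by blast
  qed
qed

lemma unit_in_const_iff: "unit_in (polys_over R) [:c:] \<longleftrightarrow> unit_in R c"
proof
  assume "unit_in (polys_over R) [:c:]"
  then have "[:c:] \<in> polys_over R" "divides_in (polys_over R) [:c:] 1"
    by (auto simp: unit_in_def)
  then have "divides_in R c (coeff 1 0)" "c \<in> R"
    using const_divides_in_iff[OF poly.one_mem, of c] apply blast
    using \<open>[:c:] \<in> polys_over R\<close> by (auto simp: polys_over_def dest: spec[of _ 0])
  then show "unit_in R c" by (simp add: unit_in_def)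
next
  assume "unit_in R c"
  then obtain d where "d \<in> R" "c * d = 1" "c \<in> R" by (auto simp: unit_in_def divides_in_def)
  then have "[:c:] * [:d:] = 1" "[:c:] \<in> polys_over R" "[:d:] \<in> polys_over R"
    by (auto simp: const_mem_polys_over mult.commute)
  then show "unit_in (polys_over R) [:c:]" by (metis divides_in_def unit_in_def)
qed

text \<open>Take the first coefficients of \<open>F\<close> and \<open>G\<close> that \<open>p\<close> does not divide, in positions \<open>i\<close> and \<open>j\<close>.
  Modulo \<open>p\<close>, the coefficient of \<open>F * G\<close> in position \<open>i + j\<close> is the product of these two.\<close>

lemma prime_in_const:
  assumes p: "prime_in R p"
  shows "prime_in (polys_over R) [:p:]"
  unfolding prime_in_def
proof (intro conjI ballI impI)
  show "[:p:] \<in> polys_over R" "[:p:] \<noteq> 0" "\<not> unit_in (polys_over R) [:p:]"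
    using p by (auto simp: prime_in_def unit_in_const_iff const_mem_polys_over)
next
  fix F G assume FG: "F \<in> polys_over R" "G \<in> polys_over R"
    and dv: "divides_in (polys_over R) [:p:] (F * G)"
  show "divides_in (polys_over R) [:p:] F \<or> divides_in (polys_over R) [:p:] G"
  proof (rule ccontr)
    assume "\<not> ?thesis"
    then have ex: "\<exists>i. \<not> divides_in R p (coeff F i)" "\<exists>j. \<not> divides_in R p (coeff G j)"
      using FG const_divides_in_iff by blast+
    define i where "i = (LEAST i. \<not> divides_in R p (coeff F i))"
    define j where "j = (LEAST j. \<not> divides_in R p (coeff G j))"
    have i: "\<not> divides_in R p (coeff F i)" "\<And>k. k < i \<Longrightarrow> divides_in R p (coeff F k)"
      using LeastI_ex[OF ex(1)] not_less_Least unfolding i_def by blast+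
    have j: "\<not> divides_in R p (coeff G j)" "\<And>k. k < j \<Longrightarrow> divides_in R p (coeff G k)"
      using LeastI_ex[OF ex(2)] not_less_Least unfolding j_def by blast+
    have mem: "coeff F k \<in> R" "coeff G k \<in> R" for k
      using FG by (auto simp: polys_over_def)
    have rest: "divides_in R p (\<Sum>k\<in>{..i+j}-{i}. coeff F k * coeff G (i + j - k))"
    proof (rule divides_in_sum)
      fix k assume "k \<in> {..i+j}-{i}"
      then have "k < i \<or> i + j - k < j" by auto
      then show "divides_in R p (coeff F k * coeff G (i + j - k))"
        using i(2) j(2) mem divides_in_mult by (metis mult.commute)
    qed
    have total: "divides_in R p (coeff (F * G) (i + j))"
      using dv const_divides_in_iff poly.mult_mem FG by blast
    have split: "coeff (F * G) (i + j) =
        coeff F i * coeff G j + (\<Sum>k\<in>{..i+j}-{i}. coeff F k * coeff G (i + j - k))"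
      unfolding coeff_mult by (subst sum.remove[of _ i]) auto
    have "divides_in R p (coeff F i * coeff G j)"
      using divides_in_diff[OF total rest] unfolding split by simp
    then show False
      using p i(1) j(1) mem unfolding prime_in_def by blast
  qed
qed

definition primitive :: "'a poly \<Rightarrow> bool" where
  "primitive F \<longleftrightarrow> F \<in> polys_over R \<and> F \<noteq> 0 \<and>
     (\<forall>p. prime_in R p \<longrightarrow> \<not> divides_in (polys_over R) [:p:] F)"

text \<open>Each prime constant that is split off also divides the leading coefficient, so the number of prime
  factors of the leading coefficient bounds the number of steps.\<close>

lemma const_times_primitive:
  assumes fac: "factorial_in R" and F: "F \<in> polys_over R" "F \<noteq> 0"
  obtains c G where "c \<in> R" "c \<noteq> 0" "primitive G" "F = [:c:] * G"
proof -
  have "lead_coeff F \<in> R" "lead_coeff F \<noteq> 0"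
    using F by (auto simp: polys_over_def)
  then obtain n where "prime_product R n (lead_coeff F)"
    using fac unfolding factorial_in_def by blast
  with F have "\<exists>c\<in>R. \<exists>G. c \<noteq> 0 \<and> primitive G \<and> F = [:c:] * G"
  proof (induction n arbitrary: F)
    case (0 F)
    have "unit_in R (lead_coeff F)"
      using 0(3) by (cases rule: prime_product.cases) auto
    then have "primitive F"
      using 0 unfolding primitive_def
      by (metis const_divides_in_iff prime_in_def unit_in_divisor)
    then show ?case using one_mem by (intro bexI[of _ 1] exI[of _ F]) auto
  next
    case (Suc n F)
    show ?case
    proof (cases "primitive F")
      case True
      then show ?thesis using one_mem by (intro bexI[of _ 1] exI[of _ F]) auto
    next
      case False
      then obtain p G where p: "prime_in R p" and G: "G \<in> polys_over R" "F = [:p:] * G"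
        using Suc.prems unfolding primitive_def divides_in_def by blast
      have "lead_coeff F = p * lead_coeff G" using G by simp
      then have "prime_product R n (lead_coeff G)"
        using prime_product_cancel[of "Suc n" p "lead_coeff G"] p G Suc.prems
        by (auto simp: polys_over_def)
      moreover have "G \<noteq> 0" using G Suc.prems by auto
      ultimately obtain c G' where c: "c \<in> R" "c \<noteq> 0" "primitive G'" "G = [:c:] * G'"
        using Suc.IH G by blast
      have "F = [:p * c:] * G'" using G(2) c(4) by (simp add: mult.commute)
      moreover have "p * c \<in> R" "p * c \<noteq> 0"
        using p c by (auto simp: prime_in_def intro: mult_mem)
      ultimately show ?thesis using c(3) by blast
    qed
  qed
  then show ?thesis using that by blast
qed

text \<open>Gauss's lemma in the form needed: a constant cannot share a prime factor with a primitive
  polynomial, so each prime factor of \<open>c\<close> cancels against \<open>Q\<close>.\<close>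

lemma primitive_divides_cancel:
  assumes fac: "factorial_in R" and c: "c \<in> R" "c \<noteq> 0" and G: "primitive G"
    and FQ: "F \<in> polys_over R" "Q \<in> polys_over R" "[:c:] * F = G * Q"
  shows "divides_in (polys_over R) G F"
proof -
  obtain n where "prime_product R n c" using fac c by (auto simp: factorial_in_def)
  then show ?thesis using FQ
  proof (induction arbitrary: F Q rule: prime_product.induct)
    case (unit u)
    then obtain v where v: "v \<in> R" "u * v = 1" by (auto simp: unit_in_def divides_in_def)
    have "F = [:v:] * ([:u:] * F)" using v by (simp add: mult.commute)
    also have "\<dots> = G * ([:v:] * Q)" unfolding unit.prems by (simp add: mult.left_commute)
    finally show ?case
      using v unit.prems poly.mult_mem const_mem_polys_over unfolding divides_in_def by blast
  next
    case (prime p n a)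
    have p: "p \<in> R" "p \<noteq> 0" using prime by (auto simp: prime_in_def)
    have a: "a \<in> R" using prime prime_product_mem by blast
    have "G * Q = [:p:] * ([:a:] * F)" using prime.prems by (simp add: mult.commute)
    then have "divides_in (polys_over R) [:p:] (G * Q)"
      using a prime.prems poly.mult_mem const_mem_polys_over unfolding divides_in_def by blast
    then have "divides_in (polys_over R) [:p:] Q"
      using prime_in_const[OF prime.hyps(1)] prime.hyps(1) G prime.prems
      unfolding prime_in_def primitive_def by blast
    then obtain Q' where Q': "Q' \<in> polys_over R" "Q = [:p:] * Q'"
      by (auto simp: divides_in_def)
    have "[:p:] * ([:a:] * F) = [:p:] * (G * Q')"
      using \<open>G * Q = [:p:] * ([:a:] * F)\<close> Q' by (metis mult.left_commute)
    then have "[:a:] * F = G * Q'" using p by (metis mult_cancel_left pCons_eq_0_iff)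
    then show ?case using prime.IH prime.prems(1) Q'(1) by blast
  qed
qed

text \<open>Division with remainder, where multiplication by a nonzero constant \<open>c\<close> makes up for the missing
  inverse of the leading coefficient of \<open>D\<close>.\<close>

lemma pseudo_division:
  assumes D: "D \<in> polys_over R" "D \<noteq> 0" and F: "F \<in> polys_over R"
  obtains c Q S where "c \<in> R" "c \<noteq> 0" "Q \<in> polys_over R" "S \<in> polys_over R"
    "[:c:] * F = D * Q + S" "S = 0 \<or> degree S < degree D"
proof -
  have "\<exists>c\<in>R. \<exists>Q\<in>polys_over R. \<exists>S\<in>polys_over R.
      c \<noteq> 0 \<and> [:c:] * F = D * Q + S \<and> (S = 0 \<or> degree S < degree D)"
    using F
  proof (induction "degree F" arbitrary: F rule: less_induct)
    case (less F)
    show ?case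
    proof (cases "F = 0 \<or> degree F < degree D")
      case True
      then show ?thesis using one_mem poly.zero_mem less.prems
        by (intro bexI[of _ 1] bexI[of _ 0] bexI[of _ F]) auto
    next
      case False
      define k where "k = degree F - degree D"
      define b where "b = lead_coeff D"
      define M where "M = monom (lead_coeff F) k"
      define F' where "F' = [:b:] * F - M * D"
      have b: "b \<in> R" "b \<noteq> 0" using D by (auto simp: b_def polys_over_def)
      have M: "M \<in> polys_over R" "M \<noteq> 0"
        using less.prems False by (auto simp: M_def polys_over_def monom_eq_0_iff intro: monom_mem_polys_over zero_mem)
      have F': "F' \<in> polys_over R"
        using b M D less.prems unfolding F'_def
        by (intro poly.diff_mem poly.mult_mem const_mem_polys_over)
      have degM: "degree (M * D) = degree F"
        using M D False by (simp add: degree_mult_eq M_def k_def degree_monom_eq)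
      have lcM: "lead_coeff (M * D) = b * lead_coeff F"
        unfolding lead_coeff_mult using False by (simp add: M_def b_def degree_monom_eq)
      have rec: "\<exists>c\<in>R. \<exists>Q\<in>polys_over R. \<exists>S\<in>polys_over R.
        c \<noteq> 0 \<and> [:c:] * F' = D * Q + S \<and> (S = 0 \<or> degree S < degree D)"
      proof (cases "F' = 0")
        case True
        then show ?thesis using one_mem poly.zero_mem
          by (intro bexI[of _ 1] bexI[of _ 0] bexI[of _ 0]) auto
      next
        case nz: False
        have "degree F' \<le> degree F"
          unfolding F'_def using degM b by (intro degree_diff_le) auto
        moreover have "coeff F' (degree F) = 0"
          using lcM degM unfolding F'_def by simp
        ultimately have "degree F' < degree F"
          using nz by (metis le_neq_implies_less leading_coeff_0_iff)
        then show ?thesis using less.hyps F' by blast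
      qed
      then obtain c Q S where r: "c \<in> R" "Q \<in> polys_over R" "S \<in> polys_over R" "c \<noteq> 0"
        "[:c:] * F' = D * Q + S" "S = 0 \<or> degree S < degree D" by blast
      have "[:c * b:] * F = [:c:] * ([:b:] * F)" by (simp add: mult.commute)
      also have "\<dots> = [:c:] * F' + [:c:] * (M * D)" unfolding F'_def by (simp add: algebra_simps)
      also have "\<dots> = D * (Q + [:c:] * M) + S" using r(5) by (simp add: algebra_simps)
      finally have "[:c * b:] * F = D * (Q + [:c:] * M) + S" .
      moreover have "c * b \<in> R" "c * b \<noteq> 0" "Q + [:c:] * M \<in> polys_over R"
        using r b M by (auto intro!: mult_mem poly.add_mem smult_mem_polys_over)
      ultimately show ?thesis using r by blast
    qed
  qed
  then show ?thesis using that by blast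
qed

text \<open>The element of least degree of the ideal generated by \<open>F\<close> and \<open>G\<close> divides both up to constants
  of \<open>R\<close>, hence, made primitive, divides both.  As \<open>F\<close> has no proper factors, either this common
  divisor is associated to \<open>F\<close>, or a nonzero constant is a combination of \<open>F\<close> and \<open>G\<close>.\<close>

lemma primitive_irreducible_prime:
  assumes fac: "factorial_in R" and F: "primitive F" "0 < degree F"
    and irr: "\<And>A B. A \<in> polys_over R \<Longrightarrow> B \<in> polys_over R \<Longrightarrow> F = A * B \<Longrightarrow> degree A = 0 \<or> degree B = 0"
  shows "prime_in (polys_over R) F"
  unfolding prime_in_def
proof (intro conjI ballI impI)
  show FS: "F \<in> polys_over R" and F0: "F \<noteq> 0" using F by (auto simp: primitive_def)
  show "\<not> unit_in (polys_over R) F"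
  proof
    assume "unit_in (polys_over R) F"
    then obtain G where "F * G = 1" by (auto simp: unit_in_def divides_in_def)
    then show False using F(2) F0 by (metis degree_1 degree_mult_eq mult_zero_right not_gr_zero add_is_0 one_neq_zero)
  qed
  fix G H assume G: "G \<in> polys_over R" and H: "H \<in> polys_over R"
    and dv: "divides_in (polys_over R) F (G * H)"
  then obtain W where W: "W \<in> polys_over R" "G * H = F * W" by (auto simp: divides_in_def)
  define I where "I = {D. \<exists>U\<in>polys_over R. \<exists>V\<in>polys_over R. D = U * F + V * G}"
  have IR: "I \<subseteq> polys_over R" using FS G unfolding I_def
    by (auto intro!: poly.add_mem poly.mult_mem)
  have "F = 1 * F + 0 * G" "G = 0 * F + 1 * G" by simp_all
  then have FI: "F \<in> I" and GI: "G \<in> I" unfolding I_def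
    using poly.one_mem poly.zero_mem by blast+
  obtain D where D: "D \<in> I" "D \<noteq> 0" and Dmin: "\<And>E. E \<in> I \<Longrightarrow> E \<noteq> 0 \<Longrightarrow> degree D \<le> degree E"
    using ex_has_least_nat[of "\<lambda>D. D \<in> I \<and> D \<noteq> 0" F degree] FI F0 by blast
  have DR: "D \<in> polys_over R" using D IR by blast
  obtain e D0 where e: "e \<in> R" "e \<noteq> 0" and D0: "primitive D0" "D = [:e:] * D0"
    using const_times_primitive[OF fac DR D(2)] .
  have div: "divides_in (polys_over R) D0 X" if X: "X \<in> I" for X
  proof -
    have XR: "X \<in> polys_over R" using X IR by blast
    obtain c Q S where c: "c \<in> R" "c \<noteq> 0" "Q \<in> polys_over R" "S \<in> polys_over R"
      "[:c:] * X = D * Q + S" "S = 0 \<or> degree S < degree D"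
      using pseudo_division[OF DR D(2) XR] .
    obtain U V where UV: "U \<in> polys_over R" "V \<in> polys_over R" "X = U * F + V * G"
      using X unfolding I_def by blast
    obtain U' V' where UV': "U' \<in> polys_over R" "V' \<in> polys_over R" "D = U' * F + V' * G"
      using D unfolding I_def by blast
    have "S = ([:c:] * U - Q * U') * F + ([:c:] * V - Q * V') * G"
      using c(5) UV(3) UV'(3) by (simp add: algebra_simps)
    moreover have "[:c:] * U - Q * U' \<in> polys_over R" "[:c:] * V - Q * V' \<in> polys_over R"
      using c UV UV' by (auto intro!: poly.diff_mem smult_mem_polys_over poly.mult_mem)
    ultimately have "S \<in> I" unfolding I_def by blast
    then have "S = 0" using Dmin c(6) by (meson leD)
    then have "[:c:] * X = D0 * ([:e:] * Q)" using c(5) D0(2) by (simp add: mult.left_commute)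
    then show ?thesis
      using primitive_divides_cancel[OF fac c(1,2) D0(1) XR] c(3) e const_mem_polys_over poly.mult_mem
      by blast
  qed
  obtain B where B: "B \<in> polys_over R" "F = D0 * B" using div[OF FI] by (auto simp: divides_in_def)
  have D0R: "D0 \<in> polys_over R" using D0 by (simp add: primitive_def)
  from irr[OF D0R B] show "divides_in (polys_over R) F G \<or> divides_in (polys_over R) F H"
  proof
    assume "degree D0 = 0"
    then obtain d where d: "d \<in> R" "D0 = [:d:]" using degree_0_polys_over[OF D0R] by blast
    obtain U V where UV: "U \<in> polys_over R" "V \<in> polys_over R" "D = U * F + V * G"
      using D unfolding I_def by blast
    have "[:e * d:] * H = D * H" using D0 d by (simp add: mult.commute)
    also have "\<dots> = F * (U * H + V * W)"
      using UV(3) W(2) by (simp add: algebra_simps)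
    finally have "[:e * d:] * H = F * (U * H + V * W)" .
    moreover have "e * d \<in> R" "e * d \<noteq> 0" "U * H + V * W \<in> polys_over R"
      using e d D0(1) UV H W by (auto simp: primitive_def intro!: mult_mem poly.add_mem poly.mult_mem)
    ultimately have "divides_in (polys_over R) F H"
      using primitive_divides_cancel[OF fac _ _ F(1) H] by blast
    then show ?thesis ..
  next
    assume "degree B = 0"
    then obtain b where b: "b \<in> R" "B = [:b:]" using degree_0_polys_over[OF B(1)] by blast
    have b0: "b \<noteq> 0" using b B F0 by auto
    obtain C where C: "C \<in> polys_over R" "G = D0 * C" using div[OF GI] by (auto simp: divides_in_def)
    have "[:b:] * G = F * C" using B(2) C(2) b(2) by (simp add: mult.commute)
    then have "divides_in (polys_over R) F G"
      using primitive_divides_cancel[OF fac b(1) b0 F(1) G C(1)] by blast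
    then show ?thesis ..
  qed
qed

text \<open>Gauss's theorem, by induction on the degree: the content of a polynomial factors in \<open>R\<close>, and its
  primitive part either splits into factors of lower degree or has no proper factors and is prime.\<close>

theorem factorial_in_polys_over:
  assumes fac: "factorial_in R"
  shows "factorial_in (polys_over R)"
  unfolding factorial_in_def
proof (intro ballI impI)
  have const: "\<exists>n. prime_product (polys_over R) n [:c:]" if "c \<in> R" "c \<noteq> 0" for c
  proof -
    obtain n where "prime_product R n c" using fac \<open>c \<in> R\<close> \<open>c \<noteq> 0\<close> unfolding factorial_in_def by blast
    then have "prime_product (polys_over R) n [:c:]"
    proof (induction rule: prime_product.induct)
      case (unit u)
      then show ?case by (simp add: prime_product.unit unit_in_const_iff)
    next
      case (prime p n a)
      then show ?case using prime_product.prime[OF prime_in_const] by fastforce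
    qed
    then show ?thesis ..
  qed
  fix F assume "F \<in> polys_over R" "F \<noteq> 0"
  then show "\<exists>n. prime_product (polys_over R) n F"
  proof (induction "degree F" arbitrary: F rule: less_induct)
    case (less F)
    obtain c G where c: "c \<in> R" "c \<noteq> 0" and G: "primitive G" "F = [:c:] * G"
      using const_times_primitive[OF fac less.prems] .
    have degG: "degree G = degree F" using c G by simp
    have GR: "G \<in> polys_over R" "G \<noteq> 0" using G by (auto simp: primitive_def)
    have "\<exists>n. prime_product (polys_over R) n G"
    proof (cases "\<exists>A\<in>polys_over R. \<exists>B\<in>polys_over R. G = A * B \<and> degree A \<noteq> 0 \<and> degree B \<noteq> 0")
      case True
      then obtain A B where AB: "A \<in> polys_over R" "B \<in> polys_over R" "G = A * B" "degree A \<noteq> 0" "degree B \<noteq> 0"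
        by blast
      have "A \<noteq> 0" "B \<noteq> 0" using AB GR by auto
      moreover from this have "degree A < degree F" "degree B < degree F"
        using degree_mult_eq[of A B] AB degG by auto
      ultimately obtain m n where "prime_product (polys_over R) m A" "prime_product (polys_over R) n B"
        using less.hyps AB by meson
      then show ?thesis using poly.prime_product_mult AB(3) by blast
    next
      case irr: False
      show ?thesis
      proof (cases "degree G = 0")
        case True
        then obtain g where "g \<in> R" "G = [:g:]" using degree_0_polys_over[OF GR(1)] by blast
        then show ?thesis using const GR(2) by auto
      next
        case False
        then have "prime_in (polys_over R) G"
          using primitive_irreducible_prime[OF fac G(1)] irr by blast
        moreover have "prime_product (polys_over R) 0 1"
          using poly.one_mem by (intro prime_product.unit) (auto simp: unit_in_def divides_in_def)
        ultimately show ?thesis using prime_product.prime by fastforce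
      qed
    qed
    then show ?case using const[OF c] poly.prime_product_mult G(2) by blast
  qed
qed

end


section \<open>Polynomial functions in several variables\<close>

text \<open>The polynomial functions in the first \<open>m\<close> coordinates.  All sequences of complex numbers serve as
  arguments, so that the functions for different \<open>m\<close> have the same type.\<close>

inductive polyfun :: "nat \<Rightarrow> ((nat \<Rightarrow> complex) \<Rightarrow> complex) \<Rightarrow> bool" for m where
  const: "polyfun m (\<lambda>v. c)"
| var: "i < m \<Longrightarrow> polyfun m (\<lambda>v. v i)"
| add: "polyfun m f \<Longrightarrow> polyfun m g \<Longrightarrow> polyfun m (\<lambda>v. f v + g v)"
| mult: "polyfun m f \<Longrightarrow> polyfun m g \<Longrightarrow> polyfun m (\<lambda>v. f v * g v)"

lemma polyfun_mono: "polyfun m f \<Longrightarrow> m \<le> n \<Longrightarrow> polyfun n f"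
  by (induction rule: polyfun.induct) (auto intro: polyfun.intros)

lemma polyfun_common:
  "polyfun m f \<Longrightarrow> polyfun n g \<Longrightarrow> \<exists>k. polyfun k f \<and> polyfun k g"
  using polyfun_mono[of m f "max m n"] polyfun_mono[of n g "max m n"] by auto

lemma polyfun_diff: "polyfun m f \<Longrightarrow> polyfun m g \<Longrightarrow> polyfun m (\<lambda>v. f v - g v)"
  using polyfun.add[of m f "\<lambda>v. (-1) * g v"] polyfun.mult[of m "\<lambda>v. -1" g] polyfun.const[of m "-1"]
  by simp

lemma polyfun_sum: "(\<And>i. i \<in> I \<Longrightarrow> polyfun m (f i)) \<Longrightarrow> polyfun m (\<lambda>v. \<Sum>i\<in>I. f i v)"
proof (induction I rule: infinite_finite_induct)
  case (insert i I)
  then have "polyfun m (f i)" "polyfun m (\<lambda>v. \<Sum>j\<in>I. f j v)" by auto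
  then show ?case using insert.hyps polyfun.add by simp
qed (simp_all add: polyfun.const)

lemma polyfun_cong: "polyfun m f \<Longrightarrow> (\<And>i. i < m \<Longrightarrow> v i = w i) \<Longrightarrow> f v = f w"
  by (induction rule: polyfun.induct) auto

lemma polyfun_compose:
  "polyfun m f \<Longrightarrow> (\<And>i. i < m \<Longrightarrow> polyfun n (\<lambda>v. \<gamma> v i)) \<Longrightarrow> polyfun n (\<lambda>v. f (\<gamma> v))"
proof (induction rule: polyfun.induct)
  case (add f g)
  then show ?case using polyfun.add[of n "\<lambda>v. f (\<gamma> v)" "\<lambda>v. g (\<gamma> v)"] by simp
next
  case (mult f g)
  then show ?case using polyfun.mult[of n "\<lambda>v. f (\<gamma> v)" "\<lambda>v. g (\<gamma> v)"] by simp
qed (simp_all add: polyfun.const)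

lemma polyfun_curve:
  assumes "polyfun m f" "\<And>i. i < m \<Longrightarrow> \<exists>g. \<forall>t. \<gamma> t i = poly g t"
  shows "\<exists>g. \<forall>t. f (\<gamma> t) = poly g t"
  using assms
proof (induction rule: polyfun.induct)
  case (const c)
  show ?case by (rule exI[of _ "[:c:]"]) simp
next
  case (add f g)
  then obtain p q where "\<forall>t. f (\<gamma> t) = poly p t" "\<forall>t. g (\<gamma> t) = poly q t" by blast
  then show ?case by (intro exI[of _ "p + q"]) simp
next
  case (mult f g)
  then obtain p q where "\<forall>t. f (\<gamma> t) = poly p t" "\<forall>t. g (\<gamma> t) = poly q t" by blast
  then show ?case by (intro exI[of _ "p * q"]) simp
qed auto

lemma polyfun_line: "polyfun m f \<Longrightarrow> \<exists>g. \<forall>t. f (\<lambda>i. u i + t * d i) = poly g t"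
  by (erule polyfun_curve) (rule_tac x="[:u i, d i:]" in exI, simp)

text \<open>On the line through a point where \<open>f\<close> does not vanish and a point where \<open>g\<close> does not, both functions
  are nonzero polynomials in one variable.\<close>

lemma polyfun_no_zero_divisors:
  assumes "polyfun m f" "polyfun m g" "\<And>v. f v * g v = 0"
  shows "(\<forall>v. f v = 0) \<or> (\<forall>v. g v = 0)"
proof (rule ccontr)
  assume "\<not> ?thesis"
  then obtain u w where u: "f u \<noteq> 0" and w: "g w \<noteq> 0" by blast
  define \<gamma> where "\<gamma> = (\<lambda>(t::complex) i. u i + t * (w i - u i))"
  obtain p q where p: "\<And>t. f (\<gamma> t) = poly p t" and q: "\<And>t. g (\<gamma> t) = poly q t"
    using polyfun_line assms(1,2) unfolding \<gamma>_def by metis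
  have "poly (p * q) t = 0" for t using assms(3)[of "\<gamma> t"] p q by simp
  then have "p * q = 0" using poly_all_0_iff_0 by blast
  moreover have "\<gamma> 0 = u" "\<gamma> 1 = w" unfolding \<gamma>_def by auto
  then have "p \<noteq> 0" "q \<noteq> 0" using p[of 0] q[of 1] u w by auto
  ultimately show False by simp
qed

text \<open>On the line through \<open>Re v\<close> in direction \<open>Im v\<close> the function is a polynomial in one variable
  that vanishes on the real axis, so it also vanishes at \<open>\<i>\<close>, where the line passes through \<open>v\<close>.\<close>

lemma polyfun_zero_if_zero_on_reals:
  assumes f: "polyfun m f" and zero: "\<And>v. (\<forall>i. v i \<in> \<real>) \<Longrightarrow> f v = 0"
  shows "f v = 0"
proof -
  define \<gamma> where "\<gamma> = (\<lambda>(t::complex) i. complex_of_real (Re (v i)) + t * complex_of_real (Im (v i)))"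
  obtain p where p: "\<And>t. f (\<gamma> t) = poly p t"
    using polyfun_line f unfolding \<gamma>_def by metis
  have "poly p (of_real t) = 0" for t
    unfolding p[symmetric] by (intro zero) (auto simp: \<gamma>_def)
  then have "range complex_of_real \<subseteq> {t. poly p t = 0}" by auto
  moreover have "infinite (range complex_of_real)"
    using infinite_UNIV_char_0 inj_of_real finite_imageD by blast
  ultimately have "p = 0" using poly_roots_finite finite_subset by blast
  moreover have "\<gamma> \<i> = v" by (auto simp: \<gamma>_def fun_eq_iff complex_eq_iff)
  ultimately show ?thesis using p[of \<i>] by simp
qed

text \<open>The polynomial functions in arbitrarily many variables, an integral domain that contains all the
  rings of polynomials in \<open>m\<close> variables.\<close>

typedef mvpoly = "{f. \<exists>m. polyfun m f}"
  using polyfun.const by blast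

setup_lifting type_definition_mvpoly

instantiation mvpoly :: idom
begin

lift_definition zero_mvpoly :: mvpoly is "\<lambda>v. 0" using polyfun.const by blast
lift_definition one_mvpoly :: mvpoly is "\<lambda>v. 1" using polyfun.const by blast
lift_definition plus_mvpoly :: "mvpoly \<Rightarrow> mvpoly \<Rightarrow> mvpoly" is "\<lambda>f g v. f v + g v"
  by (elim exE, drule (1) polyfun_common) (blast intro: polyfun.add)
lift_definition times_mvpoly :: "mvpoly \<Rightarrow> mvpoly \<Rightarrow> mvpoly" is "\<lambda>f g v. f v * g v"
  by (elim exE, drule (1) polyfun_common) (blast intro: polyfun.mult)
lift_definition minus_mvpoly :: "mvpoly \<Rightarrow> mvpoly \<Rightarrow> mvpoly" is "\<lambda>f g v. f v - g v"
  by (elim exE, drule (1) polyfun_common) (blast intro: polyfun_diff)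
lift_definition uminus_mvpoly :: "mvpoly \<Rightarrow> mvpoly" is "\<lambda>f v. 0 - f v"
  by (elim exE) (rule exI, erule polyfun_diff[OF polyfun.const])

instance
proof
  fix a b :: mvpoly
  assume "a \<noteq> 0" "b \<noteq> 0"
  then show "a * b \<noteq> 0"
  proof (transfer, elim exE)
    fix f g m n
    assume "polyfun m f" "polyfun n g" and nz: "f \<noteq> (\<lambda>v. 0)" "g \<noteq> (\<lambda>v. 0)"
    then obtain k where "polyfun k f" "polyfun k g" using polyfun_common by blast
    then show "(\<lambda>v. f v * g v) \<noteq> (\<lambda>v. 0)"
      using polyfun_no_zero_divisors[of k f g] nz by (auto simp: fun_eq_iff)
  qed
qed (transfer; force simp: algebra_simps fun_eq_iff)+

end

lift_definition mveval :: "mvpoly \<Rightarrow> (nat \<Rightarrow> complex) \<Rightarrow> complex" is "\<lambda>f. f" .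

lift_definition mvvar :: "nat \<Rightarrow> mvpoly" is "\<lambda>i v. v i"
  using polyfun.var by blast

definition mvpolys :: "nat \<Rightarrow> mvpoly set" where
  "mvpolys m = {p. polyfun m (mveval p)}"

lemma mveval_simps [simp]:
  "mveval 0 v = 0" "mveval 1 v = 1" "mveval (p + q) v = mveval p v + mveval q v"
  "mveval (p * q) v = mveval p v * mveval q v" "mveval (p - q) v = mveval p v - mveval q v"
  "mveval (mvvar i) v = v i"
  by (transfer; simp)+

lemma mveval_fun:
  "mveval 1 = (\<lambda>v. 1)" "mveval (p + q) = (\<lambda>v. mveval p v + mveval q v)"
  "mveval (p * q) = (\<lambda>v. mveval p v * mveval q v)"
  "mveval (p - q) = (\<lambda>v. mveval p v - mveval q v)" "mveval (mvvar i) = (\<lambda>v. v i)"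
  by auto

lemma mvpoly_eqI: "(\<And>v. mveval p v = mveval q v) \<Longrightarrow> p = q"
  by transfer auto

lemma mvpolysE:
  assumes "polyfun m f"
  obtains p where "p \<in> mvpolys m" "\<And>v. mveval p v = f v"
proof
  have "f \<in> {f. \<exists>m. polyfun m f}" using assms by blast
  then have "mveval (Abs_mvpoly f) = f" by (simp add: mveval.rep_eq Abs_mvpoly_inverse)
  then show "Abs_mvpoly f \<in> mvpolys m" "\<And>v. mveval (Abs_mvpoly f) v = f v"
    using assms by (auto simp: mvpolys_def)
qed

lemma subring_of_domain_mvpolys: "subring_of_domain (mvpolys m)"
proof
  show "1 \<in> mvpolys m" by (auto simp: mvpolys_def mveval_fun intro: polyfun.intros)
qed (auto simp: mvpolys_def mveval_fun intro: polyfun.intros polyfun_diff)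

lemma mveval_poly: "mveval (poly F x) v = poly (map_poly (\<lambda>p. mveval p v) F) (mveval x v)"
  by (induction F) (auto simp: map_poly_pCons)

lemma mveval_poly_mvvar:
  assumes "F \<in> polys_over (mvpolys m)"
  shows "mveval (poly F (mvvar m)) (v(m := t)) = poly (map_poly (\<lambda>p. mveval p v) F) t"
proof -
  have "mveval (coeff F i) (v(m := t)) = mveval (coeff F i) v" for i
    using assms polyfun_cong[of m "mveval (coeff F i)" "v(m := t)" v]
    by (auto simp: polys_over_def mvpolys_def)
  then have "map_poly (\<lambda>p. mveval p (v(m := t))) F = map_poly (\<lambda>p. mveval p v) F"
    by (intro poly_eqI) (simp add: coeff_map_poly)
  then show ?thesis by (simp add: mveval_poly)
qed

text \<open>A polynomial in \<open>m + 1\<close> variables is a polynomial in the last of them with coefficients in the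
  others.  The coefficients are determined by the function: they do not change when the last
  coordinate varies, and a polynomial in one variable is determined by its values.\<close>

lemma bij_betw_poly_mvvar:
  "bij_betw (\<lambda>F. poly F (mvvar m)) (polys_over (mvpolys m)) (mvpolys (Suc m))"
proof -
  interpret M: subring_of_domain "mvpolys m" by (rule subring_of_domain_mvpolys)
  interpret N: subring_of_domain "mvpolys (Suc m)" by (rule subring_of_domain_mvpolys)
  interpret P: subring_of_domain "polys_over (mvpolys m)" by (rule M.subring_of_domain_polys_over)
  have "inj_on (\<lambda>F. poly F (mvvar m)) (polys_over (mvpolys m))"
  proof (rule inj_onI)
    fix F G assume F: "F \<in> polys_over (mvpolys m)" and G: "G \<in> polys_over (mvpolys m)"
      and eq: "poly F (mvvar m) = poly G (mvvar m)"
    have "poly (map_poly (\<lambda>p. mveval p v) F) = poly (map_poly (\<lambda>p. mveval p v) G)" for v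
      by (rule ext) (simp only: mveval_poly_mvvar[OF F, symmetric] mveval_poly_mvvar[OF G, symmetric] eq)
    then have "map_poly (\<lambda>p. mveval p v) F = map_poly (\<lambda>p. mveval p v) G" for v
      using poly_eq_poly_eq_iff by blast
    then have "mveval (coeff F i) v = mveval (coeff G i) v" for i v
      by (metis coeff_map_poly mveval_simps(1))
    then show "F = G" by (intro poly_eqI mvpoly_eqI)
  qed
  moreover have "poly F (mvvar m) \<in> mvpolys (Suc m)" if "F \<in> polys_over (mvpolys m)" for F
    using that
  proof (induction F)
    case 0
    then show ?case by (simp add: N.zero_mem)
  next
    case (pCons a F)
    have "coeff (pCons a F) 0 \<in> mvpolys m" "coeff (pCons a F) (Suc i) \<in> mvpolys m" for i
      using pCons.prems unfolding polys_over_def by blast+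
    then have "a \<in> mvpolys m" "F \<in> polys_over (mvpolys m)"
      unfolding polys_over_def by simp_all
    then have "a \<in> mvpolys (Suc m)" "poly F (mvvar m) \<in> mvpolys (Suc m)"
      using pCons.IH by (auto simp: mvpolys_def intro: polyfun_mono)
    moreover have "mvvar m \<in> mvpolys (Suc m)" by (auto simp: mvpolys_def mveval_fun intro: polyfun.intros)
    ultimately show ?case by (auto intro: N.add_mem N.mult_mem)
  qed
  moreover have "p \<in> (\<lambda>F. poly F (mvvar m)) ` polys_over (mvpolys m)" if p: "p \<in> mvpolys (Suc m)" for p
  proof -
    have "\<exists>F\<in>polys_over (mvpolys m). \<forall>v. f v = mveval (poly F (mvvar m)) v" if "polyfun (Suc m) f" for f
      using that
    proof (induction rule: polyfun.induct)
      case (const c)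
      obtain p where "p \<in> mvpolys m" "\<And>v. mveval p v = c" using mvpolysE[OF polyfun.const] by blast
      then show ?case by (intro bexI[of _ "[:p:]"]) (auto intro: M.const_mem_polys_over)
    next
      case (var i)
      show ?case
      proof (cases "i = m")
        case True
        have "monom 1 1 \<in> polys_over (mvpolys m)" by (intro M.monom_mem_polys_over M.one_mem)
        then show ?thesis using True by (intro bexI[of _ "monom 1 1"]) (auto simp: poly_monom)
      next
        case False
        then have "mvvar i \<in> mvpolys m" using var by (auto simp: mvpolys_def mveval_fun intro: polyfun.var)
        then show ?thesis by (intro bexI[of _ "[:mvvar i:]"]) (auto intro: M.const_mem_polys_over)
      qed
    next
      case (add f g)
      then obtain F G where "F \<in> polys_over (mvpolys m)" "\<forall>v. f v = mveval (poly F (mvvar m)) v"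
        "G \<in> polys_over (mvpolys m)" "\<forall>v. g v = mveval (poly G (mvvar m)) v" by blast
      then show ?case by (intro bexI[of _ "F + G"]) (auto intro: P.add_mem)
    next
      case (mult f g)
      then obtain F G where "F \<in> polys_over (mvpolys m)" "\<forall>v. f v = mveval (poly F (mvvar m)) v"
        "G \<in> polys_over (mvpolys m)" "\<forall>v. g v = mveval (poly G (mvvar m)) v" by blast
      then show ?case by (intro bexI[of _ "F * G"]) (auto intro: P.mult_mem)
    qed
    from this[of "mveval p"] p show ?thesis
      by (auto simp: mvpolys_def intro!: mvpoly_eqI)
  qed
  ultimately show ?thesis by (auto simp: bij_betw_def)
qed

lemma factorial_in_transport:
  assumes bij: "bij_betw \<phi> S S'" and S: "subring_of_domain S"
    and mult: "\<And>a b. a \<in> S \<Longrightarrow> b \<in> S \<Longrightarrow> \<phi> (a * b) = \<phi> a * \<phi> b"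
    and zo: "\<phi> 0 = 0" "\<phi> 1 = 1"
    and fac: "factorial_in S"
  shows "factorial_in S'"
proof -
  interpret S: subring_of_domain S by (rule S)
  have mem: "\<phi> a \<in> S'" if "a \<in> S" for a using bij that by (auto simp: bij_betw_def)
  have inj: "\<phi> a = \<phi> b \<longleftrightarrow> a = b" if "a \<in> S" "b \<in> S" for a b
    using bij that by (auto simp: bij_betw_def inj_on_eq_iff)
  have surj: "\<exists>a\<in>S. b = \<phi> a" if "b \<in> S'" for b using bij that by (auto simp: bij_betw_def)
  have dv: "divides_in S' (\<phi> a) (\<phi> b) \<longleftrightarrow> divides_in S a b" if "a \<in> S" "b \<in> S" for a b
    unfolding divides_in_def using mem inj surj mult S.mult_mem that by metis
  have un: "unit_in S' (\<phi> a) \<longleftrightarrow> unit_in S a" if "a \<in> S" for a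
    using dv[OF that S.one_mem] that mem zo unfolding unit_in_def by simp
  have pr: "prime_in S' (\<phi> p)" if p: "prime_in S p" for p
    unfolding prime_in_def
  proof (intro conjI ballI impI)
    have pS: "p \<in> S" "p \<noteq> 0" using p by (auto simp: prime_in_def)
    show "\<phi> p \<in> S'" using pS mem by blast
    show "\<phi> p \<noteq> 0" using inj[OF pS(1) S.zero_mem] zo pS by simp
    show "\<not> unit_in S' (\<phi> p)" using un p pS by (auto simp: prime_in_def)
    fix a' b' assume "a' \<in> S'" "b' \<in> S'" and d: "divides_in S' (\<phi> p) (a' * b')"
    then obtain a b where ab: "a \<in> S" "a' = \<phi> a" "b \<in> S" "b' = \<phi> b" using surj by metis
    then have "divides_in S p (a * b)" using d mult dv[OF pS(1) S.mult_mem] by simp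
    then show "divides_in S' (\<phi> p) a' \<or> divides_in S' (\<phi> p) b'"
      using p ab dv pS unfolding prime_in_def by blast
  qed
  have pp: "prime_product S' n (\<phi> a)" if "prime_product S n a" for n a
    using that
  proof (induction rule: prime_product.induct)
    case (unit u)
    then show ?case using un by (auto simp: unit_in_def intro: prime_product.unit)
  next
    case (prime p n a)
    then show ?case
      using prime_product.prime[OF pr] mult S.prime_product_mem by (metis prime_in_def)
  qed
  show ?thesis
    unfolding factorial_in_def
    using surj pp fac zo unfolding factorial_in_def by metis
qed

lemma factorial_in_mvpolys: "factorial_in (mvpolys m)"
proof (induction m)
  case 0
  have const: "\<exists>c. \<forall>v. f v = c" if "polyfun 0 f" for f
    using that by (induction rule: polyfun.induct) auto
  show ?case
    unfolding factorial_in_def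
  proof (intro ballI impI)
    fix a assume a: "a \<in> mvpolys 0" "a \<noteq> 0"
    then obtain c where c: "\<And>v. mveval a v = c" using const by (auto simp: mvpolys_def)
    obtain b where b: "b \<in> mvpolys 0" "\<And>v. mveval b v = inverse c"
      using mvpolysE[OF polyfun.const] by blast
    have "c \<noteq> 0" using a c by (metis mvpoly_eqI mveval_simps(1))
    then have "1 = a * b" using b c by (intro mvpoly_eqI) simp
    then have "unit_in (mvpolys 0) a" using a b by (auto simp: unit_in_def divides_in_def)
    then show "\<exists>n. prime_product (mvpolys 0) n a" using prime_product.unit by blast
  qed
next
  case (Suc m)
  interpret M: subring_of_domain "mvpolys m" by (rule subring_of_domain_mvpolys)
  show ?case
  proof (rule factorial_in_transport[OF bij_betw_poly_mvvar M.subring_of_domain_polys_over])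
    show "factorial_in (polys_over (mvpolys m))" by (rule M.factorial_in_polys_over[OF Suc])
  qed simp_all
qed

text \<open>This is the only consequence of unique factorisation that is used later: a relation \<open>a d = b c\<close>
  between polynomials comes from a two by two scheme of common factors.\<close>

theorem polyfun_four_number:
  assumes "polyfun m a" "polyfun m b" "polyfun m c" "polyfun m d"
    and eq: "\<And>v. a v * d v = b v * c v" and nz: "a u \<noteq> 0"
  obtains p q r s where "polyfun m p" "polyfun m q" "polyfun m r" "polyfun m s"
    "\<And>v. a v = p v * q v" "\<And>v. b v = p v * r v" "\<And>v. c v = s v * q v" "\<And>v. d v = s v * r v"
proof -
  interpret M: subring_of_domain "mvpolys m" by (rule subring_of_domain_mvpolys)
  obtain A where A: "A \<in> mvpolys m" "\<And>v. mveval A v = a v" using mvpolysE[OF assms(1)] by metis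
  obtain B where B: "B \<in> mvpolys m" "\<And>v. mveval B v = b v" using mvpolysE[OF assms(2)] by metis
  obtain C where C: "C \<in> mvpolys m" "\<And>v. mveval C v = c v" using mvpolysE[OF assms(3)] by metis
  obtain D where D: "D \<in> mvpolys m" "\<And>v. mveval D v = d v" using mvpolysE[OF assms(4)] by metis
  have "A \<noteq> 0" using A nz by auto
  then obtain n where n: "prime_product (mvpolys m) n A"
    using factorial_in_mvpolys A unfolding factorial_in_def by blast
  have "A * D = B * C" using A B C D eq by (intro mvpoly_eqI) simp
  from M.four_number_theorem[OF n this B(1) C(1) D(1)]
  obtain P Q R S where mem: "P \<in> mvpolys m" "Q \<in> mvpolys m" "R \<in> mvpolys m" "S \<in> mvpolys m"
    and fac: "A = P * Q" "B = P * R" "C = S * Q" "D = S * R" by blast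
  show ?thesis
  proof (rule that[of "mveval P" "mveval Q" "mveval R" "mveval S"])
    show "polyfun m (mveval P)" "polyfun m (mveval Q)" "polyfun m (mveval R)" "polyfun m (mveval S)"
      using mem by (simp_all add: mvpolys_def)
    show "a v = mveval P v * mveval Q v" "b v = mveval P v * mveval R v"
      "c v = mveval S v * mveval Q v" "d v = mveval S v * mveval R v" for v
      using A(2)[of v] B(2)[of v] C(2)[of v] D(2)[of v] fac by simp_all
  qed
qed


section \<open>Factorisations on a quadratic cone\<close>

definition poly_curve :: "(complex \<Rightarrow> complex) \<Rightarrow> bool" where
  "poly_curve f \<longleftrightarrow> (\<exists>p. \<forall>t. f t = poly p t)"

lemma poly_curve_intros:
  "poly_curve (\<lambda>t. c)" "poly_curve (\<lambda>t. t)"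
  "poly_curve f \<Longrightarrow> poly_curve g \<Longrightarrow> poly_curve (\<lambda>t. f t + g t)"
  "poly_curve f \<Longrightarrow> poly_curve g \<Longrightarrow> poly_curve (\<lambda>t. f t - g t)"
  "poly_curve f \<Longrightarrow> poly_curve g \<Longrightarrow> poly_curve (\<lambda>t. f t * g t)"
  "poly_curve f \<Longrightarrow> poly_curve (\<lambda>t. f t / c)"
proof -
  show "poly_curve (\<lambda>t. c)" unfolding poly_curve_def by (rule exI[of _ "[:c:]"]) simp
  show "poly_curve (\<lambda>t. t)" unfolding poly_curve_def by (rule exI[of _ "[:0, 1:]"]) simp
  show "poly_curve (\<lambda>t. f t + g t)" if "poly_curve f" "poly_curve g"
    using that unfolding poly_curve_def by (metis poly_add)
  show "poly_curve (\<lambda>t. f t - g t)" if "poly_curve f" "poly_curve g"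
    using that unfolding poly_curve_def by (metis poly_diff)
  show "poly_curve (\<lambda>t. f t * g t)" if "poly_curve f" "poly_curve g"
    using that unfolding poly_curve_def by (metis poly_mult)
  show "poly_curve (\<lambda>t. f t / c)" if f: "poly_curve f"
  proof -
    obtain p where "\<forall>t. f t = poly p t" using f unfolding poly_curve_def by blast
    then show ?thesis unfolding poly_curve_def
      by (intro exI[of _ "smult (inverse c) p"]) (simp add: field_simps)
  qed
qed

lemma poly_curve_If:
  "poly_curve f \<Longrightarrow> poly_curve g \<Longrightarrow> poly_curve (\<lambda>t. if c then f t else g t)"
  by (cases c) auto

text \<open>A polynomial in one variable that divides a nonzero constant is constant.  Applied along many curves,
  this shows that the factors of a monomial depend on few coordinates.\<close>

lemma poly_curve_const:
  assumes "poly_curve f" "poly_curve g" and prod: "\<And>t. f t * g t = c" and "c \<noteq> 0"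
  shows "f s = f t"
proof -
  obtain p q where p: "\<And>t. f t = poly p t" and q: "\<And>t. g t = poly q t"
    using assms unfolding poly_curve_def by metis
  have "poly (p * q) t = poly [:c:] t" for t using prod[of t] p q by simp
  then have pq: "p * q = [:c:]" using poly_eq_poly_eq_iff by blast
  then have "p \<noteq> 0" "q \<noteq> 0" using \<open>c \<noteq> 0\<close> by auto
  then have "degree p = 0" using pq degree_mult_eq[of p q] by simp
  then show ?thesis using p by (metis degree_0_id poly_pCons mult_zero_right poly_0)
qed

text \<open>The point \<open>v\<close> at which the coordinates \<open>v\<^sub>0 + \<i> v\<^sub>1\<close>, \<open>v\<^sub>2 + \<i> v\<^sub>3\<close>, \<open>v\<^sub>4 + \<i> v\<^sub>5\<close> take the
  values \<open>x1\<close>, \<open>x2\<close>, \<open>x3\<close> and their formal conjugates \<open>v\<^sub>0 - \<i> v\<^sub>1\<close>, \<open>v\<^sub>2 - \<i> v\<^sub>3\<close>, \<open>v\<^sub>4 - \<i> v\<^sub>5\<close> the values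
  \<open>y1\<close>, \<open>y2\<close>, \<open>y3\<close>.  It is a real point if \<open>y1\<close>, \<open>y2\<close>, \<open>y3\<close> are the conjugates of \<open>x1\<close>, \<open>x2\<close>, \<open>x3\<close>.\<close>

definition cpoint :: "complex \<Rightarrow> complex \<Rightarrow> complex \<Rightarrow> complex \<Rightarrow> complex \<Rightarrow> complex \<Rightarrow> nat \<Rightarrow> complex" where
  "cpoint x1 y1 x2 y2 x3 y3 =
     (\<lambda>i. if i = 0 then (x1 + y1) / 2 else if i = 1 then (x1 - y1) / (2 * \<i>)
      else if i = 2 then (x2 + y2) / 2 else if i = 3 then (x2 - y2) / (2 * \<i>)
      else if i = 4 then (x3 + y3) / 2 else if i = 5 then (x3 - y3) / (2 * \<i>) else 0)"

lemma poly_curve_cpoint: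
  assumes "polyfun 6 F" and "poly_curve x1" "poly_curve y1" "poly_curve x2" "poly_curve y2"
    "poly_curve x3" "poly_curve y3"
  shows "poly_curve (\<lambda>t. F (cpoint (x1 t) (y1 t) (x2 t) (y2 t) (x3 t) (y3 t)))"
  unfolding poly_curve_def
proof (rule polyfun_curve[OF assms(1)])
  fix i :: nat assume "i < 6"
  have "poly_curve (\<lambda>t. cpoint (x1 t) (y1 t) (x2 t) (y2 t) (x3 t) (y3 t) i)"
    unfolding cpoint_def by (intro poly_curve_If poly_curve_intros assms(2-))
  then show "\<exists>g. \<forall>t. cpoint (x1 t) (y1 t) (x2 t) (y2 t) (x3 t) (y3 t) i = poly g t"
    unfolding poly_curve_def .
qed

text \<open>At real points the quadratic form is \<open>a1 \<bar>z\<^sub>1\<bar>\<^sup>2 + a2 \<bar>z\<^sub>2\<bar>\<^sup>2 - b \<bar>z\<^sub>3\<bar>\<^sup>2\<close>, so that its cone is the zero fibre of the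
  moment map for three weights; the form itself is the complexification.\<close>

definition cone_bilin :: "real \<Rightarrow> real \<Rightarrow> real \<Rightarrow> (nat \<Rightarrow> complex) \<Rightarrow> (nat \<Rightarrow> complex) \<Rightarrow> complex" where
  "cone_bilin a1 a2 b v w = of_real a1 * (v 0 * w 0 + v 1 * w 1) + of_real a2 * (v 2 * w 2 + v 3 * w 3)
     - of_real b * (v 4 * w 4 + v 5 * w 5)"

lemma cone_bilin_combination:
  "cone_bilin a1 a2 b (\<lambda>i. x * v i + y * w i) (\<lambda>i. x * v i + y * w i) =
     x\<^sup>2 * cone_bilin a1 a2 b v v + 2 * x * y * cone_bilin a1 a2 b v w + y\<^sup>2 * cone_bilin a1 a2 b w w"
  unfolding cone_bilin_def by (simp add: algebra_simps power2_eq_square)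

lemma cone_bilin_linear_right:
  "cone_bilin a1 a2 b u (\<lambda>i. x * v i + y * w i) = x * cone_bilin a1 a2 b u v + y * cone_bilin a1 a2 b u w"
  unfolding cone_bilin_def by (simp add: algebra_simps)

lemma polyfun_cone_bilin: "polyfun 6 (cone_bilin a1 a2 b u)" "polyfun 6 (\<lambda>v. cone_bilin a1 a2 b v v)"
  unfolding cone_bilin_def by (intro polyfun_diff polyfun.intros; simp)+

text \<open>A vector with a nonzero coordinate is not orthogonal to all real isotropic vectors, since these
  span the space: the combinations of one positive and one negative basis vector suffice.\<close>

lemma real_isotropic_not_orthogonal:
  assumes sgn: "a1 * b > 0" "a2 * b > 0" and w: "i < 6" "w i \<noteq> 0"
  obtains u where "\<forall>i. u i \<in> \<real>" "cone_bilin a1 a2 b u u = 0" "cone_bilin a1 a2 b u w \<noteq> 0"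
proof -
  note result = that
  have key: thesis if j: "(j = 0 \<or> j = 1) \<and> a = a1 \<or> (j = 2 \<or> j = 3) \<and> a = a2"
    and k: "k = 4 \<or> k = 5" and nz: "w j \<noteq> 0 \<or> w k \<noteq> 0" for j k :: nat and a
  proof -
    have ab: "a * b > 0" using j sgn by auto
    define s r where "s = sqrt \<bar>b\<bar>" and "r = sqrt \<bar>a\<bar>"
    have sr: "s > 0" "r > 0" using ab unfolding s_def r_def by auto
    have "a * \<bar>b\<bar> = b * \<bar>a\<bar>"
      using ab by (auto simp: zero_less_mult_iff)
    then have iso: "a * s\<^sup>2 = b * r\<^sup>2" unfolding s_def r_def by simp
    define u where "u e = (\<lambda>i. if i = j then complex_of_real s else if i = k then of_real (e * r) else 0)" for e :: real
    have real: "\<forall>i. u e i \<in> \<real>" for e by (auto simp: u_def)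
    have uu: "cone_bilin a1 a2 b (u e) (u e) = of_real (a * s\<^sup>2 - e\<^sup>2 * (b * r\<^sup>2))" for e
      using j k unfolding cone_bilin_def u_def by (auto simp: power2_eq_square algebra_simps)
    have uw: "cone_bilin a1 a2 b (u e) w = of_real (a * s) * w j - of_real (e * (b * r)) * w k" for e
      using j k unfolding cone_bilin_def u_def by (auto simp: algebra_simps)
    have "cone_bilin a1 a2 b (u 1) w \<noteq> 0 \<or> cone_bilin a1 a2 b (u (-1)) w \<noteq> 0"
    proof (rule ccontr)
      assume "\<not> ?thesis"
      then have "of_real (a * s) * w j - of_real (b * r) * w k = 0"
        "of_real (a * s) * w j + of_real (b * r) * w k = 0"
        unfolding uw by simp_all
      moreover have "x = 0 \<and> y = 0" if "x - y = 0" "x + y = 0" for x y :: complex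
        using that by (simp add: complex_eq_iff)
      ultimately have "of_real (a * s) * w j = 0" "of_real (b * r) * w k = 0" by blast+
      then show False using nz sr ab by auto
    qed
    then show thesis
      using result[OF real, of 1] result[OF real, of "-1"] uu[of 1] uu[of "-1"] iso by force
  qed
  have "i = 0 \<or> i = 1 \<or> i = 2 \<or> i = 3 \<or> i = 4 \<or> i = 5" using w(1) by auto
  then show thesis
    using key[of 0 a1 4] key[of 1 a1 4] key[of 2 a2 4] key[of 3 a2 4] key[of 0 a1 5] w(2)
    by (elim disjE) simp_all
qed

text \<open>The real points of the quadric are dense for the Zariski topology.  From a real point \<open>u\<close> of the
  quadric, stereographic projection gives the polynomial map \<open>v \<mapsto> q(v) u - 2 B(u, v) v\<close> into the
  quadric, defined over the reals; its image contains every point that is not orthogonal to \<open>u\<close>.\<close>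

lemma cone_zero_if_zero_on_reals:
  assumes F: "polyfun 6 F" and sgn: "a1 * b > 0" "a2 * b > 0"
    and zero: "\<And>v. (\<forall>i. v i \<in> \<real>) \<Longrightarrow> cone_bilin a1 a2 b v v = 0 \<Longrightarrow> F v = 0"
    and w: "cone_bilin a1 a2 b w w = 0"
  shows "F w = 0"
proof (cases "\<exists>i<6. w i \<noteq> 0")
  case False
  then have "F w = F (\<lambda>i. 0)" by (intro polyfun_cong[OF F]) auto
  also have "\<dots> = 0" by (rule zero) (auto simp: cone_bilin_def)
  finally show ?thesis .
next
  case True
  then obtain u where u: "\<forall>i. u i \<in> \<real>" "cone_bilin a1 a2 b u u = 0" "cone_bilin a1 a2 b u w \<noteq> 0"
    using real_isotropic_not_orthogonal[OF sgn] by metis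
  let ?B = "cone_bilin a1 a2 b"
  define \<phi> where "\<phi> v = (\<lambda>i. ?B v v * u i + (- 2 * ?B u v) * v i)" for v
  have iso: "?B (\<phi> v) (\<phi> v) = 0" for v
    unfolding \<phi>_def cone_bilin_combination u(2) by (simp add: power2_eq_square)
  have pf: "polyfun 6 (\<lambda>v. F (\<phi> v))"
    unfolding \<phi>_def by (intro polyfun_compose[OF F] polyfun.intros polyfun_cone_bilin; simp)
  have vanish: "F (\<phi> v) = 0" for v
  proof (rule polyfun_zero_if_zero_on_reals[OF pf])
    fix v :: "nat \<Rightarrow> complex" assume v: "\<forall>i. v i \<in> \<real>"
    then have "\<forall>i. \<phi> v i \<in> \<real>" using u(1) by (auto simp: \<phi>_def cone_bilin_def)
    then show "F (\<phi> v) = 0" using zero iso by blast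
  qed
  define \<beta> where "\<beta> = csqrt (- 1 / (2 * ?B u w))"
  have \<beta>: "\<beta>\<^sup>2 * (- 2 * ?B u w) = 1" unfolding \<beta>_def using u(3) by simp
  define v where "v = (\<lambda>i. 1 * u i + \<beta> * w i)"
  have Buv: "?B u v = \<beta> * ?B u w" and Bvv: "?B v v = 2 * \<beta> * ?B u w"
    unfolding v_def cone_bilin_combination cone_bilin_linear_right u(2) w by simp_all
  have "\<phi> v i = w i" for i
  proof -
    have "\<phi> v i = (\<beta>\<^sup>2 * (- 2 * ?B u w)) * w i"
      unfolding \<phi>_def Buv Bvv by (simp add: v_def algebra_simps power2_eq_square)
    then show ?thesis unfolding \<beta> by simp
  qed
  then have "\<phi> v = w" by auto
  then show ?thesis using vanish[of v] by simp
qed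

text \<open>Write \<open>x\<^sub>j\<close>, \<open>y\<^sub>j\<close> for the complexifications of \<open>z\<^sub>j\<close> and of its conjugate.  On the complex
  cone \<open>P Q = (x\<^sub>1 y\<^sub>1)\<^sup>c\<close>, \<open>P R = x\<^sub>1\<^sup>c y\<^sub>2\<^sup>d\<close> and \<open>S R = (x\<^sub>2 y\<^sub>2)\<^sup>d\<close>.  Where \<open>x\<^sub>1\<close> and \<open>y\<^sub>2\<close> are nonzero constants,
  \<open>P\<close> has no zeros and is constant by the second relation; by the first one it does not depend on
  \<open>y\<^sub>2\<close>; by the third one \<open>R\<close> does not depend on \<open>x\<^sub>1\<close>.  So \<open>P\<close> is a multiple of \<open>x\<^sub>1\<^sup>c\<close>, which is not
  invariant under a rotation with \<open>l1\<^sup>c \<noteq> 1\<close>.  Complex points are essential: on the real cone \<open>x\<^sub>3\<close>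
  vanishes only at the vertex, and for the weights \<open>1\<close>, \<open>1\<close>, \<open>-1\<close> the invariant continuous function
  \<open>z\<^sub>1 z\<^sub>3 / \<bar>z\<^sub>3\<bar>\<close> could take the place of \<open>z\<^sub>1\<close>.\<close>

lemma cone_no_invariant_factorization:
  fixes a1 a2 b :: real
  assumes sgn: "a1 * b > 0" "a2 * b > 0"
    and PQRS: "polyfun 6 P" "polyfun 6 Q" "polyfun 6 R" "polyfun 6 S"
    and PQ: "\<And>v. (\<forall>i. v i \<in> \<real>) \<Longrightarrow> cone_bilin a1 a2 b v v = 0 \<Longrightarrow>
      P v * Q v = ((v 0 + \<i> * v 1) * (v 0 - \<i> * v 1)) ^ c"
    and PR: "\<And>v. (\<forall>i. v i \<in> \<real>) \<Longrightarrow> cone_bilin a1 a2 b v v = 0 \<Longrightarrow>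
      P v * R v = (v 0 + \<i> * v 1) ^ c * (v 2 - \<i> * v 3) ^ d"
    and SR: "\<And>v. (\<forall>i. v i \<in> \<real>) \<Longrightarrow> cone_bilin a1 a2 b v v = 0 \<Longrightarrow>
      S v * R v = ((v 2 + \<i> * v 3) * (v 2 - \<i> * v 3)) ^ d"
    and l: "l1 \<noteq> 0" "l2 \<noteq> 0" "l3 \<noteq> 0" "l1 ^ c \<noteq> 1"
    and inv: "\<And>v. (\<forall>i. v i \<in> \<real>) \<Longrightarrow> cone_bilin a1 a2 b v v = 0 \<Longrightarrow>
      P (cpoint (l1 * (v 0 + \<i> * v 1)) ((v 0 - \<i> * v 1) / l1) (l2 * (v 2 + \<i> * v 3)) ((v 2 - \<i> * v 3) / l2)
        (l3 * (v 4 + \<i> * v 5)) ((v 4 - \<i> * v 5) / l3)) = P v"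
  shows False
proof -
  have nz: "a1 \<noteq> 0" "a2 \<noteq> 0" "b \<noteq> 0" using sgn by auto
  have coord: "cpoint x1 y1 x2 y2 x3 y3 0 + \<i> * cpoint x1 y1 x2 y2 x3 y3 1 = x1"
    "cpoint x1 y1 x2 y2 x3 y3 0 - \<i> * cpoint x1 y1 x2 y2 x3 y3 1 = y1"
    "cpoint x1 y1 x2 y2 x3 y3 2 + \<i> * cpoint x1 y1 x2 y2 x3 y3 3 = x2"
    "cpoint x1 y1 x2 y2 x3 y3 2 - \<i> * cpoint x1 y1 x2 y2 x3 y3 3 = y2"
    "cpoint x1 y1 x2 y2 x3 y3 4 + \<i> * cpoint x1 y1 x2 y2 x3 y3 5 = x3"
    "cpoint x1 y1 x2 y2 x3 y3 4 - \<i> * cpoint x1 y1 x2 y2 x3 y3 5 = y3" for x1 y1 x2 y2 x3 y3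
    unfolding cpoint_def by (simp_all add: field_simps)
  have quad: "cone_bilin a1 a2 b v v = of_real a1 * ((v 0 + \<i> * v 1) * (v 0 - \<i> * v 1))
      + of_real a2 * ((v 2 + \<i> * v 3) * (v 2 - \<i> * v 3)) - of_real b * ((v 4 + \<i> * v 5) * (v 4 - \<i> * v 5))" for v
    unfolding cone_bilin_def by (simp add: algebra_simps)
  have pw: "polyfun 6 (\<lambda>v. f v ^ n)" if "polyfun 6 f" for f n
    using that by (induction n) (auto intro: polyfun.intros)
  \<comment> \<open>coordinates: the equation of the quadric determines \<open>y\<^sub>3\<close> once \<open>y\<^sub>1\<close> and \<open>x\<^sub>2\<close> are
    divisible by \<open>x\<^sub>3\<close>\<close>
  define G where "G \<xi> \<eta> t u \<mu> =
    cpoint \<xi> (t * u) (of_real (b / a2) * \<mu> * t) \<eta> t (of_real (a1 / b) * \<xi> * u + \<eta> * \<mu>)" for \<xi> \<eta> t u \<mu>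
  have G: "cone_bilin a1 a2 b (G \<xi> \<eta> t u \<mu>) (G \<xi> \<eta> t u \<mu>) = 0" for \<xi> \<eta> t u \<mu>
    unfolding quad G_def coord using nz by (simp add: field_simps)
  have coordG: "G \<xi> \<eta> t u \<mu> 0 + \<i> * G \<xi> \<eta> t u \<mu> 1 = \<xi>" "G \<xi> \<eta> t u \<mu> 0 - \<i> * G \<xi> \<eta> t u \<mu> 1 = t * u"
    "G \<xi> \<eta> t u \<mu> 2 + \<i> * G \<xi> \<eta> t u \<mu> 3 = of_real (b / a2) * \<mu> * t"
    "G \<xi> \<eta> t u \<mu> 2 - \<i> * G \<xi> \<eta> t u \<mu> 3 = \<eta>" for \<xi> \<eta> t u \<mu>
    unfolding G_def coord by simp_all
  note dense = cone_zero_if_zero_on_reals[OF _ sgn _ G]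
  have PQ': "P (G \<xi> \<eta> t u \<mu>) * Q (G \<xi> \<eta> t u \<mu>) = (\<xi> * (t * u)) ^ c" for \<xi> \<eta> t u \<mu>
  proof -
    have "polyfun 6 (\<lambda>v. P v * Q v - ((v 0 + \<i> * v 1) * (v 0 - \<i> * v 1)) ^ c)"
      using PQRS by (intro polyfun_diff pw polyfun.intros) auto
    from dense[OF this, of \<xi> \<eta> t u \<mu>] PQ show ?thesis unfolding coordG by simp
  qed
  have PR': "P (G \<xi> \<eta> t u \<mu>) * R (G \<xi> \<eta> t u \<mu>) = \<xi> ^ c * \<eta> ^ d" for \<xi> \<eta> t u \<mu>
  proof -
    have "polyfun 6 (\<lambda>v. P v * R v - (v 0 + \<i> * v 1) ^ c * (v 2 - \<i> * v 3) ^ d)"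
      using PQRS by (intro polyfun_diff pw polyfun.intros) auto
    from dense[OF this, of \<xi> \<eta> t u \<mu>] PR show ?thesis unfolding coordG by simp
  qed
  have SR': "S (G \<xi> \<eta> t u \<mu>) * R (G \<xi> \<eta> t u \<mu>) = (of_real (b / a2) * \<mu> * t * \<eta>) ^ d" for \<xi> \<eta> t u \<mu>
  proof -
    have "polyfun 6 (\<lambda>v. S v * R v - ((v 2 + \<i> * v 3) * (v 2 - \<i> * v 3)) ^ d)"
      using PQRS by (intro polyfun_diff pw polyfun.intros) auto
    from dense[OF this, of \<xi> \<eta> t u \<mu>] SR show ?thesis unfolding coordG by simp
  qed
  have inv': "P (G (l1 * \<xi>) (\<eta> / l2) (l3 * t) 0 0) = P (G \<xi> \<eta> t 0 0)" for \<xi> \<eta> t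
  proof -
    define rot where "rot v = cpoint (l1 * (v 0 + \<i> * v 1)) ((v 0 - \<i> * v 1) / l1)
        (l2 * (v 2 + \<i> * v 3)) ((v 2 - \<i> * v 3) / l2)
        (l3 * (v 4 + \<i> * v 5)) ((v 4 - \<i> * v 5) / l3)" for v :: "nat \<Rightarrow> complex"
    have div: "polyfun 6 (\<lambda>v. f v / k)" if "polyfun 6 f" for f k
      using polyfun.mult[OF polyfun.const[of 6 "inverse k"] that] by (simp add: field_simps)
    have cond: "polyfun 6 (\<lambda>v. if c then f v else g v)" if "polyfun 6 f" "polyfun 6 g" for c f g
      using that by (cases c) simp_all
    have "polyfun 6 (\<lambda>v. P (rot v) - P v)"
    proof (rule polyfun_diff[OF polyfun_compose[OF PQRS(1)] PQRS(1)])
      fix i :: nat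
      show "polyfun 6 (\<lambda>v. rot v i)"
        unfolding rot_def cpoint_def by (intro cond div polyfun_diff polyfun.intros; simp)
    qed
    from dense[OF this, of \<xi> \<eta> t 0 0] inv have "P (rot (G \<xi> \<eta> t 0 0)) = P (G \<xi> \<eta> t 0 0)"
      by (simp add: rot_def)
    moreover have "rot (G \<xi> \<eta> t 0 0) = G (l1 * \<xi>) (\<eta> / l2) (l3 * t) 0 0"
      unfolding rot_def G_def coord by simp
    ultimately show ?thesis by simp
  qed
  have curve: "poly_curve (\<lambda>s. F (G (x1 s) (x2 s) (x3 s) (x4 s) (x5 s)))"
    if "polyfun 6 F" "poly_curve (\<lambda>s. x1 s)" "poly_curve (\<lambda>s. x2 s)" "poly_curve (\<lambda>s. x3 s)"
      "poly_curve (\<lambda>s. x4 s)" "poly_curve (\<lambda>s. x5 s)"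
    for F x1 x2 x3 x4 x5
    unfolding G_def by (rule poly_curve_cpoint[OF that(1)]) (intro poly_curve_intros that(2-))+
  have tu: "P (G \<xi> \<eta> t u \<mu>) = P (G \<xi> \<eta> 0 0 0)" if "\<xi> \<noteq> 0" "\<eta> \<noteq> 0" for \<xi> \<eta> t u \<mu>
  proof -
    have ne: "\<xi> ^ c * \<eta> ^ d \<noteq> 0" using that by simp
    have "P (G \<xi> \<eta> t u \<mu>) = P (G \<xi> \<eta> 0 u \<mu>)"
      by (rule poly_curve_const[of "\<lambda>s. P (G \<xi> \<eta> s u \<mu>)" "\<lambda>s. R (G \<xi> \<eta> s u \<mu>)", OF _ _ PR' ne])
        (rule curve, rule PQRS, (rule poly_curve_intros)+)+
    also have "\<dots> = P (G \<xi> \<eta> 0 0 \<mu>)"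
      by (rule poly_curve_const[of "\<lambda>s. P (G \<xi> \<eta> 0 s \<mu>)" "\<lambda>s. R (G \<xi> \<eta> 0 s \<mu>)", OF _ _ PR' ne])
        (rule curve, rule PQRS, (rule poly_curve_intros)+)+
    also have "\<dots> = P (G \<xi> \<eta> 0 0 0)"
      by (rule poly_curve_const[of "\<lambda>s. P (G \<xi> \<eta> 0 0 s)" "\<lambda>s. R (G \<xi> \<eta> 0 0 s)", OF _ _ PR' ne])
        (rule curve, rule PQRS, (rule poly_curve_intros)+)+
    finally show ?thesis .
  qed
  have eta: "P (G \<xi> \<eta> 0 0 0) = P (G \<xi> 1 0 0 0)" if "\<xi> \<noteq> 0" "\<eta> \<noteq> 0" for \<xi> \<eta>
  proof -
    have ne: "(\<xi> * (1 * 1)) ^ c \<noteq> 0" using that by simp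
    have "P (G \<xi> \<eta> 1 1 0) = P (G \<xi> 1 1 1 0)"
      by (rule poly_curve_const[of "\<lambda>s. P (G \<xi> s 1 1 0)" "\<lambda>s. Q (G \<xi> s 1 1 0)", OF _ _ PQ' ne])
        (rule curve, rule PQRS, (rule poly_curve_intros)+)+
    with tu[OF that, of 1 1 0] tu[OF that(1) one_neq_zero, of 1 1 0] show ?thesis
      by (simp only:)
  qed
  define \<rho> where "\<rho> = R (G 1 1 1 0 1)"
  have R\<rho>: "R (G \<xi> 1 1 0 1) = \<rho>" for \<xi>
  proof -
    have ne: "(of_real (b / a2) * 1 * 1 * 1 :: complex) ^ d \<noteq> 0" using nz by simp
    show ?thesis unfolding \<rho>_def
      by (rule poly_curve_const[of "\<lambda>s. R (G s 1 1 0 1)" "\<lambda>s. S (G s 1 1 0 1)", OF _ _ _ ne])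
        ((rule curve, rule PQRS, (rule poly_curve_intros)+)+, subst mult.commute, rule SR')
  qed
  have P\<rho>: "P (G \<xi> 1 0 0 0) * \<rho> = \<xi> ^ c" if "\<xi> \<noteq> 0" for \<xi>
    using PR'[of \<xi> 1 1 0 1] tu[OF that, of 1 1 0 1] R\<rho> by simp
  have "P (G l1 1 0 0 0) = P (G 1 1 0 0 0)"
    using inv'[of 1 1 0] eta[of l1 "1 / l2"] l by simp
  then show False using P\<rho>[of l1] P\<rho>[of 1] l by simp
qed


section \<open>Weight bases of circle representations\<close>

context hermitian_space
begin

lemma form_scale_right: "h x (cscale c y) = cnj c * h x y"
  by (metis complex_cnj_mult form_hermitian form_scale_left)

lemma form_zero_left [simp]: "h 0 x = 0"
  using form_add_left[of 0 0 x] by simp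

lemma form_diff_left: "h (x - y) z = h x z - h y z"
  using form_add_left[of "x - y" y z] by simp

lemma form_sum_left: "h (\<Sum>i\<in>I. f i) x = (\<Sum>i\<in>I. h (f i) x)"
  by (induction I rule: infinite_finite_induct) (auto simp: form_add_left)

lemma form_self: "h x x = of_real (x \<bullet> x)"
proof -
  have "Im (h x x) = 0" using arg_cong[OF form_hermitian[of x x], of Im] by simp
  then show ?thesis using Re_form[of x x] by (simp add: complex_eq_iff)
qed

lemma form_self_eq_0: "h x x = 0 \<longleftrightarrow> x = 0"
  by (simp add: form_self)

lemma Im_form: "Im (h x y) = x \<bullet> cscale \<i> y"
  using Re_form[of x "cscale \<i> y"] by (simp add: form_scale_right)

lemma bounded_linear_Re_form: "bounded_linear (\<lambda>x. Re (h x y))"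
  and bounded_linear_Im_form: "bounded_linear (\<lambda>x. Im (h x y))"
  unfolding Re_form Im_form by (rule bounded_linear_inner_left)+

lemma cscale_decompose: "cscale c x = Re c *\<^sub>R x + Im c *\<^sub>R cscale \<i> x"
proof -
  have "cscale c x = cscale (of_real (Re c) + of_real (Im c) * \<i>) x"
    by (simp add: complex_eq mult.commute)
  then show ?thesis by (simp only: scale_left_distrib scale_scale[symmetric] scale_of_real)
qed

text \<open>Finiteness is included since the sums below run over the family.\<close>

definition orthonormal :: "'v set \<Rightarrow> bool" where
  "orthonormal E \<longleftrightarrow> finite E \<and> (\<forall>e\<in>E. \<forall>f\<in>E. h e f = (if e = f then 1 else 0))"

lemma orthonormal_sum:
  assumes "orthonormal E" "f \<in> E"
  shows "h (\<Sum>e\<in>E. cscale (c e) e) f = c f"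
proof -
  have "h (\<Sum>e\<in>E. cscale (c e) e) f = (\<Sum>e\<in>E. if e = f then c e else 0)"
    unfolding form_sum_left form_scale_left using assms by (intro sum.cong) (auto simp: orthonormal_def)
  then show ?thesis using assms by (simp add: orthonormal_def)
qed

lemma orthonormal_card_bound:
  assumes "finite B" "span B = UNIV" "orthonormal E"
  shows "card E \<le> card B"
proof -
  have "independent E"
    unfolding independent_explicit_module
  proof (intro allI impI)
    fix t u v assume t: "finite t" "t \<subseteq> E" "(\<Sum>v\<in>t. cscale (u v) v) = 0" "v \<in> t"
    then have "orthonormal t" using assms(3) unfolding orthonormal_def by (simp add: subset_iff)
    from orthonormal_sum[OF this t(4), of u] t(3) show "u v = 0" by simp
  qed
  then show ?thesis using independent_span_bound[OF assms(1), of E] assms(2) by simp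
qed

text \<open>An orthonormal family of vectors with property \<open>Q\<close> of maximal length is a basis as soon as
  every nonzero orthogonal complement of such a family contains a nonzero vector with property \<open>Q\<close>.\<close>

lemma orthonormal_basis_exists:
  assumes scale: "\<And>c u. Q u \<Longrightarrow> Q (cscale c u)"
    and ext: "\<And>E v. orthonormal E \<Longrightarrow> (\<And>e. e \<in> E \<Longrightarrow> Q e) \<Longrightarrow> v \<noteq> 0 \<Longrightarrow> (\<And>e. e \<in> E \<Longrightarrow> h v e = 0) \<Longrightarrow>
        \<exists>u. u \<noteq> 0 \<and> Q u \<and> (\<forall>e\<in>E. h u e = 0)"
  obtains E where "orthonormal E" "\<And>e. e \<in> E \<Longrightarrow> Q e" "\<And>v. v = (\<Sum>e\<in>E. cscale (h v e) e)"
proof -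
  obtain B where B: "finite B" "span B = UNIV" using finite_dim by blast
  let ?P = "\<lambda>E. orthonormal E \<and> (\<forall>e\<in>E. Q e)"
  have "?P {}" by (simp add: orthonormal_def)
  moreover have "\<forall>E. ?P E \<longrightarrow> card E < Suc (card B)"
    using orthonormal_card_bound[OF B] by (simp add: less_Suc_eq_le)
  ultimately have "\<exists>E. ?P E \<and> (\<forall>F. ?P F \<longrightarrow> card F \<le> card E)"
    by (rule ex_has_greatest_nat)
  then obtain E where E: "?P E" and max: "\<And>F. ?P F \<Longrightarrow> card F \<le> card E"
    by blast
  have "v = (\<Sum>e\<in>E. cscale (h v e) e)" for v
  proof (rule ccontr)
    assume neq: "\<not> ?thesis"
    define w where "w = v - (\<Sum>e\<in>E. cscale (h v e) e)"
    have "w \<noteq> 0" "\<And>e. e \<in> E \<Longrightarrow> h w e = 0"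
      using neq E by (auto simp: w_def form_diff_left orthonormal_sum)
    then obtain u where u: "u \<noteq> 0" "Q u" "\<forall>e\<in>E. h u e = 0" using ext E by metis
    define f where "f = cscale (of_real (1 / norm u)) u"
    have "h f f = of_real (1 / norm u) * (of_real (1 / norm u) * h u u)"
      by (simp add: f_def form_scale_left form_scale_right)
    also have "\<dots> = 1"
      using u(1) by (simp add: form_self power2_norm_eq_inner[symmetric] power2_eq_square)
    finally have "h f f = 1" .
    moreover have fe: "h f e = 0" "h e f = 0" if "e \<in> E" for e
      using u(3) that form_hermitian[of e f] by (auto simp: f_def form_scale_left)
    ultimately have "f \<notin> E" "orthonormal (insert f E)"
      using E by (auto simp: orthonormal_def) 
    moreover have "Q f" using scale u(2) unfolding f_def by blast
    ultimately show False using max[of "insert f E"] E by (auto simp: orthonormal_def)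
  qed
  then show thesis using that E by blast
qed

text \<open>A nonzero polynomial \<open>p\<close> with \<open>p(T) v = 0\<close> exists since the iterates of \<open>v\<close> are linearly
  dependent.  Splitting off the roots of \<open>p\<close> one after another, the first factor that kills the
  current vector shows it to be an eigenvector.\<close>

lemma eigenvector_exists:
  assumes T: "Vector_Spaces.linear cscale cscale T"
    and U: "\<And>u. u \<in> U \<Longrightarrow> T u \<in> U" "\<And>u w. u \<in> U \<Longrightarrow> w \<in> U \<Longrightarrow> u - w \<in> U" "\<And>c u. u \<in> U \<Longrightarrow> cscale c u \<in> U"
    and v: "v \<in> U" "v \<noteq> 0"
  obtains u l where "u \<in> U" "u \<noteq> 0" "T u = cscale l u"
proof -
  interpret T: Vector_Spaces.linear cscale cscale T by (rule T)
  have iter: "(T ^^ i) (x - cscale c y) = (T ^^ i) x - cscale c ((T ^^ i) y)" for i x y c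
    by (induction i) (simp_all add: T.diff T.scale)
  define ev where "ev p x = (\<Sum>i\<le>degree p. cscale (coeff p i) ((T ^^ i) x))" for p x
  have ev: "ev p x = (\<Sum>i\<le>n. cscale (coeff p i) ((T ^^ i) x))" if "degree p \<le> n" for p x n
    unfolding ev_def using that
    by (intro sum.mono_neutral_left) (auto simp: coeff_eq_0)
  have ev_factor: "ev ([:- l, 1:] * q) x = ev q (T x - cscale l x)" for l q x
  proof -
    have "degree ([:- l, 1:] * q) \<le> Suc (degree q)"
      by (rule order_trans[OF degree_mult_le]) simp
    then have "ev ([:- l, 1:] * q) x = (\<Sum>i\<le>Suc (degree q). cscale (coeff ([:- l, 1:] * q) i) ((T ^^ i) x))"
      by (rule ev)
    also have "\<dots> = (\<Sum>i\<le>Suc (degree q). cscale (coeff (pCons 0 q) i) ((T ^^ i) x))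
        - (\<Sum>i\<le>Suc (degree q). cscale (l * coeff q i) ((T ^^ i) x))"
      by (simp add: sum_subtractf[symmetric] scale_left_diff_distrib[symmetric] del: sum.atMost_Suc)
    also have "(\<Sum>i\<le>Suc (degree q). cscale (l * coeff q i) ((T ^^ i) x))
        = (\<Sum>i\<le>degree q. cscale (l * coeff q i) ((T ^^ i) x))"
      by (simp add: coeff_eq_0)
    also have "(\<Sum>i\<le>Suc (degree q). cscale (coeff (pCons 0 q) i) ((T ^^ i) x))
        = (\<Sum>i\<le>degree q. cscale (coeff q i) ((T ^^ i) (T x)))"
      by (subst sum.atMost_Suc_shift) (simp add: funpow_swap1)
    finally show ?thesis
      by (simp add: ev_def iter sum_subtractf[symmetric] scale_right_diff_distrib mult.commute)
  qed
  have main: "\<exists>u\<in>U. u \<noteq> 0 \<and> (\<exists>l. T u = cscale l u)"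
    if "p \<noteq> 0" "x \<in> U" "x \<noteq> 0" "ev p x = 0" for p x
    using that
  proof (induction "degree p" arbitrary: p x rule: less_induct)
    case (less p x)
    show ?case
    proof (cases "degree p = 0")
      case True
      then have "cscale (coeff p 0) x = 0" "coeff p 0 \<noteq> 0"
        using less.prems by (auto simp: ev_def) (metis leading_coeff_0_iff)
      then show ?thesis using less.prems by simp
    next
      case False
      then obtain l where "poly p l = 0"
        using fundamental_theorem_of_algebra[of p] constant_degree[of p] by auto
      then obtain q where q: "p = [:- l, 1:] * q" using poly_eq_0_iff_dvd dvdE by blast
      have q0: "q \<noteq> 0" using q less.prems by auto
      have "degree p = Suc (degree q)" unfolding q using q0 by (subst degree_mult_eq) auto
      define w where "w = T x - cscale l x"
      have "ev q w = 0" using less.prems(4) ev_factor q unfolding w_def by simp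
      show ?thesis
      proof (cases "w = 0")
        case True
        then show ?thesis using less.prems w_def by auto
      next
        case False
        moreover have "w \<in> U" unfolding w_def using U less.prems by blast
        ultimately show ?thesis
          using less.hyps[of q w] q0 \<open>degree p = Suc (degree q)\<close> \<open>ev q w = 0\<close> by simp
      qed
    qed
  qed
  have "\<exists>p. p \<noteq> 0 \<and> ev p v = 0"
  proof -
    obtain B where B: "finite B" "span B = UNIV" using finite_dim by blast
    define n where "n = card B"
    define f where "f i = (T ^^ i) v" for i
    have build: "\<exists>p. p \<noteq> 0 \<and> ev p v = 0"
      if c: "(\<Sum>i\<le>n. cscale (c i) (f i)) = 0" "j \<le> n" "c j \<noteq> 0" for c j
    proof -
      define p where "p = (\<Sum>i\<le>n. monom (c i) i)"
      have cf: "coeff p i = (if i \<le> n then c i else 0)" for i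
        unfolding p_def by (simp add: coeff_sum)
      have "degree p \<le> n" by (rule degree_le) (simp add: cf)
      then have "ev p v = 0" using c(1) by (simp add: ev[of p n] cf f_def)
      moreover have "coeff p j \<noteq> 0" using c cf by simp
      then have "p \<noteq> 0" by auto
      ultimately show ?thesis by blast
    qed
    show ?thesis
    proof (cases "inj_on f {..n}")
      case True
      then have "card (f ` {..n}) = Suc n" by (simp add: card_image)
      then have "dependent (f ` {..n})"
        using independent_span_bound[OF B(1), of "f ` {..n}"] B(2) n_def by auto
      then obtain t u x where t: "finite t" "t \<subseteq> f ` {..n}" "(\<Sum>y\<in>t. cscale (u y) y) = 0" "x \<in> t" "u x \<noteq> 0"
        unfolding dependent_explicit by blast
      define c where "c i = (if f i \<in> t then u (f i) else 0)" for i
      obtain j where j: "j \<le> n" "x = f j" using t by auto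
      have "(\<Sum>i\<le>n. cscale (c i) (f i)) = (\<Sum>y\<in>f ` {..n}. if y \<in> t then cscale (u y) y else 0)"
        using True by (simp add: sum.reindex c_def if_distrib[of "\<lambda>a. cscale a _"] cong: if_cong)
      also have "\<dots> = (\<Sum>y\<in>t. cscale (u y) y)"
        using t by (subst sum.inter_restrict[symmetric]) (auto simp: Int_absorb1)
      finally show ?thesis using build[of c j] t j by (simp add: c_def)
    next
      case False
      then obtain i j where ij: "i \<le> n" "j \<le> n" "i \<noteq> j" "f i = f j"
        by (auto simp: inj_on_def)
      define c :: "nat \<Rightarrow> complex" where "c k = (if k = i then 1 else 0) - (if k = j then 1 else 0)" for k
      have "(\<Sum>k\<le>n. cscale (c k) (f k)) = (\<Sum>k\<le>n. if k = i then f k else 0) - (\<Sum>k\<le>n. if k = j then f k else 0)"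
        unfolding c_def sum_subtractf[symmetric] by (intro sum.cong) auto
      also have "\<dots> = 0" using ij by simp
      finally show ?thesis using build[of c i] ij by (simp add: c_def)
    qed
  qed
  then show thesis using main v that by blast
qed

end

lemma has_vector_derivative_shift:
  fixes f :: "real \<Rightarrow> 'a::real_normed_vector"
  assumes "(f has_vector_derivative d) (at (x + c))"
  shows "((\<lambda>t. f (t + c)) has_vector_derivative d) (at x)"
proof -
  have "((\<lambda>t. t + c) has_vector_derivative 1) (at x)"
    unfolding has_real_derivative_iff_has_vector_derivative[symmetric]
    by (auto intro!: derivative_eq_intros)
  from vector_diff_chain_at[OF this, of f d] assms show ?thesis by (simp add: o_def)
qed

text \<open>Averaging over a short interval shows that a continuous one-parameter group is differentiable;
  it then solves a linear differential equation.\<close>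

lemma continuous_exponential_function:
  fixes f :: "real \<Rightarrow> complex"
  assumes cont: "continuous_on UNIV f" and add: "\<And>s t. f (s + t) = f s * f t" and f0: "f 0 = 1"
  obtains c where "\<And>t. f t = exp (c * of_real t)"
proof -
  define F where "F u = integral {-2..u} f" for u
  have F: "(F has_vector_derivative f u) (at u)" if "-2 < u" "u < 2" for u
  proof -
    have "(F has_vector_derivative f u) (at u within {-2..2})"
      unfolding F_def using cont that by (intro integral_has_vector_derivative) (auto intro: continuous_on_subset)
    then show ?thesis using that at_within_interior[of u "{-2..2}"] by (simp add: interior_atLeastAtMost_real)
  qed
  have shift: "F (t + s) - F t = f t * (F s - F 0)" if "\<bar>t\<bar> < 1" "0 \<le> s" "s < 1" for s t
  proof -
    define D where "D s = F (t + s) - F t - f t * (F s - F 0)" for s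
    have "(D has_vector_derivative 0) (at x within {0..s})" if x: "x \<in> {0..s}" for x
    proof -
      have "((\<lambda>s. F (t + s)) has_vector_derivative f (t + x)) (at x)"
        using has_vector_derivative_shift[of F "f (t + x)" x t] F[of "t + x"] x \<open>\<bar>t\<bar> < 1\<close> \<open>s < 1\<close>
        by (auto simp: add.commute)
      moreover have "(F has_vector_derivative f x) (at x)" using F[of x] x \<open>s < 1\<close> by auto
      ultimately have "(D has_vector_derivative f (t + x) - 0 - f t * (f x - 0)) (at x)"
        unfolding D_def
        by (intro has_vector_derivative_diff has_vector_derivative_const has_vector_derivative_mult_right)
      then show ?thesis by (simp add: add has_vector_derivative_at_within)
    qed
    then obtain k where "\<And>x. x \<in> {0..s} \<Longrightarrow> D x = k"
      using has_vector_derivative_zero_constant[of "{0..s}" D] by auto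
    from this[of 0] this[of s] have "D s = D 0" using that by simp
    then show ?thesis by (simp add: D_def)
  qed
  obtain d where d: "0 \<le> d" "d < 1" "F d \<noteq> F 0"
  proof (rule ccontr)
    assume "\<not> thesis"
    with that have eq: "F s = F 0" if "0 \<le> s" "s < 1" for s using that by blast
    have "(F has_vector_derivative f (1/2)) (at (1/2))" by (rule F) auto
    moreover have "(F has_vector_derivative 0) (at (1/2))"
    proof (rule has_vector_derivative_transform_within_open[of "\<lambda>_. F 0" _ _ "{0<..<1}"])
      show "((\<lambda>_. F 0) has_vector_derivative 0) (at (1/2))" by (rule has_vector_derivative_const)
      show "\<And>x. x \<in> {0<..<1} \<Longrightarrow> F 0 = F x" by (rule eq[symmetric]) auto
    qed auto
    ultimately have "f (1/2) = 0" using vector_derivative_unique_at by blast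
    then show False using add[of "1/2" "-1/2"] f0 by simp
  qed
  define c where "c = (f d - 1) / (F d - F 0)"
  have "((\<lambda>t. (F (t + d) - F t) / (F d - F 0)) has_vector_derivative (f (0 + d) - f 0) / (F d - F 0)) (at 0)"
  proof -
    have "((\<lambda>s. F (s + d)) has_vector_derivative f (0 + d)) (at 0)"
      using has_vector_derivative_shift[of F "f (0 + d)" 0 d] F[of d] d by simp
    moreover have "(F has_vector_derivative f 0) (at 0)" using F[of 0] by simp
    ultimately show ?thesis by (intro has_vector_derivative_divide has_vector_derivative_diff)
  qed
  then have quot: "((\<lambda>t. (F (t + d) - F t) / (F d - F 0)) has_vector_derivative c) (at 0)"
    by (simp add: c_def f0)
  have "(f has_vector_derivative c) (at 0)"
  proof (rule has_vector_derivative_transform_within_open[OF quot])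
    show "open {-1<..<1::real}" "0 \<in> {-1<..<1::real}" by auto
    show "(F (t + d) - F t) / (F d - F 0) = f t" if "t \<in> {-1<..<1}" for t
      using that d shift[of t d] by (simp add: abs_less_iff)
  qed
  then have deriv: "(f has_vector_derivative c * f t) (at t)" for t
  proof -
    have "((\<lambda>s. f (s - t)) has_vector_derivative c) (at t)"
      using has_vector_derivative_shift[of f c t "- t"] \<open>(f has_vector_derivative c) (at 0)\<close> by simp
    then have "((\<lambda>s. f (s - t) * f t) has_vector_derivative c * f t) (at t)"
      by (rule has_vector_derivative_mult_left)
    then show ?thesis by (simp add: add[symmetric])
  qed
  have "f t * exp (- (c * of_real t)) = 1" for t
  proof -
    have "((\<lambda>t. f t * exp (- (c * of_real t))) has_vector_derivative 0) (at x within UNIV)" for x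
    proof -
      have "((\<lambda>t. exp (of_real t * (- c))) has_vector_derivative - c * exp (of_real x * (- c))) (at x)"
        using exp_scaleR_has_vector_derivative_right[of "- c" x UNIV] by (simp add: scaleR_conv_of_real mult.commute)
      then show ?thesis
        using has_vector_derivative_mult[OF deriv[of x], of "\<lambda>t. exp (of_real t * (- c))"] by (force simp: algebra_simps)
    qed
    then obtain k where "\<And>t. f t * exp (- (c * of_real t)) = k"
      using has_vector_derivative_zero_constant[of UNIV "\<lambda>t. f t * exp (- (c * of_real t))"] by auto
    from this[of 0] this[of t] f0 show ?thesis by simp
  qed
  then have "f t = exp (c * of_real t)" for t
    by (metis exp_minus_inverse mult.commute mult.left_commute mult.right_neutral)
  then show thesis using that by blast
qed

context unitary_module
begin

lemma rep_mem: "g \<in> carrier G \<Longrightarrow> \<rho> g \<in> carrier (unitary_group cscale h)"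
  using rep_hom by (auto simp: hom_def)

lemma rep_linear: "g \<in> carrier G \<Longrightarrow> Vector_Spaces.linear cscale cscale (\<rho> g)"
  using rep_mem by (auto simp: unitary_group_def)

lemma rep_form: "g \<in> carrier G \<Longrightarrow> h (\<rho> g x) (\<rho> g y) = h x y"
  using rep_mem by (auto simp: unitary_group_def)

lemma rep_mult: "g \<in> carrier G \<Longrightarrow> k \<in> carrier G \<Longrightarrow> \<rho> (g \<otimes>\<^bsub>G\<^esub> k) v = \<rho> g (\<rho> k v)"
  using rep_hom by (auto simp: hom_def unitary_group_def)

lemma rep_one: "\<rho> \<one>\<^bsub>G\<^esub> v = v"
proof -
  have "inj (\<rho> \<one>\<^bsub>G\<^esub>)" using rep_mem[OF one_closed] by (auto simp: unitary_group_def bij_def)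
  moreover have "\<rho> \<one>\<^bsub>G\<^esub> (\<rho> \<one>\<^bsub>G\<^esub> v) = \<rho> \<one>\<^bsub>G\<^esub> v" using rep_mult[of "\<one>\<^bsub>G\<^esub>" "\<one>\<^bsub>G\<^esub>" v] by simp
  ultimately show ?thesis by (auto dest: injD)
qed

lemma
  assumes g: "g \<in> carrier G"
  shows rep_scale: "\<rho> g (cscale c v) = cscale c (\<rho> g v)"
    and rep_add: "\<rho> g (v + w) = \<rho> g v + \<rho> g w"
    and rep_sum: "\<rho> g (\<Sum>i\<in>I. f i) = (\<Sum>i\<in>I. \<rho> g (f i))"
proof -
  interpret T: Vector_Spaces.linear cscale cscale "\<rho> g" by (rule rep_linear[OF g])
  show "\<rho> g (cscale c v) = cscale c (\<rho> g v)" "\<rho> g (v + w) = \<rho> g v + \<rho> g w"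
    "\<rho> g (\<Sum>i\<in>I. f i) = (\<Sum>i\<in>I. \<rho> g (f i))"
    by (rule T.scale T.add T.sum)+
qed

lemma rep_bounded_linear:
  assumes g: "g \<in> carrier G"
  shows "bounded_linear (\<rho> g)"
proof (rule bounded_linear_intro[of _ 1])
  show "\<rho> g (r *\<^sub>R x) = r *\<^sub>R \<rho> g x" for r x
    using rep_scale[OF g] by (simp add: scale_of_real[symmetric])
  have "\<rho> g x \<bullet> \<rho> g x = x \<bullet> x" for x
    using arg_cong[OF rep_form[OF g, of x x], of Re] by (simp add: Re_form)
  then show "norm (\<rho> g x) \<le> norm x * 1" for x by (simp add: norm_eq_sqrt_inner)
qed (rule rep_add[OF g])

end

context unitary_circle_module
begin

lemma cis_mem: "cis t \<in> carrier circle_group"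
  by (simp add: circle_group_def)

lemma rep_cis_add: "\<rho> (cis (s + t)) v = \<rho> (cis s) (\<rho> (cis t) v)"
  using rep_mult[OF cis_mem cis_mem] by (simp add: circle_group_def cis_mult)

lemma rep_cis_0: "\<rho> (cis 0) v = v"
  using rep_one by (simp add: circle_group_def)

lemma rep_cis_continuous: "continuous_on UNIV (\<lambda>t. \<rho> (cis t) v)"
  by (rule continuous_on_compose2[OF rep_continuous]) (auto intro!: continuous_intros)

lemma rep_form_continuous: "continuous_on UNIV (\<lambda>t. h (\<rho> (cis t) u) v)"
proof -
  have "h (\<rho> (cis t) u) v = Complex (\<rho> (cis t) u \<bullet> v) (\<rho> (cis t) u \<bullet> cscale \<i> v)" for t
    by (simp add: complex_eq_iff Re_form Im_form)
  then show ?thesis using rep_cis_continuous by (auto simp: Complex_eq intro!: continuous_intros)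
qed

definition weight_vector :: "int \<Rightarrow> 'v \<Rightarrow> bool" where
  "weight_vector a u \<longleftrightarrow> (\<forall>t. \<rho> (cis t) u = cscale (cis (of_int a * t)) u)"

text \<open>For irrational \<open>\<alpha>\<close> the powers of \<open>cis (2 \<pi> \<alpha>)\<close> are dense in the circle, so an eigenvector of
  this single element is an eigenvector of the whole circle; the eigenvalue is a continuous
  character.\<close>

lemma eigenvector_is_weight_vector:
  assumes irr: "\<alpha> \<notin> \<rat>" and u: "u \<noteq> 0" "\<rho> (cis (2 * pi * \<alpha>)) u = cscale l u"
  shows "\<exists>a. weight_vector a u"
proof -
  define \<psi> where "\<psi> t = h (\<rho> (cis t) u) u / h u u" for t
  have huu: "h u u \<noteq> 0" using u by (simp add: form_self_eq_0)
  define S where "S = {t. \<rho> (cis t) u = cscale (\<psi> t) u}"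
  have \<psi>_cont: "continuous_on UNIV \<psi>"
    unfolding \<psi>_def using huu by (intro continuous_intros rep_form_continuous) auto
  have memS: "t \<in> S" if "\<rho> (cis t) u = cscale c u" for t c
    using that huu by (simp add: S_def \<psi>_def form_scale_left)
  have "S = {t. \<rho> (cis t) u = Re (\<psi> t) *\<^sub>R u + Im (\<psi> t) *\<^sub>R cscale \<i> u}"
    unfolding S_def using cscale_decompose by metis
  also have "closed \<dots>"
    by (intro closed_Collect_eq rep_cis_continuous continuous_intros \<psi>_cont)
  finally have "closed S" .
  have powers: "\<rho> (cis (of_nat k * (2 * pi * \<alpha>))) u = cscale (l ^ k) u" for k
  proof (induction k)
    case 0
    then show ?case using rep_cis_0[of u] by simp
  next
    case (Suc k)
    have "\<rho> (cis (of_nat (Suc k) * (2 * pi * \<alpha>))) u = \<rho> (cis (2 * pi * \<alpha>)) (\<rho> (cis (of_nat k * (2 * pi * \<alpha>))) u)"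
      by (simp only: rep_cis_add[symmetric]) (simp add: algebra_simps)
    then show ?case using Suc u(2) by (simp add: rep_scale[OF cis_mem] mult.commute)
  qed
  have allS: "t \<in> S" for t
  proof -
    have "\<exists>x\<in>S. dist x t < \<epsilon>" if "\<epsilon> > 0" for \<epsilon>
    proof -
      have "\<epsilon> / (2 * pi) > 0" using \<open>\<epsilon> > 0\<close> by simp
      from sequence_of_fractional_parts_is_dense[OF irr this, of "t / (2 * pi)"]
      obtain m k where mk: "0 < k" "\<bar>of_int k * \<alpha> - of_int m - t / (2 * pi)\<bar> < \<epsilon> / (2 * pi)"
        by blast
      define x where "x = 2 * pi * (of_int k * \<alpha> - of_int m)"
      have "cis x = cis (of_nat (nat k) * (2 * pi * \<alpha>)) * cis (2 * pi * of_int (- m))"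
        unfolding cis_mult x_def using mk(1) by (simp add: algebra_simps)
      also have "cis (2 * pi * of_int (- m)) = 1" by (rule cis_multiple_2pi) simp
      finally have "\<rho> (cis x) u = cscale (l ^ nat k) u" using powers[of "nat k"] by simp
      then have "x \<in> S" by (rule memS)
      moreover have "dist x t < \<epsilon>"
      proof -
        have "x - t = 2 * pi * (of_int k * \<alpha> - of_int m - t / (2 * pi))"
          by (simp add: x_def algebra_simps)
        then have "\<bar>x - t\<bar> = 2 * pi * \<bar>of_int k * \<alpha> - of_int m - t / (2 * pi)\<bar>"
          by (simp add: abs_mult)
        also have "\<dots> < 2 * pi * (\<epsilon> / (2 * pi))"
          by (rule mult_strict_left_mono[OF mk(2)]) simp
        finally show ?thesis by (simp add: dist_real_def)
      qed
      ultimately show ?thesis by blast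
    qed
    then show ?thesis using \<open>closed S\<close> closed_approachable by blast
  qed
  then have eig: "\<rho> (cis t) u = cscale (\<psi> t) u" for t by (auto simp: S_def)
  have "cscale (\<psi> (s + t)) u = cscale (\<psi> s * \<psi> t) u" for s t
    using rep_cis_add[of s t u] by (simp add: eig rep_scale[OF cis_mem] mult.commute)
  then have mult: "\<psi> (s + t) = \<psi> s * \<psi> t" for s t using u(1) by simp
  obtain c where c: "\<And>t. \<psi> t = exp (c * of_real t)"
    using continuous_exponential_function[OF \<psi>_cont mult] huu rep_cis_0[of u] by (auto simp: \<psi>_def)
  have "\<psi> (2 * pi) = \<psi> 0" unfolding \<psi>_def by (simp add: cis_2pi)
  then have "exp (c * of_real (2 * pi)) = 1" unfolding c by simp
  then obtain n :: int where n: "Re (c * of_real (2 * pi)) = 0" "Im (c * of_real (2 * pi)) = of_int (2 * n) * pi"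
    unfolding exp_eq_1 by blast
  then have cn: "c = \<i> * of_int n" by (auto simp: complex_eq_iff)
  have "\<psi> t = cis (of_int n * t)" for t
    unfolding c cn by (simp add: cis_conv_exp mult.assoc)
  then show ?thesis using eig unfolding weight_vector_def by metis
qed

text \<open>The orthogonal complement of some weight vectors is invariant under the circle, so an eigenvector
  that it contains is a further weight vector.\<close>

theorem weight_basis_exists:
  obtains E a where "orthonormal E" "\<And>v. v = (\<Sum>e\<in>E. cscale (h v e) e)"
    "\<And>e t. e \<in> E \<Longrightarrow> \<rho> (cis t) e = cscale (cis (of_int (a e) * t)) e"
proof -
  obtain \<alpha> :: real where \<alpha>: "\<alpha> \<notin> \<rat>"
    using countable_rat uncountable_UNIV_real by (metis UNIV_eq_I)
  let ?Q = "\<lambda>u. \<exists>a. weight_vector a u"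
  obtain E where E: "orthonormal E" "\<And>e. e \<in> E \<Longrightarrow> ?Q e" "\<And>v. v = (\<Sum>e\<in>E. cscale (h v e) e)"
  proof (rule orthonormal_basis_exists[of ?Q])
    show "?Q (cscale c u)" if "?Q u" for c u
      using that by (auto simp: weight_vector_def rep_scale[OF cis_mem] mult.commute)
  next
    fix E v assume E: "orthonormal E" "\<And>e. e \<in> E \<Longrightarrow> ?Q e" and v: "v \<noteq> 0" "\<And>e. e \<in> E \<Longrightarrow> h v e = 0"
    define U where "U = {u. \<forall>e\<in>E. h u e = 0}"
    define x where "x = 2 * pi * \<alpha>"
    have inv: "\<rho> (cis x) u \<in> U" if "u \<in> U" for u
    proof -
      have "h (\<rho> (cis x) u) e = 0" if "e \<in> E" for e
      proof -
        obtain a where a: "weight_vector a e" using E(2) \<open>e \<in> E\<close> by blast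
        have "h (\<rho> (cis x) u) (\<rho> (cis x) (\<rho> (cis (- x)) e)) = h u (\<rho> (cis (- x)) e)"
          by (rule rep_form[OF cis_mem])
        also have "\<dots> = 0"
          using a \<open>u \<in> U\<close> \<open>e \<in> E\<close> by (simp add: weight_vector_def form_scale_right U_def)
        finally show ?thesis by (simp add: rep_cis_add[symmetric] rep_cis_0[simplified])
      qed
      then show ?thesis by (simp add: U_def)
    qed
    obtain u l where "u \<in> U" "u \<noteq> 0" "\<rho> (cis x) u = cscale l u"
    proof (rule eigenvector_exists[OF rep_linear[OF cis_mem[of x]], of U v])
      show "v \<in> U" "v \<noteq> 0" using v by (auto simp: U_def)
    qed (use inv in \<open>auto simp: U_def form_diff_left form_scale_left\<close>)
    then show "\<exists>u. u \<noteq> 0 \<and> ?Q u \<and> (\<forall>e\<in>E. h u e = 0)"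
      using eigenvector_is_weight_vector[OF \<alpha>] unfolding x_def U_def by blast
  qed blast
  obtain a where "\<And>e. e \<in> E \<Longrightarrow> weight_vector (a e) e" using E(2) by metis
  then show thesis using that[of E a] E unfolding weight_vector_def by blast
qed

end

locale weight_basis = unitary_circle_module cscale h \<rho>
  for cscale :: "complex \<Rightarrow> 'v::real_inner \<Rightarrow> 'v"
    and h :: "'v \<Rightarrow> 'v \<Rightarrow> complex"
    and \<rho> :: "complex \<Rightarrow> 'v \<Rightarrow> 'v" +
  fixes E :: "'v set" and a :: "'v \<Rightarrow> int"
  assumes orthonormal: "orthonormal E"
    and expansion: "v = (\<Sum>e\<in>E. cscale (h v e) e)"
    and weights: "e \<in> E \<Longrightarrow> \<rho> (cis t) e = cscale (cis (of_int (a e) * t)) e"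
begin

lemma finite_basis: "finite E"
  using orthonormal by (simp add: orthonormal_def)

lemma rep_expansion: "\<rho> (cis t) v = (\<Sum>e\<in>E. cscale (h v e * cis (of_int (a e) * t)) e)"
proof -
  have "\<rho> (cis t) v = \<rho> (cis t) (\<Sum>e\<in>E. cscale (h v e) e)"
    using expansion[of v] by simp
  also have "\<dots> = (\<Sum>e\<in>E. cscale (h v e * cis (of_int (a e) * t)) e)"
    unfolding rep_sum[OF cis_mem] by (intro sum.cong) (auto simp: rep_scale[OF cis_mem] weights)
  finally show ?thesis .
qed

lemma rep_coord: "e \<in> E \<Longrightarrow> h (\<rho> (cis t) v) e = cis (of_int (a e) * t) * h v e"
  unfolding rep_expansion by (simp add: orthonormal_sum[OF orthonormal] mult.commute)

lemma infinitesimal_action_eq: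
  "infinitesimal_action \<rho> v = (\<Sum>e\<in>E. cscale (h v e * (\<i> * of_int (a e))) e)"
proof -
  have one: "((\<lambda>t. cscale (h v e * cis (of_int (a e) * t)) e) has_vector_derivative
      cscale (h v e * (\<i> * of_int (a e))) e) (at 0)" for e
  proof -
    have "((\<lambda>t. exp (t *\<^sub>R (\<i> * of_int (a e)))) has_vector_derivative
        exp (0 *\<^sub>R (\<i> * of_int (a e))) * (\<i> * of_int (a e))) (at 0)"
      by (rule exp_scaleR_has_vector_derivative_right)
    then have "((\<lambda>t. cis (of_int (a e) * t)) has_vector_derivative \<i> * of_int (a e)) (at 0)"
      by (simp add: cis_conv_exp scaleR_conv_of_real mult_ac)
    then have *: "((\<lambda>t. h v e * cis (of_int (a e) * t)) has_vector_derivative h v e * (\<i> * of_int (a e))) (at 0)"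
      by (rule has_vector_derivative_mult_right)
    have lin: "bounded_linear (\<lambda>c. cscale c e)"
    proof (rule bounded_linear_intro[of _ "norm e + norm (cscale \<i> e)"])
      show "cscale (x + y) e = cscale x e + cscale y e" for x y by (rule scale_left_distrib)
      show "cscale (r *\<^sub>R x) e = r *\<^sub>R cscale x e" for r x
        by (simp only: scaleR_conv_of_real scale_scale[symmetric] scale_of_real)
      show "norm (cscale x e) \<le> norm x * (norm e + norm (cscale \<i> e))" for x
      proof -
        have "norm (cscale x e) \<le> \<bar>Re x\<bar> * norm e + \<bar>Im x\<bar> * norm (cscale \<i> e)"
          unfolding cscale_decompose[of x e]
          using norm_triangle_ineq[of "Re x *\<^sub>R e" "Im x *\<^sub>R cscale \<i> e"] by simp
        also have "\<dots> \<le> norm x * norm e + norm x * norm (cscale \<i> e)"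
          by (intro add_mono mult_right_mono abs_Re_le_cmod abs_Im_le_cmod norm_ge_zero)
        finally show ?thesis by (simp add: distrib_left)
      qed
    qed
    show ?thesis by (rule bounded_linear.has_vector_derivative[OF lin *])
  qed
  show ?thesis
    unfolding infinitesimal_action_def rep_expansion
    by (intro vector_derivative_at has_vector_derivative_sum one)
qed

lemma zero_fibre_eq: "zero_fibre h \<rho> = {v. (\<Sum>e\<in>E. of_int (a e) * (cmod (h v e))\<^sup>2) = 0}"
proof -
  have "h (infinitesimal_action \<rho> v) v = (\<Sum>e\<in>E. \<i> * of_int (a e) * of_real ((cmod (h v e))\<^sup>2))" for v
  proof -
    have "h v e * (\<i> * of_int (a e)) * h e v = \<i> * of_int (a e) * of_real ((cmod (h v e))\<^sup>2)" for e
      using form_hermitian[of e v] complex_norm_square[of "h v e"] by (simp add: mult_ac)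
    then show ?thesis unfolding infinitesimal_action_eq form_sum_left form_scale_left
      by (intro sum.cong refl)
  qed
  then have mm: "moment_map h \<rho> v = (\<Sum>e\<in>E. of_int (a e) * (cmod (h v e))\<^sup>2) / 2" for v
    unfolding moment_map_def by simp
  show ?thesis unfolding zero_fibre_def mm by simp
qed

lemma weights_nonzero:
  assumes "fixed_points circle_group \<rho> = {0}" "e \<in> E"
  shows "a e \<noteq> 0"
proof
  assume "a e = 0"
  have "\<rho> z e = e" if "z \<in> carrier circle_group" for z
  proof -
    have "z = cis (Arg z)" using that rcis_cmod_Arg[of z] by (simp add: circle_group_def rcis_def)
    then show ?thesis using weights[OF assms(2), of "Arg z"] \<open>a e = 0\<close> by simp
  qed
  then have "e = 0" using assms(1) by (auto simp: fixed_points_def)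
  then show False using orthonormal assms(2) unfolding orthonormal_def by force
qed

end


section \<open>Quotients of dimension at most two\<close>

text \<open>Invariance of domain excludes an injection of three-dimensional Euclidean space into the plane.\<close>

lemma Euclidean_space_injection_into_complex:
  fixes f :: "(nat \<Rightarrow> real) \<Rightarrow> complex"
  assumes cont: "continuous_map (Euclidean_space d) euclidean f"
    and inj: "inj_on f (topspace (Euclidean_space d))"
  shows "d \<le> 2"
proof (rule ccontr)
  assume "\<not> d \<le> 2"
  then have sub: "topspace (Euclidean_space 3) \<subseteq> topspace (Euclidean_space d)" by simp
  then have "Euclidean_space 3 = subtopology (Euclidean_space d) (topspace (Euclidean_space 3))"
    by (simp add: Euclidean_space_def inf.absorb_iff2 subtopology_subtopology)
  then have cont3: "continuous_map (Euclidean_space 3) euclidean f"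
    using continuous_map_from_subtopology[OF cont] by metis
  obtain p :: "(nat \<Rightarrow> real) \<Rightarrow> real^3" and q
    where pq: "homeomorphic_maps (Euclidean_space DIM(real^3)) euclidean p q"
    using homeomorphic_maps_Euclidean_space_euclidean by blast
  then have q: "continuous_map euclidean (Euclidean_space 3) q" "\<And>x. p (q x) = x"
    by (auto simp: homeomorphic_maps_def)
  have "continuous_on UNIV (f \<circ> q)"
    using continuous_map_compose[OF q(1) cont3] by simp
  moreover have "inj (f \<circ> q)"
  proof (rule injI)
    fix x y assume "(f \<circ> q) x = (f \<circ> q) y"
    moreover have "q z \<in> topspace (Euclidean_space d)" for z
    proof (rule subsetD[OF sub])
      show "q z \<in> topspace (Euclidean_space 3)" using q(1) by (auto simp: continuous_map_def)
    qed
    ultimately have "q x = q y" using inj by (auto dest: inj_onD)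
    then show "x = y" using q(2) by metis
  qed
  ultimately have "dim (UNIV :: (real^3) set) \<le> dim (UNIV :: complex set)"
    by (intro continuous_injective_image_subspace_dim_le) auto
  then show False by simp
qed

lemma chart_dims_injection_into_complex:
  fixes f :: "'a \<Rightarrow> complex"
  assumes cont: "continuous_map X euclidean f" and inj: "inj_on f (topspace X)"
    and d: "d \<in> chart_dims (subtopology X S)"
  shows "d \<le> 2"
proof -
  obtain U where "subtopology (subtopology X S) U homeomorphic_space Euclidean_space d"
    using d by (auto simp: chart_dims_def)
  then obtain p q where pq: "homeomorphic_maps (subtopology X (S \<inter> U)) (Euclidean_space d) p q"
    by (auto simp: homeomorphic_space_def subtopology_subtopology)
  then have q: "continuous_map (Euclidean_space d) (subtopology X (S \<inter> U)) q"
    and pq': "\<And>y. y \<in> topspace (Euclidean_space d) \<Longrightarrow> p (q y) = y"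
    by (auto simp: homeomorphic_maps_def)
  show ?thesis
  proof (rule Euclidean_space_injection_into_complex)
    show "continuous_map (Euclidean_space d) euclidean (f \<circ> q)"
      by (rule continuous_map_compose[OF q continuous_map_from_subtopology[OF cont]])
    show "inj_on (f \<circ> q) (topspace (Euclidean_space d))"
    proof (rule inj_onI)
      fix x y assume xy: "x \<in> topspace (Euclidean_space d)" "y \<in> topspace (Euclidean_space d)"
        and "(f \<circ> q) x = (f \<circ> q) y"
      moreover have "q z \<in> topspace X" if "z \<in> topspace (Euclidean_space d)" for z
        using continuous_map_image_subset_topspace[OF q] that by auto
      ultimately have "q x = q y" using inj by (auto dest: inj_onD)
      then show "x = y" using pq' xy by metis
    qed
  qed
qed

context unitary_module
begin

lemma mem_orbit: "x \<in> orbit G \<rho> x"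
  using rep_one[of x] one_closed by (force simp: orbit_def)

lemma orbit_rep: "g \<in> carrier G \<Longrightarrow> orbit G \<rho> (\<rho> g x) = orbit G \<rho> x"
proof (intro equalityI subsetI)
  fix y assume g: "g \<in> carrier G" and "y \<in> orbit G \<rho> (\<rho> g x)"
  then show "y \<in> orbit G \<rho> x" using rep_mult[OF _ g] g by (auto simp: orbit_def) (metis m_closed)
next
  fix y assume g: "g \<in> carrier G" and "y \<in> orbit G \<rho> x"
  then obtain k where k: "k \<in> carrier G" "y = \<rho> k x" by (auto simp: orbit_def)
  have "\<rho> (k \<otimes>\<^bsub>G\<^esub> inv\<^bsub>G\<^esub> g) (\<rho> g x) = \<rho> (k \<otimes>\<^bsub>G\<^esub> inv\<^bsub>G\<^esub> g \<otimes>\<^bsub>G\<^esub> g) x"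
    using k g by (simp add: rep_mult)
  also have "\<dots> = y" using k g by (simp add: m_assoc)
  finally show "y \<in> orbit G \<rho> (\<rho> g x)" using k g unfolding orbit_def
    by (intro CollectI exI[of _ "k \<otimes>\<^bsub>G\<^esub> inv\<^bsub>G\<^esub> g"]) auto
qed

text \<open>An invariant that separates the orbits maps the quotient, and with it every chart of a stratum,
  injectively to the plane.  The fixed point \<open>0\<close> is a stratum by itself, so the set of chart dimensions, whose maximum is
  \<open>quotient_dim\<close>, is nonempty.\<close>

lemma quotient_dim_le_2:
  fixes \<gamma> :: "'v \<Rightarrow> complex"
  assumes fixed: "fixed_points G \<rho> = {0}" and M: "0 \<in> M"
    and cont: "continuous_on M \<gamma>"
    and inv: "\<And>g x. g \<in> carrier G \<Longrightarrow> x \<in> M \<Longrightarrow> \<gamma> (\<rho> g x) = \<gamma> x"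
    and sep: "\<And>x y. x \<in> M \<Longrightarrow> y \<in> M \<Longrightarrow> \<gamma> x = \<gamma> y \<Longrightarrow> orbit G \<rho> x = orbit G \<rho> y"
  shows "quotient_dim G \<rho> M \<le> 2"
proof -
  let ?X = "orbit_space G \<rho> M"
  define f where "f p = \<gamma> (SOME x. x \<in> p)" for p
  have f: "f (orbit G \<rho> x) = \<gamma> x" if "x \<in> M" for x
  proof -
    have "(SOME y. y \<in> orbit G \<rho> x) \<in> orbit G \<rho> x" using mem_orbit by (rule someI)
    then obtain g where "g \<in> carrier G" "(SOME y. y \<in> orbit G \<rho> x) = \<rho> g x" by (auto simp: orbit_def)
    then show ?thesis using inv that by (simp add: f_def)
  qed
  have fcont: "continuous_map ?X euclidean f"
  proof (rule continuous_compose_quotient_map[OF quotient_map_orbit_space])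
    have "continuous_on M (f \<circ> orbit G \<rho>)" using cont f by (simp cong: continuous_on_cong)
    then show "continuous_map (top_of_set M) euclidean (f \<circ> orbit G \<rho>)" by simp
  qed
  have finj: "inj_on f (topspace ?X)"
  proof (rule inj_onI)
    fix p q assume "p \<in> topspace ?X" "q \<in> topspace ?X" "f p = f q"
    then obtain x y where xy: "x \<in> M" "y \<in> M" and pq: "p = orbit G \<rho> x" "q = orbit G \<rho> y"
      by (auto simp: topspace_orbit_space orbits_def)
    have "\<gamma> x = \<gamma> y" using f[OF xy(1)] f[OF xy(2)] \<open>f p = f q\<close> unfolding pq by simp
    then show "p = q" unfolding pq by (rule sep[OF xy])
  qed
  define D where "D = (\<Union>L. chart_dims (subtopology ?X (stratum G \<rho> M L)))"
  have D: "D \<subseteq> {..2}"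
    using chart_dims_injection_into_complex[OF fcont finj] by (auto simp: D_def)
  have fix0: "\<rho> g 0 = 0" if "g \<in> carrier G" for g using fixed that by (auto simp: fixed_points_def)
  have orbit0: "orbit G \<rho> 0 = {0}" 
  proof
    show "orbit G \<rho> 0 \<subseteq> {0}" using fix0 by (auto simp: orbit_def)
  qed (use mem_orbit in auto)
  have strat: "stratum G \<rho> M (carrier G) = {{0}}"
  proof (intro equalityI subsetI)
    fix p assume "p \<in> stratum G \<rho> M (carrier G)"
    then obtain x y where y: "y \<in> M" "p = orbit G \<rho> y" and x: "x \<in> p" "stabilizer G \<rho> x = carrier G"
      by (auto simp: stratum_def orbits_def)
    have "x \<in> fixed_points G \<rho>" using x(2) by (auto simp: stabilizer_def fixed_points_def)
    then have "0 \<in> orbit G \<rho> y" using fixed x y by auto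
    then obtain g where "g \<in> carrier G" "0 = \<rho> g y" by (auto simp: orbit_def)
    then have "orbit G \<rho> 0 = p" using orbit_rep[of g y] y(2) by simp
    then show "p \<in> {{0}}" using orbit0 by simp
  next
    fix p :: "'v set" assume "p \<in> {{0}}"
    then have "p = orbit G \<rho> 0" using orbit0 by simp
    then show "p \<in> stratum G \<rho> M (carrier G)"
      using M orbit0 fix0 by (auto simp: stratum_def orbits_def stabilizer_def)
  qed
  let ?Y = "subtopology ?X (stratum G \<rho> M (carrier G))"
  have "{0} \<in> topspace ?X"
    using M orbit0 by (auto simp: topspace_orbit_space orbits_def)
  then have topY: "topspace ?Y = {{0}}" using strat by auto
  have top0: "topspace (Euclidean_space 0) = {\<lambda>i. 0}" by (auto simp: topspace_Euclidean_space)
  have "homeomorphic_maps ?Y (Euclidean_space 0) (\<lambda>_ i. 0) (\<lambda>_. {0})"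
    unfolding homeomorphic_maps_def using topY top0 by auto
  then have "subtopology ?Y (topspace ?Y) homeomorphic_space Euclidean_space 0"
    unfolding homeomorphic_space_def subtopology_topspace by blast
  moreover have "topspace ?Y \<noteq> {}" using topY by simp
  ultimately have "0 \<in> D"
    unfolding D_def chart_dims_def using openin_topspace[of ?Y] by blast
  then have "Max D \<le> 2" using D finite_subset[OF D] by (subst Max_le_iff) auto
  then show ?thesis unfolding quotient_dim_def D_def .
qed

end

context weight_basis
begin

lemma coord_continuous: "continuous_on S (\<lambda>v. h v e)"
proof -
  have "h v e = Complex (v \<bullet> e) (v \<bullet> cscale \<i> e)" for v
    by (simp add: complex_eq_iff Re_form Im_form)
  then show ?thesis by (auto simp: Complex_eq intro!: continuous_intros)
qed

lemma coords_eqI: "(\<And>e. e \<in> E \<Longrightarrow> h v e = h w e) \<Longrightarrow> v = w"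
  using expansion[of v] expansion[of w] by (metis (mono_tags, lifting) sum.cong)

lemma circle_elem: "z \<in> carrier circle_group \<Longrightarrow> \<exists>t. z = cis t"
  using rcis_cmod_Arg[of z] by (auto simp: circle_group_def rcis_def) metis

text \<open>Otherwise the zero fibre is a point, or there are two weights \<open>A > 0 > -B\<close>, and then
  \<open>z\<^sup>b w\<^sup>a\<close> with \<open>a = A / gcd A B\<close> and \<open>b = B / gcd A B\<close> embeds the quotient in the complex plane: the
  zero fibre determines the ratio of the absolute values of \<open>z\<close> and \<open>w\<close>, and Bezout's identity
  yields the element of the circle that adjusts their arguments.\<close>

theorem weights_of_large_quotient:
  assumes fixed: "fixed_points circle_group \<rho> = {0}"
    and dim: "quotient_dim circle_group \<rho> (zero_fibre h \<rho>) > 2"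
  obtains e1 e2 e3 where "e1 \<in> E" "e2 \<in> E" "e3 \<in> E" "e1 \<noteq> e2" "a e1 * a e2 > 0" "a e1 * a e3 < 0"
proof (rule ccontr)
  assume "\<not> thesis"
  with that have no: "\<not> (a e1 * a e2 > 0 \<and> a e1 * a e3 < 0)"
    if "e1 \<in> E" "e2 \<in> E" "e3 \<in> E" "e1 \<noteq> e2" for e1 e2 e3 using \<open>\<not> thesis\<close> that by blast
  note nz = weights_nonzero[OF fixed]
  let ?M = "zero_fibre h \<rho>"
  have zM: "0 \<in> ?M" by (simp add: zero_fibre_eq)
  have "quotient_dim circle_group \<rho> ?M \<le> 2"
  proof (cases "\<exists>p\<in>E. \<exists>n\<in>E. a p > 0 \<and> a n < 0")
    case False
    then have same: "(\<forall>e\<in>E. a e > 0) \<or> (\<forall>e\<in>E. a e < 0)" using nz by (metis linorder_neqE_linordered_idom)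
    have M0: "v = 0" if "v \<in> ?M" for v
    proof -
      have sum0: "(\<Sum>e\<in>E. of_int (a e) * (cmod (h v e))\<^sup>2) = 0" using that by (simp add: zero_fibre_eq)
      from same have "(\<Sum>e\<in>E. \<bar>of_int (a e)\<bar> * (cmod (h v e))\<^sup>2) = 0"
      proof
        assume "\<forall>e\<in>E. a e > 0"
        then have "(\<Sum>e\<in>E. \<bar>of_int (a e)\<bar> * (cmod (h v e))\<^sup>2) = (\<Sum>e\<in>E. of_int (a e) * (cmod (h v e))\<^sup>2)"
          by (intro sum.cong) auto
        then show ?thesis using sum0 by simp
      next
        assume "\<forall>e\<in>E. a e < 0"
        then have "(\<Sum>e\<in>E. \<bar>of_int (a e)\<bar> * (cmod (h v e))\<^sup>2) = - (\<Sum>e\<in>E. of_int (a e) * (cmod (h v e))\<^sup>2)"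
          unfolding sum_negf[symmetric] by (intro sum.cong) auto
        then show ?thesis using sum0 by simp
      qed
      then have "\<forall>e\<in>E. \<bar>of_int (a e)\<bar> * (cmod (h v e))\<^sup>2 = 0"
        by (subst (asm) sum_nonneg_eq_0_iff) (auto simp: finite_basis)
      then have "h v e = 0" if "e \<in> E" for e using nz that by fastforce
      then show ?thesis by (intro coords_eqI) simp
    qed
    show ?thesis
      by (rule quotient_dim_le_2[OF fixed zM, of "\<lambda>_. 0"]) (auto dest: M0)
  next
    case True
    then obtain p n where pn: "p \<in> E" "n \<in> E" "a p > 0" "a n < 0" by blast
    have E: "e = p \<or> e = n" if "e \<in> E" for e
      using no[of p e n] no[of n e p] pn that nz[OF that]
      by (metis linorder_neqE_linordered_idom mult_neg_neg mult_neg_pos mult_pos_neg mult_pos_pos)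
    have "p \<noteq> n" using pn by auto
    have E_eq: "E = {p, n}" using E pn by blast
    define A B where "A = nat (a p)" and "B = nat (- a n)"
    have AB: "A > 0" "B > 0" "a p = int A" "a n = - int B" using pn by (auto simp: A_def B_def)
    obtain A' B' where red: "A = gcd A B * A'" "B = gcd A B * B'" "coprime A' B'"
      using gcd_coprime_exists[of A B] AB by (metis gcd_eq_0_iff mult.commute neq0_conv)
    have pos: "A' > 0" "B' > 0" using red AB by (metis mult_0_right neq0_conv)+
    define \<gamma> where "\<gamma> v = h v p ^ B' * h v n ^ A'" for v
    have AB': "A * B' = B * A'" using red by (metis mult.assoc mult.commute)
    have inM: "A * (cmod (h v p))\<^sup>2 = B * (cmod (h v n))\<^sup>2" if "v \<in> ?M" for v
      using that \<open>p \<noteq> n\<close> AB by (simp add: zero_fibre_eq E_eq)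
    show ?thesis
    proof (rule quotient_dim_le_2[OF fixed zM, of \<gamma>])
      show "continuous_on ?M \<gamma>" unfolding \<gamma>_def by (intro continuous_intros coord_continuous)
    next
      fix g x assume "g \<in> carrier circle_group"
      then obtain t where t: "g = cis t" using circle_elem by blast
      have "cis (A * t) ^ B' * cis (- B * t) ^ A' = cis (A * B' * t - B * A' * t)"
        by (simp only: Complex.DeMoivre cis_mult) (simp add: algebra_simps)
      also have "\<dots> = 1" using AB' by (simp flip: of_nat_mult)
      finally show "\<gamma> (\<rho> g x) = \<gamma> x"
        using pn AB by (simp add: t \<gamma>_def rep_coord power_mult_distrib algebra_simps)
    next
      fix x y assume xy: "x \<in> ?M" "y \<in> ?M" and eq: "\<gamma> x = \<gamma> y"
      define r where "r = sqrt (B / A)"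
      have r: "r > 0" using AB by (simp add: r_def)
      have cp: "cmod (h v p) = r * cmod (h v n)" if "v \<in> ?M" for v
      proof -
        have "(cmod (h v p))\<^sup>2 = (r * cmod (h v n))\<^sup>2"
          using inM[OF that] AB by (simp add: r_def power_mult_distrib field_simps)
        then show ?thesis using r by (simp add: power2_eq_iff_nonneg)
      qed
      have "r ^ B' * cmod (h x n) ^ (B' + A') = r ^ B' * cmod (h y n) ^ (B' + A')"
        using arg_cong[OF eq, of cmod] cp xy
        by (simp add: \<gamma>_def norm_mult norm_power power_mult_distrib power_add mult.assoc)
      then have nn: "cmod (h x n) = cmod (h y n)"
        using r pos power_eq_iff_eq_base[of "B' + A'" "cmod (h x n)" "cmod (h y n)"] by simp
      then have np: "cmod (h x p) = cmod (h y p)" using cp xy by simp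
      show "orbit circle_group \<rho> x = orbit circle_group \<rho> y"
      proof (cases "h x n = 0")
        case True
        then have "h x n = h y n" "h x p = h y p" using nn cp[OF xy(1)] cp[OF xy(2)] by auto
        then have "x = y" using E_eq by (intro coords_eqI) auto
        then show ?thesis by simp
      next
        case False
        then have nz4: "h x n \<noteq> 0" "h y n \<noteq> 0" "h x p \<noteq> 0" "h y p \<noteq> 0"
          using nn np cp[OF xy(1)] cp[OF xy(2)] r by auto
        define \<theta> \<phi> where "\<theta> = Arg (h y p / h x p)" and "\<phi> = Arg (h y n / h x n)"
        have th: "h y p = cis \<theta> * h x p" "h y n = cis \<phi> * h x n"
          using nz4 nn np rcis_cmod_Arg[of "h y p / h x p"] rcis_cmod_Arg[of "h y n / h x n"]
          by (auto simp: \<theta>_def \<phi>_def rcis_def norm_divide field_simps)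
        have "cis \<theta> ^ B' * cis \<phi> ^ A' = 1"
          using eq nz4 by (simp add: \<gamma>_def th power_mult_distrib)
        then have "cis (B' * \<theta> + A' * \<phi>) = 1" by (simp add: Complex.DeMoivre cis_mult)
        then obtain k :: int where k: "B' * \<theta> + A' * \<phi> = 2 * pi * k"
          by (auto simp: cis_conv_exp exp_eq_1 algebra_simps)
        obtain u v :: int where uv: "u * int A' + v * int B' = 1"
          using red(3) bezout_int[of "int A'" "int B'"] by (auto simp: coprime_iff_gcd_eq_1)
        define t where "t = (\<theta> - 2 * pi * k * v) / A"
        have At: "A * t = \<theta> - 2 * pi * k * v" using AB by (simp add: t_def)
        have "cis (A * t) = cis \<theta> * cis (2 * pi * of_int (- k * v))"
          unfolding cis_mult At by (simp add: algebra_simps)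
        then have cA: "cis (A * t) = cis \<theta>" using cis_multiple_2pi[of "of_int (- k * v)"] by simp
        have "A' * (- B * t) = A' * (\<phi> - 2 * pi * k * u)"
        proof -
          have "A' * (- B * t) = - (B' * (A * t))"
            using arg_cong[OF AB', of real] by (simp add: algebra_simps)
          also have "A * t = \<theta> - 2 * pi * k * v" by (rule At)
          also have "- (B' * (\<theta> - 2 * pi * k * v)) = A' * \<phi> - 2 * pi * k * (1 - v * B')"
            using k by (simp add: algebra_simps)
          also have "1 - v * int B' = u * int A'"
            using uv by linarith
          finally show ?thesis by (simp add: algebra_simps)
        qed
        moreover have "real A' \<noteq> 0" using pos by simp
        ultimately have "- B * t = \<phi> - 2 * pi * k * u" by (simp only: mult_cancel_left) blast
        then have "cis (- B * t) = cis \<phi> * cis (2 * pi * of_int (- k * u))"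
          unfolding cis_mult by (simp add: algebra_simps)
        then have cB: "cis (- B * t) = cis \<phi>" using cis_multiple_2pi[of "of_int (- k * u)"] by simp
        have "y = \<rho> (cis t) x"
        proof (rule coords_eqI)
          fix e assume "e \<in> E"
          then show "h y e = h (\<rho> (cis t) x) e"
            using E_eq th cA cB AB by (auto simp: rep_coord)
        qed
        then show ?thesis using orbit_rep[OF cis_mem] by simp
      qed
    qed
  qed
  then show False using dim by simp
qed

end


section \<open>Regular diffeomorphisms and invariant polynomials\<close>

lemma Ck_const: "Ck k (\<lambda>x. c)"
proof (induction k arbitrary: c)
  case (Suc k)
  then show ?case by (simp add: frechet_derivative_const)
qed simp

lemma zero_mem_invariant_vanishing_ideal: "(\<lambda>x. 0) \<in> invariant_vanishing_ideal G \<rho> M"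
  by (simp add: invariant_vanishing_ideal_def vanishing_ideal_def smooth_invariants_def smooth_def
      Ck_const invariant_def)

lemma mem_coset_invariant_vanishing_ideal:
  "f' \<in> invariant_vanishing_ideal G \<rho> M +>\<^bsub>smooth_invariants G \<rho>\<^esub> f \<longleftrightarrow>
     (\<exists>i\<in>invariant_vanishing_ideal G \<rho> M. f' = (\<lambda>x. i x + f x))"
  by (auto simp: a_r_coset_def' smooth_invariants_def)

lemma class_value_coset:
  assumes "p \<subseteq> M" "x \<in> p" "\<And>y. y \<in> p \<Longrightarrow> f y = c"
  shows "class_value (invariant_vanishing_ideal G \<rho> M +>\<^bsub>smooth_invariants G \<rho>\<^esub> f) p = c"
  unfolding class_value_def
proof (rule the_equality)
  show "\<forall>f'\<in>invariant_vanishing_ideal G \<rho> M +>\<^bsub>smooth_invariants G \<rho>\<^esub> f. \<forall>x\<in>p. f' x = c"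
  proof (intro ballI)
    fix f' y assume "f' \<in> invariant_vanishing_ideal G \<rho> M +>\<^bsub>smooth_invariants G \<rho>\<^esub> f" and y: "y \<in> p"
    then obtain i where "i \<in> invariant_vanishing_ideal G \<rho> M" "f' = (\<lambda>x. i x + f x)"
      unfolding mem_coset_invariant_vanishing_ideal by blast
    then show "f' y = c"
      using y assms by (auto simp: invariant_vanishing_ideal_def vanishing_ideal_def)
  qed
next
  fix c' assume all: "\<forall>f'\<in>invariant_vanishing_ideal G \<rho> M +>\<^bsub>smooth_invariants G \<rho>\<^esub> f. \<forall>x\<in>p. f' x = c'"
  have "f \<in> invariant_vanishing_ideal G \<rho> M +>\<^bsub>smooth_invariants G \<rho>\<^esub> f"
    unfolding mem_coset_invariant_vanishing_ideal
    by (rule bexI[OF _ zero_mem_invariant_vanishing_ideal]) simp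
  then show "c' = c" using all assms by metis
qed

lemma carrier_regular_functions:
  "carrier (regular_functions G \<rho> M) =
     (\<lambda>f. invariant_vanishing_ideal G \<rho> M +>\<^bsub>smooth_invariants G \<rho>\<^esub> f) `
       {f. real_polynomial_function f \<and> invariant G \<rho> f}"
  by (simp add: regular_functions_def)

text \<open>A regular diffeomorphism enters the proof only through these properties: every point of the target
  is an image, and invariant polynomials on the two sides correspond to each other as functions on
  the quotients.  A coset contains its representative, since the zero function lies in the ideal; so
  equality of cosets gives the values of the representatives.\<close>

lemma regular_diffeomorphism_transfer:
  fixes \<rho> :: "'g \<Rightarrow> 'v \<Rightarrow> 'v::real_normed_vector" and \<sigma> :: "'h \<Rightarrow> 'w \<Rightarrow> 'w::real_normed_vector"
  assumes rd: "regular_diffeomorphism G \<rho> M H \<sigma> UNIV F"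
    and mem: "\<And>w. w \<in> orbit H \<sigma> w"
  shows regular_diffeomorphism_surj: "\<exists>x\<in>M. w \<in> F (orbit G \<rho> x)"
    and regular_diffeomorphism_nonempty: "x \<in> M \<Longrightarrow> F (orbit G \<rho> x) \<noteq> {}"
    and regular_diffeomorphism_push: "real_polynomial_function f \<Longrightarrow> invariant G \<rho> f \<Longrightarrow>
      \<exists>g. real_polynomial_function g \<and> invariant H \<sigma> g \<and> (\<forall>x\<in>M. \<forall>w\<in>F (orbit G \<rho> x). g w = f x)"
    and regular_diffeomorphism_pull: "real_polynomial_function g \<Longrightarrow> invariant H \<sigma> g \<Longrightarrow>
      \<exists>f. real_polynomial_function f \<and> invariant G \<rho> f \<and> (\<forall>x\<in>M. \<forall>w\<in>F (orbit G \<rho> x). g w = f x)"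
proof -
  have homeo: "homeomorphic_map (orbit_space G \<rho> M) (orbit_space H \<sigma> UNIV) F"
    and bij: "bij_betw (pullback G \<rho> M F) (carrier (regular_functions H \<sigma> UNIV)) (carrier (regular_functions G \<rho> M))"
    using rd by (auto simp: regular_diffeomorphism_def diffeomorphism_def ring_iso_def)
  have img: "F ` orbits G M \<rho> = orbits H UNIV \<sigma>"
    using homeomorphic_imp_surjective_map[OF homeo] by (simp add: topspace_orbit_space)
  show "\<exists>x\<in>M. w \<in> F (orbit G \<rho> x)"
  proof -
    have "orbit H \<sigma> w \<in> F ` orbits G M \<rho>" unfolding img by (auto simp: orbits_def)
    then show ?thesis using mem[of w] by (auto simp: orbits_def)
  qed
  have Forb: "\<exists>w. F (orbit G \<rho> x) = orbit H \<sigma> w" if "x \<in> M" for x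
  proof -
    have "F (orbit G \<rho> x) \<in> orbits H UNIV \<sigma>" unfolding img[symmetric] using that by (auto simp: orbits_def)
    then show ?thesis by (auto simp: orbits_def)
  qed
  show "F (orbit G \<rho> x) \<noteq> {}" if "x \<in> M"
    using Forb[OF that] mem by fastforce
  let ?IG = "\<lambda>f. invariant_vanishing_ideal G \<rho> M +>\<^bsub>smooth_invariants G \<rho>\<^esub> f"
  let ?IH = "\<lambda>g. invariant_vanishing_ideal H \<sigma> UNIV +>\<^bsub>smooth_invariants H \<sigma>\<^esub> g"
  have rel: "g w = f x" if g: "invariant H \<sigma> g" and eq: "?IG f = pullback G \<rho> M F (?IH g)"
    and xw: "x \<in> M" "w \<in> F (orbit G \<rho> x)" for f g x w
  proof -
    have "f \<in> ?IG f" unfolding mem_coset_invariant_vanishing_ideal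
      by (rule bexI[OF _ zero_mem_invariant_vanishing_ideal]) simp
    then have "f x = class_value (?IH g) (F (orbit G \<rho> x))"
      unfolding eq using xw by (simp add: pullback_def)
    also have "\<dots> = g w"
    proof (rule class_value_coset)
      obtain w0 where w0: "F (orbit G \<rho> x) = orbit H \<sigma> w0" using Forb xw by blast
      have const: "g z = g w0" if "z \<in> orbit H \<sigma> w0" for z
        using that g by (auto simp: orbit_def invariant_def)
      show "g y = g w" if "y \<in> F (orbit G \<rho> x)" for y
        using const that xw(2) unfolding w0 by metis
    qed (use xw in auto)
    finally show ?thesis by simp
  qed
  show "\<exists>g. real_polynomial_function g \<and> invariant H \<sigma> g \<and> (\<forall>x\<in>M. \<forall>w\<in>F (orbit G \<rho> x). g w = f x)"
    if "real_polynomial_function f" "invariant G \<rho> f"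
  proof -
    have "?IG f \<in> carrier (regular_functions G \<rho> M)" using that by (auto simp: carrier_regular_functions)
    then have "?IG f \<in> pullback G \<rho> M F ` carrier (regular_functions H \<sigma> UNIV)"
      using bij by (simp add: bij_betw_def)
    then obtain g where "real_polynomial_function g" "invariant H \<sigma> g" "?IG f = pullback G \<rho> M F (?IH g)"
      by (auto simp: carrier_regular_functions)
    then show ?thesis using rel by blast
  qed
  show "\<exists>f. real_polynomial_function f \<and> invariant G \<rho> f \<and> (\<forall>x\<in>M. \<forall>w\<in>F (orbit G \<rho> x). g w = f x)"
    if "real_polynomial_function g" "invariant H \<sigma> g"
  proof -
    have "?IH g \<in> carrier (regular_functions H \<sigma> UNIV)" using that by (auto simp: carrier_regular_functions)
    then have "pullback G \<rho> M F (?IH g) \<in> carrier (regular_functions G \<rho> M)"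
      using bij by (auto simp: bij_betw_def)
    then obtain f where "real_polynomial_function f" "invariant G \<rho> f" "?IG f = pullback G \<rho> M F (?IH g)"
      by (auto simp: carrier_regular_functions)
    then show ?thesis using rel that by blast
  qed
qed

definition complex_polynomial_function :: "('a::real_normed_vector \<Rightarrow> complex) \<Rightarrow> bool" where
  "complex_polynomial_function f \<longleftrightarrow>
     real_polynomial_function (\<lambda>x. Re (f x)) \<and> real_polynomial_function (\<lambda>x. Im (f x))"

definition complex_invariant :: "('g, 'b) monoid_scheme \<Rightarrow> ('g \<Rightarrow> 'v \<Rightarrow> 'v) \<Rightarrow> ('v \<Rightarrow> complex) \<Rightarrow> bool" where
  "complex_invariant G \<rho> f \<longleftrightarrow> (\<forall>g\<in>carrier G. \<forall>x. f (\<rho> g x) = f x)"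

lemma complex_polynomial_function_intros:
  "complex_polynomial_function (\<lambda>x. c)"
  "complex_polynomial_function f \<Longrightarrow> complex_polynomial_function g \<Longrightarrow> complex_polynomial_function (\<lambda>x. f x + g x)"
  "complex_polynomial_function f \<Longrightarrow> complex_polynomial_function g \<Longrightarrow> complex_polynomial_function (\<lambda>x. f x * g x)"
  "complex_polynomial_function f \<Longrightarrow> complex_polynomial_function (\<lambda>x. cnj (f x))"
  "real_polynomial_function r \<Longrightarrow> complex_polynomial_function (\<lambda>x. of_real (r x))"
  by (auto simp: complex_polynomial_function_def)

lemma complex_polynomial_function_power:
  "complex_polynomial_function f \<Longrightarrow> complex_polynomial_function (\<lambda>x. f x ^ n)"
  by (induction n) (auto intro: complex_polynomial_function_intros)

lemma complex_polynomial_function_prod: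
  "(\<And>i. i \<in> I \<Longrightarrow> complex_polynomial_function (f i)) \<Longrightarrow> complex_polynomial_function (\<lambda>x. \<Prod>i\<in>I. f i x)"
proof (induction I rule: infinite_finite_induct)
  case (insert i I)
  then have "complex_polynomial_function (f i)" "complex_polynomial_function (\<lambda>x. \<Prod>j\<in>I. f j x)" by auto
  then show ?case using insert.hyps complex_polynomial_function_intros(3) by simp
qed (simp_all add: complex_polynomial_function_intros)

lemma complex_regular_transfer:
  fixes \<rho> :: "'g \<Rightarrow> 'v \<Rightarrow> 'v::real_normed_vector" and \<sigma> :: "'h \<Rightarrow> 'w \<Rightarrow> 'w::real_normed_vector"
  assumes rd: "regular_diffeomorphism G \<rho> M H \<sigma> UNIV F"
    and mem: "\<And>w. w \<in> orbit H \<sigma> w"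
  shows complex_regular_push: "complex_polynomial_function f \<Longrightarrow> complex_invariant G \<rho> f \<Longrightarrow>
      \<exists>g. complex_polynomial_function g \<and> complex_invariant H \<sigma> g \<and> (\<forall>x\<in>M. \<forall>w\<in>F (orbit G \<rho> x). g w = f x)"
    and complex_regular_pull: "complex_polynomial_function g \<Longrightarrow> complex_invariant H \<sigma> g \<Longrightarrow>
      \<exists>f. complex_polynomial_function f \<and> complex_invariant G \<rho> f \<and> (\<forall>x\<in>M. \<forall>w\<in>F (orbit G \<rho> x). g w = f x)"
proof -
  note push = regular_diffeomorphism_push[OF rd mem] and pull = regular_diffeomorphism_pull[OF rd mem]
  show "\<exists>g. complex_polynomial_function g \<and> complex_invariant H \<sigma> g \<and> (\<forall>x\<in>M. \<forall>w\<in>F (orbit G \<rho> x). g w = f x)"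
    if f: "complex_polynomial_function f" "complex_invariant G \<rho> f"
  proof -
    obtain r where r: "real_polynomial_function r" "invariant H \<sigma> r" "\<forall>x\<in>M. \<forall>w\<in>F (orbit G \<rho> x). r w = Re (f x)"
      using push[of "\<lambda>x. Re (f x)"] f
      by (auto simp: complex_polynomial_function_def complex_invariant_def invariant_def)
    obtain s where s: "real_polynomial_function s" "invariant H \<sigma> s" "\<forall>x\<in>M. \<forall>w\<in>F (orbit G \<rho> x). s w = Im (f x)"
      using push[of "\<lambda>x. Im (f x)"] f
      by (auto simp: complex_polynomial_function_def complex_invariant_def invariant_def)
    show ?thesis
      using r s by (intro exI[of _ "\<lambda>w. Complex (r w) (s w)"])
        (auto simp: complex_polynomial_function_def complex_invariant_def invariant_def complex_eq_iff)
  qed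
  show "\<exists>f. complex_polynomial_function f \<and> complex_invariant G \<rho> f \<and> (\<forall>x\<in>M. \<forall>w\<in>F (orbit G \<rho> x). g w = f x)"
    if g: "complex_polynomial_function g" "complex_invariant H \<sigma> g"
  proof -
    obtain r where r: "real_polynomial_function r" "invariant G \<rho> r" "\<forall>x\<in>M. \<forall>w\<in>F (orbit G \<rho> x). Re (g w) = r x"
      using pull[of "\<lambda>x. Re (g x)"] g
      by (auto simp: complex_polynomial_function_def complex_invariant_def invariant_def)
    obtain s where s: "real_polynomial_function s" "invariant G \<rho> s" "\<forall>x\<in>M. \<forall>w\<in>F (orbit G \<rho> x). Im (g w) = s x"
      using pull[of "\<lambda>x. Im (g x)"] g
      by (auto simp: complex_polynomial_function_def complex_invariant_def invariant_def)
    show ?thesis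
      using r s by (intro exI[of _ "\<lambda>x. Complex (r x) (s x)"])
        (auto simp: complex_polynomial_function_def complex_invariant_def invariant_def complex_eq_iff)
  qed
qed

text \<open>In real coordinates a polynomial function has a complexification.\<close>

lemma real_polynomial_function_imp_polyfun:
  assumes "real_polynomial_function g"
  shows "\<exists>p. polyfun m p \<and> (\<forall>u. of_real (g (\<Sum>i<m. u i *\<^sub>R b i)) = p (\<lambda>i. of_real (u i)))"
  using assms
proof (induction rule: real_polynomial_function.induct)
  case (linear f)
  interpret f: bounded_linear f by (rule linear)
  have "polyfun m (\<lambda>v. \<Sum>i<m. v i * of_real (f (b i)))"
    by (rule polyfun_sum) (auto intro!: polyfun.intros)
  moreover have "of_real (f (\<Sum>i<m. u i *\<^sub>R b i)) = (\<Sum>i<m. of_real (u i) * complex_of_real (f (b i)))" for u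
    by (simp add: f.sum f.scaleR)
  ultimately show ?case by blast
next
  case (const c)
  show ?case by (rule exI[of _ "\<lambda>_. of_real c"]) (simp add: polyfun.const)
next
  case (add f g)
  then obtain p q where "polyfun m p" "polyfun m q" "\<forall>u. of_real (f (\<Sum>i<m. u i *\<^sub>R b i)) = p (\<lambda>i. of_real (u i))"
    "\<forall>u. of_real (g (\<Sum>i<m. u i *\<^sub>R b i)) = q (\<lambda>i. of_real (u i))" by blast
  then show ?case by (intro exI[of _ "\<lambda>v. p v + q v"]) (simp add: polyfun.add)
next
  case (mult f g)
  then obtain p q where "polyfun m p" "polyfun m q" "\<forall>u. of_real (f (\<Sum>i<m. u i *\<^sub>R b i)) = p (\<lambda>i. of_real (u i))"
    "\<forall>u. of_real (g (\<Sum>i<m. u i *\<^sub>R b i)) = q (\<lambda>i. of_real (u i))" by blast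
  then show ?case by (intro exI[of _ "\<lambda>v. p v * q v"]) (simp add: polyfun.mult)
qed

lemma complex_polynomial_function_imp_polyfun:
  assumes "complex_polynomial_function f"
  shows "\<exists>p. polyfun m p \<and> (\<forall>u. f (\<Sum>i<m. u i *\<^sub>R b i) = p (\<lambda>i. of_real (u i)))"
proof -
  obtain p q where pq: "polyfun m p" "polyfun m q"
    "\<And>u. of_real (Re (f (\<Sum>i<m. u i *\<^sub>R b i))) = p (\<lambda>i. of_real (u i))"
    "\<And>u. of_real (Im (f (\<Sum>i<m. u i *\<^sub>R b i))) = q (\<lambda>i. of_real (u i))"
    using assms real_polynomial_function_imp_polyfun[of "\<lambda>x. Re (f x)" m b]
      real_polynomial_function_imp_polyfun[of "\<lambda>x. Im (f x)" m b]
    unfolding complex_polynomial_function_def by blast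
  have "polyfun m (\<lambda>v. p v + \<i> * q v)" using pq by (intro polyfun.intros)
  moreover have "f (\<Sum>i<m. u i *\<^sub>R b i) = p (\<lambda>i. of_real (u i)) + \<i> * q (\<lambda>i. of_real (u i))" for u
    unfolding pq(3,4)[symmetric] by (rule complex_eq)
  ultimately show ?thesis by blast
qed

lemma polyfun_imp_complex_polynomial_function:
  "polyfun m p \<Longrightarrow> (\<And>i. bounded_linear (l i)) \<Longrightarrow> complex_polynomial_function (\<lambda>w. p (\<lambda>i. of_real (l i w)))"
proof (induction rule: polyfun.induct)
  case (var i)
  then show ?case by (intro complex_polynomial_function_intros real_polynomial_function.intros(1))
next
  case (add f g)
  then show ?case using complex_polynomial_function_intros(2) by blast
next
  case (mult f g)
  then show ?case using complex_polynomial_function_intros(3) by blast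
qed (rule complex_polynomial_function_intros)

context hermitian_space
begin

lemma real_orthonormal_coordinates:
  obtains m :: nat and b :: "nat \<Rightarrow> 'v" where "\<And>w. w = (\<Sum>i<m. (w \<bullet> b i) *\<^sub>R b i)"
proof -
  obtain E where E: "orthonormal E" "\<And>v. v = (\<Sum>e\<in>E. cscale (h v e) e)"
    by (rule orthonormal_basis_exists[of "\<lambda>_. True"]) blast+
  define n where "n = card E"
  obtain f where f: "bij_betw f {..<n} E"
    using E(1) ex_bij_betw_nat_finite[of E] unfolding n_def orthonormal_def by (auto simp: atLeast0LessThan)
  define b where "b i = (if i < n then f i else cscale \<i> (f (i - n)))" for i
  have "w = (\<Sum>i<n + n. (w \<bullet> b i) *\<^sub>R b i)" for w
  proof -
    have "w = (\<Sum>e\<in>E. cscale (h w e) e)" by (rule E(2))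
    also have "\<dots> = (\<Sum>e\<in>E. (w \<bullet> e) *\<^sub>R e + (w \<bullet> cscale \<i> e) *\<^sub>R cscale \<i> e)"
      by (simp only: cscale_decompose[of "h w _"] Re_form Im_form)
    also have "\<dots> = (\<Sum>i<n. (w \<bullet> f i) *\<^sub>R f i + (w \<bullet> cscale \<i> (f i)) *\<^sub>R cscale \<i> (f i))"
      by (rule sum.reindex_bij_betw[OF f, symmetric])
    also have "\<dots> = (\<Sum>i<n. (w \<bullet> b i) *\<^sub>R b i) + (\<Sum>i<n. (w \<bullet> b (i + n)) *\<^sub>R b (i + n))"
      by (simp add: sum.distrib b_def)
    also have "(\<Sum>i<n. (w \<bullet> b (i + n)) *\<^sub>R b (i + n)) = (\<Sum>i\<in>{n..<n + n}. (w \<bullet> b i) *\<^sub>R b i)"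
      using sum.shift_bounds_nat_ivl[of "\<lambda>i. (w \<bullet> b i) *\<^sub>R b i" 0 n n] by (simp add: atLeast0LessThan)
    finally show ?thesis
      using sum.atLeastLessThan_concat[of 0 n "n + n" "\<lambda>i. (w \<bullet> b i) *\<^sub>R b i"] by (simp add: atLeast0LessThan)
  qed
  then show thesis by (rule that)
qed

end

context unitary_module
begin

text \<open>The four factors are not invariant themselves, but their norms, the products of their
  translates, are.\<close>

lemma invariant_four_number:
  assumes fin: "finite (carrier G)"
    and poly: "complex_polynomial_function A" "complex_polynomial_function B"
      "complex_polynomial_function C" "complex_polynomial_function D"
    and inv: "complex_invariant G \<rho> A" "complex_invariant G \<rho> B" "complex_invariant G \<rho> C" "complex_invariant G \<rho> D"
    and eq: "\<And>w. A w * D w = B w * C w" and nz: "A w0 \<noteq> 0"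
  obtains P Q R S where
    "complex_polynomial_function P" "complex_polynomial_function Q"
    "complex_polynomial_function R" "complex_polynomial_function S"
    "complex_invariant G \<rho> P" "complex_invariant G \<rho> Q" "complex_invariant G \<rho> R" "complex_invariant G \<rho> S"
    "\<And>w. P w * Q w = A w ^ card (carrier G)" "\<And>w. P w * R w = B w ^ card (carrier G)"
    "\<And>w. S w * Q w = C w ^ card (carrier G)" "\<And>w. S w * R w = D w ^ card (carrier G)"
proof -
  obtain m :: nat and b :: "nat \<Rightarrow> 'v" where b: "\<And>w. w = (\<Sum>i<m. (w \<bullet> b i) *\<^sub>R b i)"
    using real_orthonormal_coordinates by blast
  define crd where "crd w i = complex_of_real (w \<bullet> b i)" for w i
  obtain pa where pa: "polyfun m pa" "\<And>u. A (\<Sum>i<m. u i *\<^sub>R b i) = pa (\<lambda>i. of_real (u i))"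
    using complex_polynomial_function_imp_polyfun[OF poly(1)] by blast
  obtain pb where pb: "polyfun m pb" "\<And>u. B (\<Sum>i<m. u i *\<^sub>R b i) = pb (\<lambda>i. of_real (u i))"
    using complex_polynomial_function_imp_polyfun[OF poly(2)] by blast
  obtain pc where pc: "polyfun m pc" "\<And>u. C (\<Sum>i<m. u i *\<^sub>R b i) = pc (\<lambda>i. of_real (u i))"
    using complex_polynomial_function_imp_polyfun[OF poly(3)] by blast
  obtain pd where pd: "polyfun m pd" "\<And>u. D (\<Sum>i<m. u i *\<^sub>R b i) = pd (\<lambda>i. of_real (u i))"
    using complex_polynomial_function_imp_polyfun[OF poly(4)] by blast
  have crd: "A w = pa (crd w)" "B w = pb (crd w)" "C w = pc (crd w)" "D w = pd (crd w)" for w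
    using pa(2)[of "\<lambda>i. w \<bullet> b i"] pb(2)[of "\<lambda>i. w \<bullet> b i"] pc(2)[of "\<lambda>i. w \<bullet> b i"] pd(2)[of "\<lambda>i. w \<bullet> b i"] b[of w]
    unfolding crd_def by simp_all
  have "pa v * pd v - pb v * pc v = 0" for v
  proof (rule polyfun_zero_if_zero_on_reals[of m "\<lambda>v. pa v * pd v - pb v * pc v"])
    show "polyfun m (\<lambda>v. pa v * pd v - pb v * pc v)"
      by (intro polyfun_diff polyfun.mult pa pb pc pd)
    fix v :: "nat \<Rightarrow> complex" assume "\<forall>i. v i \<in> \<real>"
    then have "v = (\<lambda>i. of_real (Re (v i)))" by (simp add: fun_eq_iff)
    then show "pa v * pd v - pb v * pc v = 0"
      using eq pa(2)[of "\<lambda>i. Re (v i)"] pb(2)[of "\<lambda>i. Re (v i)"] pc(2)[of "\<lambda>i. Re (v i)"] pd(2)[of "\<lambda>i. Re (v i)"]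
      by (metis right_minus_eq)
  qed
  then have peq: "pa v * pd v = pb v * pc v" for v by simp
  have "pa (crd w0) \<noteq> 0" using nz crd by simp
  from polyfun_four_number[OF pa(1) pb(1) pc(1) pd(1) peq this]
  obtain p q r s where pqrs: "polyfun m p" "polyfun m q" "polyfun m r" "polyfun m s"
    and fac: "\<And>v. pa v = p v * q v" "\<And>v. pb v = p v * r v" "\<And>v. pc v = s v * q v" "\<And>v. pd v = s v * r v"
    by blast
  define nrm where "nrm f w = (\<Prod>g\<in>carrier G. f (crd (\<rho> g w)) :: complex)" for f w
  have nrm_poly: "complex_polynomial_function (nrm f)" if "polyfun m f" for f
    unfolding nrm_def crd_def
  proof (rule complex_polynomial_function_prod)
    fix g assume g: "g \<in> carrier G"
    show "complex_polynomial_function (\<lambda>w. f (\<lambda>i. of_real (\<rho> g w \<bullet> b i)))"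
      by (rule polyfun_imp_complex_polynomial_function[OF that])
        (rule bounded_linear_compose[OF bounded_linear_inner_left rep_bounded_linear[OF g]])
  qed
  have nrm_inv: "complex_invariant G \<rho> (nrm f)" for f
    unfolding complex_invariant_def
  proof (intro ballI allI)
    fix k w assume k: "k \<in> carrier G"
    have "nrm f (\<rho> k w) = (\<Prod>g\<in>carrier G. f (crd (\<rho> (g \<otimes>\<^bsub>G\<^esub> k) w)))"
      unfolding nrm_def using k by (intro prod.cong) (auto simp: rep_mult)
    also have "\<dots> = nrm f w"
      unfolding nrm_def
    proof (rule prod.reindex_bij_witness[of _ "\<lambda>g. g \<otimes>\<^bsub>G\<^esub> inv\<^bsub>G\<^esub> k" "\<lambda>g. g \<otimes>\<^bsub>G\<^esub> k"])
    qed (use k in \<open>auto simp: m_assoc\<close>)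
    finally show "nrm f (\<rho> k w) = nrm f w" .
  qed
  have nrm_mult: "nrm f w * nrm g w = X w ^ card (carrier G)"
    if "complex_invariant G \<rho> X" "\<And>w. X w = f (crd w) * g (crd w)" for f g X w
  proof -
    have "nrm f w * nrm g w = (\<Prod>k\<in>carrier G. X (\<rho> k w))"
      unfolding nrm_def prod.distrib[symmetric] that(2) by simp
    also have "\<dots> = (\<Prod>k\<in>carrier G. X w)"
      using that(1) by (intro prod.cong) (auto simp: complex_invariant_def)
    finally show ?thesis by simp
  qed
  have "nrm p w * nrm q w = A w ^ card (carrier G)" "nrm p w * nrm r w = B w ^ card (carrier G)"
    "nrm s w * nrm q w = C w ^ card (carrier G)" "nrm s w * nrm r w = D w ^ card (carrier G)" for w
    by (rule nrm_mult, rule inv, simp add: crd fac)+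
  then show thesis
    by (intro that[of "nrm p" "nrm q" "nrm r" "nrm s"] nrm_poly nrm_inv pqrs)
qed

end


section \<open>Symplectic quotients and linear symplectic orbifolds\<close>

context weight_basis
begin

text \<open>On the span of the three weight vectors the zero fibre is a quadratic cone in real coordinates.\<close>

lemma no_invariant_factorization:
  assumes e: "e1 \<in> E" "e2 \<in> E" "e3 \<in> E" "e1 \<noteq> e2"
    and sgn: "a e1 * a e2 > 0" "a e1 * a e3 < 0" and "c > 0"
    and poly: "complex_polynomial_function P" "complex_polynomial_function Q"
      "complex_polynomial_function R" "complex_polynomial_function S"
    and inv: "complex_invariant circle_group \<rho> P"
    and PQ: "\<And>v. v \<in> zero_fibre h \<rho> \<Longrightarrow> P v * Q v = (h v e1 * cnj (h v e1)) ^ c"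
    and PR: "\<And>v. v \<in> zero_fibre h \<rho> \<Longrightarrow> P v * R v = h v e1 ^ c * cnj (h v e2) ^ d"
    and SR: "\<And>v. v \<in> zero_fibre h \<rho> \<Longrightarrow> S v * R v = (h v e2 * cnj (h v e2)) ^ d"
  shows False
proof -
  have ne: "e1 \<noteq> e3" "e2 \<noteq> e3" using sgn by (auto simp: zero_less_mult_iff mult_less_0_iff)
  define b where "b = nth [e1, cscale \<i> e1, e2, cscale \<i> e2, e3, cscale \<i> e3]"
  define emb where "emb u = (\<Sum>i<6. u i *\<^sub>R b i)" for u
  have emb: "emb u = cscale (Complex (u 0) (u 1)) e1 + cscale (Complex (u 2) (u 3)) e2
      + cscale (Complex (u 4) (u 5)) e3" for u
    unfolding emb_def b_def
    by (simp add: cscale_decompose[of "Complex _ _"] lessThan_Suc eval_nat_numeral add_ac)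
  have h_emb: "h (emb u) f = (if f = e1 then Complex (u 0) (u 1) else if f = e2 then Complex (u 2) (u 3)
      else if f = e3 then Complex (u 4) (u 5) else 0)" if "f \<in> E" for u f
    unfolding emb form_add_left form_scale_left using orthonormal e ne that
    by (auto simp: orthonormal_def)
  have h12: "h (emb u) e1 = Complex (u 0) (u 1)" "h (emb u) e2 = Complex (u 2) (u 3)" for u
    using e by (simp_all add: h_emb)
  let ?cone = "cone_bilin (of_int (a e1)) (of_int (a e2)) (- of_int (a e3))"
  have emb_M: "emb u \<in> zero_fibre h \<rho>" if "?cone (\<lambda>i. of_real (u i)) (\<lambda>i. of_real (u i)) = 0" for u
  proof -
    have "(\<Sum>f\<in>E. of_int (a f) * (cmod (h (emb u) f))\<^sup>2) = (\<Sum>f\<in>{e1, e2, e3}. of_int (a f) * (cmod (h (emb u) f))\<^sup>2)"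
      using e by (intro sum.mono_neutral_right) (auto simp: finite_basis h_emb)
    also have "\<dots> = of_int (a e1) * ((u 0)\<^sup>2 + (u 1)\<^sup>2) + of_int (a e2) * ((u 2)\<^sup>2 + (u 3)\<^sup>2) + of_int (a e3) * ((u 4)\<^sup>2 + (u 5)\<^sup>2)"
      using e ne by (simp add: h_emb cmod_power2)
    finally have sum_eq: "(\<Sum>f\<in>E. of_int (a f) * (cmod (h (emb u) f))\<^sup>2) = \<dots>" .
    have "complex_of_real (\<Sum>f\<in>E. of_int (a f) * (cmod (h (emb u) f))\<^sup>2) = 0"
      unfolding sum_eq using that by (simp add: cone_bilin_def power2_eq_square)
    then have "(\<Sum>f\<in>E. of_int (a f) * (cmod (h (emb u) f))\<^sup>2) = 0" by (simp only: of_real_eq_0_iff)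
    then show ?thesis by (simp add: zero_fibre_eq)
  qed
  obtain p where p: "polyfun 6 p" "\<And>u. P (emb u) = p (\<lambda>i. of_real (u i))"
    using complex_polynomial_function_imp_polyfun[OF poly(1), of 6 b] unfolding emb_def by blast
  obtain q where q: "polyfun 6 q" "\<And>u. Q (emb u) = q (\<lambda>i. of_real (u i))"
    using complex_polynomial_function_imp_polyfun[OF poly(2), of 6 b] unfolding emb_def by blast
  obtain r where r: "polyfun 6 r" "\<And>u. R (emb u) = r (\<lambda>i. of_real (u i))"
    using complex_polynomial_function_imp_polyfun[OF poly(3), of 6 b] unfolding emb_def by blast
  obtain s where s: "polyfun 6 s" "\<And>u. S (emb u) = s (\<lambda>i. of_real (u i))"
    using complex_polynomial_function_imp_polyfun[OF poly(4), of 6 b] unfolding emb_def by blast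
  have real: "\<exists>u. v = (\<lambda>i. of_real (u i))" if "\<forall>i. v i \<in> \<real>" for v :: "nat \<Rightarrow> complex"
    using that by (intro exI[of _ "\<lambda>i. Re (v i)"]) (simp add: fun_eq_iff)
  have z: "of_real x + \<i> * of_real y = Complex x y" "of_real x - \<i> * of_real y = cnj (Complex x y)" for x y
    by (simp_all add: complex_eq_iff)
  \<comment> \<open>an element of the circle on which the character of weight \<open>c a(e\<^sub>1)\<close> is \<open>-1\<close>\<close>
  define t where "t = pi / (of_int (a e1) * c)"
  define l where "l f = cis (of_int (a f) * t)" for f
  have l0: "l f \<noteq> 0" for f by (simp add: l_def)
  have "of_nat c * (of_int (a e1) * t) = pi" using sgn \<open>c > 0\<close> by (auto simp: t_def)
  then have lc: "l e1 ^ c \<noteq> 1" unfolding l_def Complex.DeMoivre by simp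
  show False
  proof (rule cone_no_invariant_factorization[OF _ _ p(1) q(1) r(1) s(1) _ _ _ l0 l0 l0 lc])
    show "0 < real_of_int (a e1) * - real_of_int (a e3)"
      using sgn(2) by (simp flip: of_int_mult)
    have "a e2 * a e3 < 0" using sgn by (auto simp: zero_less_mult_iff mult_less_0_iff)
    then show "0 < real_of_int (a e2) * - real_of_int (a e3)" by (simp flip: of_int_mult)
  next
    fix v assume v: "\<forall>i. v i \<in> \<real>" "?cone v v = 0"
    then obtain u where u: "v = (\<lambda>i. of_real (u i))" using real by blast
    then have M: "emb u \<in> zero_fibre h \<rho>" using emb_M v by simp
    show "p v * q v = ((v 0 + \<i> * v 1) * (v 0 - \<i> * v 1)) ^ c"
      using PQ[OF M] unfolding p(2) q(2) h12 u z .
    show "p v * r v = (v 0 + \<i> * v 1) ^ c * (v 2 - \<i> * v 3) ^ d"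
      using PR[OF M] unfolding p(2) r(2) h12 u z .
    show "s v * r v = ((v 2 + \<i> * v 3) * (v 2 - \<i> * v 3)) ^ d"
      using SR[OF M] unfolding s(2) r(2) h12 u z .
    define x1 x2 x3 where "x1 = l e1 * Complex (u 0) (u 1)" and "x2 = l e2 * Complex (u 2) (u 3)"
      and "x3 = l e3 * Complex (u 4) (u 5)"
    define u' where "u' = (\<lambda>i. if i = 0 then Re x1 else if i = 1 then Im x1 else if i = 2 then Re x2
      else if i = 3 then Im x2 else if i = 4 then Re x3 else if i = (5::nat) then Im x3 else 0)"
    have "cpoint x1 (cnj x1) x2 (cnj x2) x3 (cnj x3) = (\<lambda>i. of_real (u' i))"
      by (auto simp: cpoint_def u'_def fun_eq_iff complex_eq_iff)
    moreover have "cnj (Complex x y) / l f = cnj (l f * Complex x y)" for x y f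
      by (simp add: l_def cis_cnj divide_inverse cis_inverse mult.commute)
    moreover have "emb u' = \<rho> (cis t) (emb u)"
      by (rule coords_eqI) (auto simp: rep_coord h_emb u'_def x1_def x2_def x3_def l_def complex_eq_iff)
    moreover have "P (\<rho> (cis t) (emb u)) = P (emb u)"
      using inv cis_mem by (simp add: complex_invariant_def)
    ultimately show "p (cpoint (l e1 * (v 0 + \<i> * v 1)) ((v 0 - \<i> * v 1) / l e1)
        (l e2 * (v 2 + \<i> * v 3)) ((v 2 - \<i> * v 3) / l e2)
        (l e3 * (v 4 + \<i> * v 5)) ((v 4 - \<i> * v 5) / l e3)) = p v"
      unfolding u z using p(2)[of u] p(2)[of u'] by (simp add: x1_def x2_def x3_def)
  qed
qed

lemma zero_fibre_point:
  assumes e: "e1 \<in> E" "e3 \<in> E" and sgn: "a e1 * a e3 < 0"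
  obtains x where "x \<in> zero_fibre h \<rho>" "h x e1 \<noteq> 0"
proof -
  have ne: "e1 \<noteq> e3" using sgn by (auto simp: mult_less_0_iff)
  define s r where "s = sqrt \<bar>of_int (a e3)\<bar>" and "r = sqrt \<bar>of_int (a e1)\<bar>"
  define x where "x = cscale (of_real s) e1 + cscale (of_real r) e3"
  have hx: "h x f = (if f = e1 then of_real s else if f = e3 then of_real r else 0)" if "f \<in> E" for f
    unfolding x_def form_add_left form_scale_left using orthonormal e ne that by (auto simp: orthonormal_def)
  have "(\<Sum>f\<in>E. of_int (a f) * (cmod (h x f))\<^sup>2) = (\<Sum>f\<in>{e1, e3}. of_int (a f) * (cmod (h x f))\<^sup>2)"
    using e by (intro sum.mono_neutral_right) (auto simp: finite_basis hx)
  also have "\<dots> = of_int (a e1) * \<bar>of_int (a e3)\<bar> + of_int (a e3) * \<bar>of_int (a e1)\<bar>"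
    using e ne by (simp add: hx s_def r_def)
  also have "\<dots> = 0" using sgn by (auto simp: mult_less_0_iff)
  finally have "x \<in> zero_fibre h \<rho>" by (simp add: zero_fibre_eq)
  moreover have "h x e1 \<noteq> 0" using hx[OF e(1)] sgn by (auto simp: s_def)
  ultimately show thesis by (rule that)
qed

end

theorem theorem1p5:
  fixes scaleV :: "complex \<Rightarrow> 'v::real_inner \<Rightarrow> 'v"
    and hV :: "'v \<Rightarrow> 'v \<Rightarrow> complex"
    and \<rho> :: "complex \<Rightarrow> 'v \<Rightarrow> 'v"
    and scaleW :: "complex \<Rightarrow> 'w::real_inner \<Rightarrow> 'w"
    and hW :: "'w \<Rightarrow> 'w \<Rightarrow> complex"
    and H :: "('h, 'b) monoid_scheme"
    and \<sigma> :: "'h \<Rightarrow> 'w \<Rightarrow> 'w"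
  assumes "unitary_circle_module scaleV hV \<rho>"
    and "fixed_points circle_group \<rho> = {0}"
    and "quotient_dim circle_group \<rho> (zero_fibre hV \<rho>) \<ge> 4"
    and "unitary_module scaleW hW H \<sigma>"
    and "finite (carrier H)"
  shows "\<not> (\<exists>F. regular_diffeomorphism circle_group \<rho> (zero_fibre hV \<rho>) H \<sigma> UNIV F)"
proof
  assume "\<exists>F. regular_diffeomorphism circle_group \<rho> (zero_fibre hV \<rho>) H \<sigma> UNIV F"
  then obtain F where rd: "regular_diffeomorphism circle_group \<rho> (zero_fibre hV \<rho>) H \<sigma> UNIV F" ..
  interpret V: unitary_circle_module scaleV hV \<rho> by (rule assms)
  interpret W: unitary_module scaleW hW H \<sigma> by (rule assms)
  obtain E a where E: "V.orthonormal E" "\<And>v. v = (\<Sum>e\<in>E. scaleV (hV v e) e)"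
    "\<And>e t. e \<in> E \<Longrightarrow> \<rho> (cis t) e = scaleV (cis (of_int (a e) * t)) e"
    using V.weight_basis_exists by blast
  interpret V: weight_basis scaleV hV \<rho> E a by unfold_locales (use E in auto)
  let ?M = "zero_fibre hV \<rho>"
  obtain e1 e2 e3 where e: "e1 \<in> E" "e2 \<in> E" "e3 \<in> E" "e1 \<noteq> e2" "a e1 * a e2 > 0" "a e1 * a e3 < 0"
    using V.weights_of_large_quotient[OF assms(2)] assms(3) by auto
  \<comment> \<open>with these exponents \<open>z1\<^sup>c\<close> and \<open>z2\<^sup>d\<close> have the same weight, so \<open>B\<close> and \<open>C\<close> are invariant\<close>
  define c d where "c = nat \<bar>a e2\<bar>" and "d = nat \<bar>a e1\<bar>"
  have cd: "c > 0" "of_int (a e1) * real c = of_int (a e2) * real d"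
    using e(5) by (auto simp: c_def d_def zero_less_mult_iff)
  define z1 z2 where "z1 v = hV v e1" and "z2 v = hV v e2" for v
  define A B C D where "A v = (z1 v * cnj (z1 v)) ^ c" and "B v = z1 v ^ c * cnj (z2 v) ^ d"
    and "C v = cnj (z1 v) ^ c * z2 v ^ d" and "D v = (z2 v * cnj (z2 v)) ^ d" for v
  have zpoly: "complex_polynomial_function z1" "complex_polynomial_function z2"
    unfolding z1_def z2_def complex_polynomial_function_def
    using V.bounded_linear_Re_form V.bounded_linear_Im_form by (auto intro: real_polynomial_function.intros(1))
  note intros = complex_polynomial_function_intros complex_polynomial_function_power zpoly
  have poly: "complex_polynomial_function A" "complex_polynomial_function B"
    "complex_polynomial_function C" "complex_polynomial_function D"
    unfolding A_def B_def C_def D_def by (intro intros)+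
  have inv: "complex_invariant circle_group \<rho> A" "complex_invariant circle_group \<rho> B"
    "complex_invariant circle_group \<rho> C" "complex_invariant circle_group \<rho> D"
  proof -
    have *: "A (\<rho> g v) = A v \<and> B (\<rho> g v) = B v \<and> C (\<rho> g v) = C v \<and> D (\<rho> g v) = D v"
      if g: "g \<in> carrier circle_group" for g v
    proof -
      obtain t where t: "g = cis t" using V.circle_elem[OF g] by blast
      define u1 u2 where "u1 = cis (of_int (a e1) * t)" and "u2 = cis (of_int (a e2) * t)"
      have z: "z1 (\<rho> g v) = u1 * z1 v" "z2 (\<rho> g v) = u2 * z2 v"
        using e by (simp_all add: t z1_def z2_def u1_def u2_def V.rep_coord)
      have u: "u1 * cnj u1 = 1" "u2 * cnj u2 = 1" by (simp_all add: u1_def u2_def cis_cnj cis_mult)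
      have "u1 ^ c * cnj u2 ^ d = cis (real c * (of_int (a e1) * t) + real d * - (of_int (a e2) * t))"
        unfolding u1_def u2_def cis_cnj Complex.DeMoivre cis_mult ..
      also have "real c * (of_int (a e1) * t) + real d * - (of_int (a e2) * t) = 0"
        using arg_cong[OF cd(2), of "\<lambda>x. x * t"] by (simp add: algebra_simps)
      finally have u12: "u1 ^ c * cnj u2 ^ d = 1" by simp
      have "cnj u1 ^ c * u2 ^ d = cnj (u1 ^ c * cnj u2 ^ d)"
        by (simp only: complex_cnj_mult complex_cnj_power complex_cnj_cnj)
      also have "\<dots> = 1" unfolding u12 by simp
      finally have u21: "cnj u1 ^ c * u2 ^ d = 1" .
      have "A (\<rho> g v) = ((u1 * cnj u1) * (z1 v * cnj (z1 v))) ^ c"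
        unfolding A_def z by (simp add: mult_ac)
      moreover have "B (\<rho> g v) = (u1 ^ c * cnj u2 ^ d) * (z1 v ^ c * cnj (z2 v) ^ d)"
        unfolding B_def z by (simp add: power_mult_distrib mult_ac)
      moreover have "C (\<rho> g v) = (cnj u1 ^ c * u2 ^ d) * (cnj (z1 v) ^ c * z2 v ^ d)"
        unfolding C_def z by (simp add: power_mult_distrib mult_ac)
      moreover have "D (\<rho> g v) = ((u2 * cnj u2) * (z2 v * cnj (z2 v))) ^ d"
        unfolding D_def z by (simp add: mult_ac)
      ultimately show ?thesis unfolding u u12 u21 by (simp add: A_def B_def C_def D_def)
    qed
    then show "complex_invariant circle_group \<rho> A" "complex_invariant circle_group \<rho> B"
      "complex_invariant circle_group \<rho> C" "complex_invariant circle_group \<rho> D"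
      unfolding complex_invariant_def by blast+
  qed
  note mem = W.mem_orbit
  note push = complex_regular_push[OF rd mem] and pull = complex_regular_pull[OF rd mem]
  have rel: "\<exists>x\<in>?M. w \<in> F (orbit circle_group \<rho> x)" for w
    by (rule regular_diffeomorphism_surj[OF rd mem])
  obtain A' where A': "complex_polynomial_function A'" "complex_invariant H \<sigma> A'"
    "\<forall>x\<in>?M. \<forall>w\<in>F (orbit circle_group \<rho> x). A' w = A x" using push[OF poly(1) inv(1)] by blast
  obtain B' where B': "complex_polynomial_function B'" "complex_invariant H \<sigma> B'"
    "\<forall>x\<in>?M. \<forall>w\<in>F (orbit circle_group \<rho> x). B' w = B x" using push[OF poly(2) inv(2)] by blast
  obtain C' where C': "complex_polynomial_function C'" "complex_invariant H \<sigma> C'"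
    "\<forall>x\<in>?M. \<forall>w\<in>F (orbit circle_group \<rho> x). C' w = C x" using push[OF poly(3) inv(3)] by blast
  obtain D' where D': "complex_polynomial_function D'" "complex_invariant H \<sigma> D'"
    "\<forall>x\<in>?M. \<forall>w\<in>F (orbit circle_group \<rho> x). D' w = D x" using push[OF poly(4) inv(4)] by blast
  have eq: "A' w * D' w = B' w * C' w" for w
  proof -
    obtain x where "x \<in> ?M" "w \<in> F (orbit circle_group \<rho> x)" using rel by blast
    then show ?thesis using A'(3) B'(3) C'(3) D'(3)
      by (simp add: A_def B_def C_def D_def power_mult_distrib)
  qed
  obtain x where x: "x \<in> ?M" "z1 x \<noteq> 0"
    using V.zero_fibre_point[OF e(1,3,6)] unfolding z1_def by blast
  obtain w where w: "w \<in> F (orbit circle_group \<rho> x)"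
    using regular_diffeomorphism_nonempty[OF rd mem x(1)] by blast
  have "A' w \<noteq> 0" using A'(3) x w by (simp add: A_def)
  let ?N = "card (carrier H)"
  have N: "?N > 0" using assms(5) W.one_closed by (auto simp: card_gt_0_iff)
  obtain P' Q' R' S' where
    poly': "complex_polynomial_function P'" "complex_polynomial_function Q'"
      "complex_polynomial_function R'" "complex_polynomial_function S'"
    and inv': "complex_invariant H \<sigma> P'" "complex_invariant H \<sigma> Q'" "complex_invariant H \<sigma> R'" "complex_invariant H \<sigma> S'"
    and fac: "\<And>w. P' w * Q' w = A' w ^ ?N" "\<And>w. P' w * R' w = B' w ^ ?N"
      "\<And>w. S' w * Q' w = C' w ^ ?N" "\<And>w. S' w * R' w = D' w ^ ?N"
    by (rule W.invariant_four_number
        [OF assms(5) A'(1) B'(1) C'(1) D'(1) A'(2) B'(2) C'(2) D'(2) eq \<open>A' w \<noteq> 0\<close>])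
      (rule that; assumption)
  obtain P where P: "complex_polynomial_function P" "complex_invariant circle_group \<rho> P"
    "\<forall>x\<in>?M. \<forall>w\<in>F (orbit circle_group \<rho> x). P' w = P x" using pull[OF poly'(1) inv'(1)] by blast
  obtain Q where Q: "complex_polynomial_function Q"
    "\<forall>x\<in>?M. \<forall>w\<in>F (orbit circle_group \<rho> x). Q' w = Q x" using pull[OF poly'(2) inv'(2)] by blast
  obtain R where R: "complex_polynomial_function R"
    "\<forall>x\<in>?M. \<forall>w\<in>F (orbit circle_group \<rho> x). R' w = R x" using pull[OF poly'(3) inv'(3)] by blast
  obtain S where S: "complex_polynomial_function S"
    "\<forall>x\<in>?M. \<forall>w\<in>F (orbit circle_group \<rho> x). S' w = S x" using pull[OF poly'(4) inv'(4)] by blast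
  show False
  proof (rule V.no_invariant_factorization[OF e _ P(1) Q(1) R(1) S(1) P(2)])
    show "c * ?N > 0" using cd N by simp
  next
    fix v assume v: "v \<in> ?M"
    then obtain w where w: "w \<in> F (orbit circle_group \<rho> v)"
      using regular_diffeomorphism_nonempty[OF rd mem] by blast
    show "P v * Q v = (hV v e1 * cnj (hV v e1)) ^ (c * ?N)"
      using fac(1)[of w] A'(3) P(3) Q(2) v w by (simp add: A_def z1_def power_mult)
    show "P v * R v = hV v e1 ^ (c * ?N) * cnj (hV v e2) ^ (d * ?N)"
      using fac(2)[of w] B'(3) P(3) R(2) v w by (simp add: B_def z1_def z2_def power_mult power_mult_distrib)
    show "S v * R v = (hV v e2 * cnj (hV v e2)) ^ (d * ?N)"
      using fac(4)[of w] D'(3) S(2) R(2) v w by (simp add: D_def z2_def power_mult)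
  qed
qed

end
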